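(* Assume $\lambda_1(-L)\in\sigma_{disc}(-L)$, and that there exists $\kappa>0$ such that the function $W=\frac{V''}{2}+\frac{(V')^2}{4}$ satisfies $W''(x)\ge2\kappa^2$ for all $x\in\mathbb R$. Then $$\lambda_2(-L)-\lambda_1(-L)\ \ge\ 2\kappa .$$
   Context: $V\in C^\infty(\mathbb R)$ with $\int e^{-V}dx<\infty$, $\mu$ the probability measure with density proportional to $e^{-V}$, $Lf=f''-V'f'$ self-adjoint in $L^2(\mu)$ (unique extension from $C_0^\infty(\mathbb R)$). $\sigma_{disc}(-L)$ is the set of isolated eigenvalues of finite multiplicity. For $n\ge1$, $\lambda_n(-L)=\sup_{g_0,\dots,g_{n-1}\in L^2(\mu)}\inf_{f\in D(-L)\setminus\{0\},\,f\perp_\mu g_i}\frac{\int f(-Lf)\,d\mu}{\int f^2d\mu}$ (max-min values; $\lambda_1(-L)$ is the spectral gap, and $\lambda_2(-L)$ may be the bottom of the essential spectrum). *)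

theory Defs
  imports "HOL-Analysis.Analysis"
begin

definition smooth :: "(real \<Rightarrow> real) \<Rightarrow> bool" where
  "smooth f \<longleftrightarrow> (\<forall>n x. ((deriv ^^ n) f) differentiable (at x))"

definition test_fun :: "(real \<Rightarrow> real) \<Rightarrow> bool" where
  "test_fun \<phi> \<longleftrightarrow> smooth \<phi> \<and> (\<exists>R. \<forall>x. \<bar>x\<bar> > R \<longrightarrow> \<phi> x = 0)"

definition Zc :: "(real \<Rightarrow> real) \<Rightarrow> real" where
  "Zc V = (LINT x|lborel. exp (- V x))"

definition mu :: "(real \<Rightarrow> real) \<Rightarrow> real measure" where
  "mu V = density lborel (\<lambda>x. ennreal (exp (- V x) / Zc V))"

text \<open>Membership in L2(mu) (functions taken modulo a.e. equality implicitly).\<close>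
definition L2 :: "(real \<Rightarrow> real) \<Rightarrow> (real \<Rightarrow> real) \<Rightarrow> bool" where
  "L2 V f \<longleftrightarrow> f \<in> borel_measurable borel \<and> integrable (mu V) (\<lambda>x. (f x)\<^sup>2)"

definition Lop :: "(real \<Rightarrow> real) \<Rightarrow> (real \<Rightarrow> real) \<Rightarrow> real \<Rightarrow> real" where
  "Lop V f x = deriv (deriv f) x - deriv V x * deriv f x"

text \<open>Graph of the closure of -L defined on test functions in L2(mu), i.e. of the
  (unique) self-adjoint extension: graph V f g means f \<in> D(-L) and -L f = g.\<close>
definition graph :: "(real \<Rightarrow> real) \<Rightarrow> (real \<Rightarrow> real) \<Rightarrow> (real \<Rightarrow> real) \<Rightarrow> bool" where
  "graph V f g \<longleftrightarrow> L2 V f \<and> L2 V g \<and>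
     (\<exists>\<phi> :: nat \<Rightarrow> real \<Rightarrow> real. (\<forall>n. test_fun (\<phi> n)) \<and>
        (\<lambda>n. LINT x|mu V. (\<phi> n x - f x)\<^sup>2) \<longlonglongrightarrow> 0 \<and>
        (\<lambda>n. LINT x|mu V. (- Lop V (\<phi> n) x - g x)\<^sup>2) \<longlonglongrightarrow> 0)"

text \<open>Max-min values lambda_n(-L), n = number of orthogonality constraints.\<close>
definition lam :: "(real \<Rightarrow> real) \<Rightarrow> nat \<Rightarrow> ereal" where
  "lam V n = (SUP gs \<in> {gs :: nat \<Rightarrow> real \<Rightarrow> real. \<forall>i<n. L2 V (gs i)}.
      INF fg \<in> {(f, g). graph V f g \<and> (LINT x|mu V. (f x)\<^sup>2) > 0 \<and>
                       (\<forall>i<n. (LINT x|mu V. f x * gs i x) = 0)}.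
        ereal ((LINT x|mu V. fst fg x * snd fg x) / (LINT x|mu V. (fst fg x)\<^sup>2)))"

text \<open>Spectrum of the (closed) operator -L: l is in the resolvent set iff -L - l
  is a bijection from D(-L) onto L2(mu) (modulo a.e. equality).\<close>
definition spectrum_L :: "(real \<Rightarrow> real) \<Rightarrow> real set" where
  "spectrum_L V = {l. \<not> ((\<forall>f g. graph V f g \<and> (AE x in mu V. g x = l * f x)
                                 \<longrightarrow> (AE x in mu V. f x = 0)) \<and>
                       (\<forall>h. L2 V h \<longrightarrow> (\<exists>f g. graph V f g \<and>
                                 (AE x in mu V. g x - l * f x = h x))))}"

definition eigfun :: "(real \<Rightarrow> real) \<Rightarrow> real \<Rightarrow> (real \<Rightarrow> real) \<Rightarrow> bool" where
  "eigfun V l f \<longleftrightarrow> (\<exists>g. graph V f g \<and> (AE x in mu V. g x = l * f x))"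

definition sigma_disc :: "(real \<Rightarrow> real) \<Rightarrow> real set" where
  "sigma_disc V = {l. l \<in> spectrum_L V \<and>
      (\<exists>e>0. \<forall>m \<in> spectrum_L V. \<bar>m - l\<bar> < e \<longrightarrow> m = l) \<and>
      (\<exists>f. eigfun V l f \<and> (LINT x|mu V. (f x)\<^sup>2) > 0) \<and>
      (\<exists>k (b :: nat \<Rightarrow> real \<Rightarrow> real). \<forall>f. eigfun V l f \<longrightarrow>
          (\<exists>c :: nat \<Rightarrow> real. AE x in mu V. f x = (\<Sum>i<k. c i * b i x)))}"

end

theory Submission
  imports Defs
begin

text \<open>
  With \<open>\<rho>\<close> the density of \<open>\<mu>\<close>, the nonzero part of the spectrum of \<open>-L\<close> is that of its
  supersymmetric partner \<open>H = -d\<^sup>2/dx\<^sup>2 + W\<close>: a mean-zero test function \<open>\<phi>\<close> corresponds to the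
  compactly supported \<open>v = \<rho>\<^bsup>-1/2\<^esup> \<integral> \<phi> \<rho>\<close>, for which
  \<open>\<integral> \<phi>\<^sup>2 d\<mu> = \<integral> v'\<^sup>2 + W v\<^sup>2\<close>. If \<open>F\<close> is an eigenfunction for
  \<open>\<lambda>\<^sub>1\<close>, then \<open>u = \<rho>\<^bsup>1/2\<^esup> F'\<close> solves \<open>H u = \<lambda>\<^sub>1 u\<close>, and minimality of
  \<open>\<lambda>\<^sub>1\<close> forces \<open>u\<close> to have no zeros. Its logarithmic derivative \<open>-p\<close> satisfies
  \<open>p' = p\<^sup>2 - W + \<lambda>\<^sub>1\<close>, and strong convexity of \<open>W\<close> gives \<open>p' \<ge> \<kappa>\<close>. Passing to the partner
  a second time, now with respect to \<open>u\<^sup>2 dx\<close>, adds the potential \<open>2 p' \<ge> 2 \<kappa>\<close>, which bounds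
  \<open>H - \<lambda>\<^sub>1\<close> below by \<open>2 \<kappa>\<close> on the orthogonal complement of \<open>u\<close>.
\<close>

section \<open>Continuously differentiable functions of compact support\<close>

text \<open>The model is \<open>V x = \<kappa> x^2\<close>: there
  \<open>W x = \<kappa> + \<kappa>^2 x^2\<close> and \<open>p x = \<kappa> x\<close>, so
  \<open>p' = \<kappa>\<close> and the gap is exactly \<open>2 \<kappa>\<close>. In general the
  difficulty sits at infinity: \<open>u\<close> is known only to be square integrable and nothing is
  known about the asymptotics of \<open>p\<close>, so the bound on \<open>p'\<close> is proved by
  contradiction from integrability alone. A second difficulty is that the operator is a closure,
  with no explicit description of its domain. Lower bounds are therefore proved for test functions,
  where integration by parts leaves no boundary terms, and passed to the closure afterwards; only
  the eigenfunction for \<lambda>_1 is studied inside the domain, where it is recovered as a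
  classical solution of the eigenvalue equation. Positivity of \<lambda>_1, without which the
  eigenfunction could be constant and \<open>u\<close> zero, comes from the growth of
  \<open>W\<close>.\<close>

definition C1c :: "(real \<Rightarrow> real) \<Rightarrow> (real \<Rightarrow> real) \<Rightarrow> bool" where
  "C1c f f' \<longleftrightarrow> (\<forall>x. (f has_real_derivative f' x) (at x)) \<and> continuous_on UNIV f' \<and>
     (\<exists>R. \<forall>x. \<bar>x\<bar> > R \<longrightarrow> f x = 0)"

definition C0c :: "(real \<Rightarrow> real) \<Rightarrow> bool" where
  "C0c f \<longleftrightarrow> continuous_on UNIV f \<and> (\<exists>R. \<forall>x. \<bar>x\<bar> > R \<longrightarrow> f x = 0)"

lemma continuous_on_UNIV_DERIV:
  assumes "\<And>x. ((f :: real \<Rightarrow> real) has_real_derivative f' x) (at x)"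
  shows "continuous_on UNIV f"
  using assms by (meson DERIV_isCont continuous_at_imp_continuous_on)

lemma integrable_C0c:
  assumes "C0c f"
  shows "integrable lborel f"
proof -
  obtain R where R: "\<And>x. \<bar>x\<bar> > R \<Longrightarrow> f x = 0" and c: "continuous_on UNIV f"
    using assms unfolding C0c_def by blast
  have "integrable lborel (\<lambda>x. indicator {-R..R} x *\<^sub>R f x)"
    by (rule borel_integrable_compact) (auto intro: continuous_on_subset[OF c])
  moreover have "(\<lambda>x. indicator {-R..R} x *\<^sub>R f x) = f"
  proof
    show "indicator {-R..R} x *\<^sub>R f x = f x" for x
      using R[of x] by (cases "\<bar>x\<bar> > R") (auto split: split_indicator)
  qed
  ultimately show ?thesis by simp
qed

lemma C0c_mult_left:
  assumes "C0c f" "continuous_on UNIV g"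
  shows "C0c (\<lambda>x. g x * f x)"
  using assms unfolding C0c_def by (auto intro!: continuous_intros)

lemma C0c_mult_right:
  assumes "C0c f" "continuous_on UNIV g"
  shows "C0c (\<lambda>x. f x * g x)"
  using C0c_mult_left[OF assms] by (simp add: mult.commute)

lemma C0c_add:
  assumes "C0c f" "C0c g"
  shows "C0c (\<lambda>x. f x + g x)"
proof -
  obtain R S where "\<forall>x. \<bar>x\<bar> > R \<longrightarrow> f x = 0" "\<forall>x. \<bar>x\<bar> > S \<longrightarrow> g x = 0"
    using assms unfolding C0c_def by blast
  hence "\<forall>x. \<bar>x\<bar> > max R S \<longrightarrow> f x + g x = 0" by auto
  thus ?thesis using assms unfolding C0c_def by (intro conjI exI[of _ "max R S"]) (auto intro!: continuous_intros)
qed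

lemma C0c_continuous: "C0c f \<Longrightarrow> continuous_on UNIV f"
  by (simp add: C0c_def)

lemma C0c_diff:
  assumes "C0c f" "C0c g"
  shows "C0c (\<lambda>x. f x - g x)"
  using C0c_add[OF assms(1) C0c_mult_left[OF assms(2), of "\<lambda>_. -1"]] by simp

lemma C0c_power2: "C0c f \<Longrightarrow> C0c (\<lambda>x. (f x)\<^sup>2)"
  by (simp add: power2_eq_square C0c_mult_left C0c_continuous)

lemma C1c_C0c: "C1c f f' \<Longrightarrow> C0c f"
  unfolding C1c_def C0c_def by (metis continuous_on_UNIV_DERIV)

lemma C1c_C0c_deriv:
  assumes "C1c f f'"
  shows "C0c f'"
proof -
  obtain R where R: "\<And>x. \<bar>x\<bar> > R \<Longrightarrow> f x = 0" and d: "\<And>x. (f has_real_derivative f' x) (at x)"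
    and c: "continuous_on UNIV f'"
    using assms unfolding C1c_def by blast
  have "f' x = 0" if "\<bar>x\<bar> > R" for x
  proof -
    have o: "open {x :: real. \<bar>x\<bar> > R}" by (auto intro!: open_Collect_less continuous_intros)
    have "(f has_real_derivative 0) (at x)"
      by (rule DERIV_cong_ev[THEN iffD2, OF refl _ refl, of _ "\<lambda>_. 0"])
        (use R that in \<open>auto intro!: eventually_mono[OF eventually_nhds_in_open[OF o]]\<close>)
    thus ?thesis using d DERIV_unique by blast
  qed
  thus ?thesis using c unfolding C0c_def by blast
qed

lemma C1c_mult:
  assumes f: "C1c f f'" and g: "\<And>x. (g has_real_derivative g' x) (at x)" and g': "continuous_on UNIV g'"
  shows "C1c (\<lambda>x. g x * f x) (\<lambda>x. g' x * f x + g x * f' x)"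
proof -
  have "continuous_on UNIV f'" "continuous_on UNIV g" "continuous_on UNIV f"
    using f g C1c_C0c[OF f] by (auto simp: C1c_def C0c_def intro: continuous_on_UNIV_DERIV)
  thus ?thesis using assms unfolding C1c_def
    by (auto intro!: continuous_intros derivative_eq_intros)
qed

section \<open>Primitives and the fundamental theorem of calculus\<close>

lemma continuous_antiderivative:
  fixes f :: "real \<Rightarrow> real"
  assumes "continuous_on UNIV f"
  obtains F where "\<And>x. (F has_real_derivative f x) (at x)"
  using einterval_antiderivative[of "-\<infinity>" "\<infinity>" f] assms
  by (auto simp: has_real_derivative_iff_has_vector_derivative continuous_on_eq_continuous_at)

lemma integral_Icc_deriv:
  fixes F f :: "real \<Rightarrow> real"
  assumes "a \<le> b" "\<And>x. (F has_real_derivative f x) (at x)" "continuous_on UNIV f"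
  shows "(LINT x|lborel. indicator {a..b} x * f x) = F b - F a"
  using integral_FTC_Icc_real[of a b F f] assms continuous_on_eq_continuous_at[of UNIV f]
  by (auto simp: mult.commute has_real_derivative_iff_has_vector_derivative[symmetric])

lemma integral_deriv_C1c:
  assumes "C1c F f"
  shows "(LINT x|lborel. f x) = 0"
proof -
  obtain R where R: "\<And>x. \<bar>x\<bar> > R \<Longrightarrow> F x = 0" "\<And>x. \<bar>x\<bar> > R \<Longrightarrow> f x = 0"
  proof -
    obtain R S where "\<forall>x. \<bar>x\<bar> > R \<longrightarrow> F x = 0" "\<forall>x. \<bar>x\<bar> > S \<longrightarrow> f x = 0"
      using C1c_C0c[OF assms] C1c_C0c_deriv[OF assms] unfolding C0c_def by blast
    thus ?thesis by (intro that[of "max R S"]) auto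
  qed
  define S where "S = \<bar>R\<bar> + 1"
  have "(LINT x|lborel. indicator {-S..S} x * f x) = F S - F (-S)"
    by (rule integral_Icc_deriv) (use assms in \<open>auto simp: C1c_def S_def\<close>)
  moreover have "(\<lambda>x. indicator {-S..S} x * f x) = f"
    using R(2) by (force simp: fun_eq_iff S_def split: split_indicator)
  ultimately show ?thesis using R(1) by (simp add: S_def)
qed

text \<open>Vanishing total integral is what makes the primitive that is 0 far to the left vanish
  far to the right as well. This is where mean-zero and orthogonality conditions enter.\<close>

lemma C1c_antiderivative:
  assumes g: "C0c g" and "(LINT x|lborel. g x) = 0"
  obtains F where "C1c F g"
proof -
  obtain R where R: "\<And>x. \<bar>x\<bar> > R \<Longrightarrow> g x = 0" and c: "continuous_on UNIV g"
    using g unfolding C0c_def by blast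
  obtain G where G: "\<And>x. (G has_real_derivative g x) (at x)"
    using continuous_antiderivative[OF c] by blast
  define S where "S = \<bar>R\<bar> + 1"
  define F where "F x = G x - G (-S)" for x
  have F: "(F has_real_derivative g x) (at x)" for x
    unfolding F_def using G by (auto intro!: derivative_eq_intros)
  have F0: "F (-S) = 0" by (simp add: F_def)
  have int: "F b - F a = (LINT x|lborel. indicator {a..b} x * g x)" if "a \<le> b" for a b
    using integral_Icc_deriv[OF that F c] by simp
  have "F x = 0" if x: "\<bar>x\<bar> > S" for x
  proof (cases "x > 0")
    case True
    have "(\<lambda>y. indicator {-S..x} y * g y) = g"
      using R x True by (force simp: fun_eq_iff S_def split: split_indicator)
    thus ?thesis using int[of "-S" x] x True F0 assms(2) by (simp add: S_def)
  next
    case False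
    have "(\<lambda>y. indicator {x..-S} y * g y) = (\<lambda>_. 0)"
      using R x False by (force simp: fun_eq_iff S_def split: split_indicator)
    thus ?thesis using int[of x "-S"] x False F0 by (simp add: S_def)
  qed
  hence "C1c F g" using F c unfolding C1c_def by blast
  thus ?thesis by (rule that)
qed

text \<open>Integrating \<open>2 a v v'\<close> by parts turns the left side into the integral of
  \<open>v'^2 + (a' + a^2) v^2\<close>, so two such squares differ only through the Riccati
  expressions \<open>a' + a^2\<close> and \<open>b' + b^2\<close>. Every change of factorisation of
  a Schroedinger operator below is an instance.\<close>

lemma integral_square_riccati:
  assumes v: "C1c v v'"
    and a: "\<And>x. (a has_real_derivative a' x) (at x)" "continuous_on UNIV a'"
    and b: "\<And>x. (b has_real_derivative b' x) (at x)" "continuous_on UNIV b'"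
  shows "(LINT x|lborel. (v' x - a x * v x)\<^sup>2) =
    (LINT x|lborel. (v' x - b x * v x)\<^sup>2) + (LINT x|lborel. (a' x + (a x)\<^sup>2 - b' x - (b x)\<^sup>2) * (v x)\<^sup>2)"
proof -
  have ca: "continuous_on UNIV a" and cb: "continuous_on UNIV b"
    using a b by (auto intro: continuous_on_UNIV_DERIV)
  have v0: "C0c v" "C0c v'" using v C1c_C0c C1c_C0c_deriv by auto
  have "C1c (\<lambda>x. v x * v x) (\<lambda>x. v' x * v x + v x * v' x)"
    using v C1c_mult[OF v, of v v'] by (simp add: C1c_def)
  hence "C1c (\<lambda>x. (b x - a x) * (v x * v x)) (\<lambda>x. (b' x - a' x) * (v x * v x) + (b x - a x) * (v' x * v x + v x * v' x))"
    by (rule C1c_mult) (auto intro!: derivative_eq_intros continuous_intros a b)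
  from integral_deriv_C1c[OF this]
  have 0: "(LINT x|lborel. (b' x - a' x) * (v x * v x) + (b x - a x) * (v' x * v x + v x * v' x)) = 0" .
  have i: "integrable lborel (\<lambda>x. (v' x - b x * v x)\<^sup>2)"
    "integrable lborel (\<lambda>x. (a' x + (a x)\<^sup>2 - b' x - (b x)\<^sup>2) * (v x)\<^sup>2)"
    "integrable lborel (\<lambda>x. (b' x - a' x) * (v x * v x) + (b x - a x) * (v' x * v x + v x * v' x))"
    using v0 a b ca cb C0c_continuous[OF v0(1)]
    by (auto intro!: integrable_C0c C0c_power2 C0c_diff C0c_mult_left C0c_add continuous_intros)
  have "(LINT x|lborel. (v' x - a x * v x)\<^sup>2) =
    (LINT x|lborel. (v' x - b x * v x)\<^sup>2 + (a' x + (a x)\<^sup>2 - b' x - (b x)\<^sup>2) * (v x)\<^sup>2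
       + ((b' x - a' x) * (v x * v x) + (b x - a x) * (v' x * v x + v x * v' x)))"
    by (rule Bochner_Integration.integral_cong) (auto simp: power2_eq_square algebra_simps)
  also have "\<dots> = (LINT x|lborel. (v' x - b x * v x)\<^sup>2)
      + (LINT x|lborel. (a' x + (a x)\<^sup>2 - b' x - (b x)\<^sup>2) * (v x)\<^sup>2) + 0"
    using i 0 by (simp add: Bochner_Integration.integral_add)
  finally show ?thesis by simp
qed

text \<open>The last conclusion is the duality between the two partner operators: expand
  \<open>\<integral> (h' s + c w)\<^sup>2 \<ge> 0\<close> and integrate the mixed term by parts.\<close>

lemma partner_function:
  assumes h: "C1c h h'" and s: "\<And>x. (s has_real_derivative - r x * s x) (at x)" "\<And>x. s x \<noteq> 0"
    and r: "continuous_on UNIV r"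
    and mean: "(LINT x|lborel. h x * (s x)\<^sup>2) = 0"
  obtains w w' where "C1c w w'" "\<And>x. w' x - r x * w x = h x * s x"
    "C1c (\<lambda>x. s x * w x) (\<lambda>x. h x * (s x)\<^sup>2)"
    "\<And>c. c > 0 \<Longrightarrow> c * (LINT x|lborel. (w x)\<^sup>2) \<le> (LINT x|lborel. (h x * s x)\<^sup>2) \<Longrightarrow>
       c * (LINT x|lborel. (h x * s x)\<^sup>2) \<le> (LINT x|lborel. (h' x * s x)\<^sup>2)"
proof -
  have cs: "continuous_on UNIV s" using s(1) by (rule continuous_on_UNIV_DERIV)
  have h0: "C0c h" "C0c h'" using h C1c_C0c C1c_C0c_deriv by auto
  have g0: "C0c (\<lambda>x. h x * (s x)\<^sup>2)"
    using h0 cs by (intro C0c_mult_right continuous_intros)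
  obtain T where T: "C1c T (\<lambda>x. h x * (s x)\<^sup>2)"
    using C1c_antiderivative[OF g0 mean] .
  \<comment> \<open>With \<open>A = d/dx - r\<close> and its formal adjoint
    \<open>B = - d/dx - r\<close>, this \<open>w\<close> solves \<open>A w = h s\<close>, while
    \<open>h' s = - B (h s)\<close>. The last conclusion thus passes a lower bound for
    \<open>A\<close> at \<open>w\<close> on to \<open>B\<close> at \<open>A w\<close>.\<close>
  define w where "w x = inverse (s x) * T x" for x
  define w' where "w' x = r x * inverse (s x) * T x + inverse (s x) * (h x * (s x)\<^sup>2)" for x
  have w: "C1c w w'" unfolding w_def w'_def
    by (rule C1c_mult[OF T])
      (use s r cs in \<open>auto intro!: derivative_eq_intros continuous_intros simp: power2_eq_square\<close>)
  have sw: "s x * w x = T x" for x using s(2) by (simp add: w_def)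
  have w0: "C0c w" using w C1c_C0c by auto
  have eq: "w' x - r x * w x = h x * s x" for x
    using s(2)[of x] by (simp add: w_def w'_def power2_eq_square)
  have parts: "(LINT x|lborel. h' x * s x * w x) = - (LINT x|lborel. (h x * s x)\<^sup>2)"
  proof -
    have "C1c (\<lambda>x. h x * T x) (\<lambda>x. h' x * T x + h x * (h x * (s x)\<^sup>2))"
      by (rule C1c_mult[OF T]) (use h in \<open>auto simp: C1c_def\<close>)
    from integral_deriv_C1c[OF this]
    have "0 = (LINT x|lborel. h' x * s x * w x + (h x * s x)\<^sup>2)"
      by (simp add: sw[symmetric] power2_eq_square mult_ac)
    also have "\<dots> = (LINT x|lborel. h' x * s x * w x) + (LINT x|lborel. (h x * s x)\<^sup>2)"
      using h0 w0 cs C0c_continuous[OF w0]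
      by (intro Bochner_Integration.integral_add integrable_C0c C0c_power2 C0c_mult_right)
    finally show ?thesis by simp
  qed
  have "c * (LINT x|lborel. (h x * s x)\<^sup>2) \<le> (LINT x|lborel. (h' x * s x)\<^sup>2)"
    if "c > 0" and le: "c * (LINT x|lborel. (w x)\<^sup>2) \<le> (LINT x|lborel. (h x * s x)\<^sup>2)" for c
  proof -
    have i: "integrable lborel (\<lambda>x. (h' x * s x)\<^sup>2)" "integrable lborel (\<lambda>x. h' x * s x * w x)"
      "integrable lborel (\<lambda>x. (w x)\<^sup>2)"
      using h0 w0 cs C0c_continuous[OF w0] by (auto intro!: integrable_C0c C0c_power2 C0c_mult_right)
    have "0 \<le> (LINT x|lborel. (h' x * s x + c * w x)\<^sup>2)" by simp
    also have "\<dots> = (LINT x|lborel. (h' x * s x)\<^sup>2 + 2 * c * (h' x * s x * w x) + c\<^sup>2 * (w x)\<^sup>2)"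
      by (rule Bochner_Integration.integral_cong) (auto simp: power2_eq_square algebra_simps)
    also have "\<dots> = (LINT x|lborel. (h' x * s x)\<^sup>2) - 2 * c * (LINT x|lborel. (h x * s x)\<^sup>2)
        + c * (c * (LINT x|lborel. (w x)\<^sup>2))"
      using i parts by (simp add: power2_eq_square)
    also have "\<dots> \<le> (LINT x|lborel. (h' x * s x)\<^sup>2) - 2 * c * (LINT x|lborel. (h x * s x)\<^sup>2)
        + c * (LINT x|lborel. (h x * s x)\<^sup>2)"
      using le \<open>c > 0\<close> by (intro add_left_mono mult_left_mono) auto
    finally show ?thesis by simp
  qed
  thus ?thesis using that[OF w eq] T by (simp add: sw)
qed

section \<open>Lower bound for the Riccati equation\<close>

text \<open>The integral of \<open>y\<close> stays bounded, so integrating the inequality once makes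
  \<open>y1\<close> grow at least linearly; then \<open>y\<close> grows too, contrary to
  integrability.\<close>

lemma no_positive_tail:
  fixes y :: "real \<Rightarrow> real"
  assumes y: "integrable lborel y" "\<And>x. y x \<ge> 0"
    and d: "\<And>x. (y has_real_derivative y1 x) (at x)" "\<And>x. (y1 has_real_derivative y2 x) (at x)"
    and "e > 0" and k: "k > 0" and ge: "\<And>x. x \<ge> x0 \<Longrightarrow> y2 x \<ge> e - k * y x"
  shows False
proof -
  have cy: "continuous_on UNIV y" using d(1) by (rule continuous_on_UNIV_DERIV)
  obtain Y where Y: "\<And>x. (Y has_real_derivative y x) (at x)"
    using continuous_antiderivative[OF cy] by blast
  define I where "I = (LINT x|lborel. y x)"
  have YI: "Y b - Y a \<le> I" if "a \<le> b" for a b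
  proof -
    have "Y b - Y a = (LINT x|lborel. indicator {a..b} x * y x)"
      using integral_Icc_deriv[OF that Y cy] by simp
    also have "\<dots> \<le> I" unfolding I_def
      using y integrable_real_mult_indicator[of "{a..b}" lborel y]
      by (intro integral_mono) (auto split: split_indicator simp: mult.commute)
    finally show ?thesis .
  qed
  have I0: "I \<ge> 0" using YI[of 0 0] by simp
  have y1: "y1 x \<ge> y1 x0 - k * I + e * (x - x0)" if "x \<ge> x0" for x
  proof -
    have "y1 x0 + k * Y x0 - e * x0 \<le> y1 x + k * Y x - e * x"
    proof (rule DERIV_nonneg_imp_nondecreasing[OF that, of "\<lambda>x. y1 x + k * Y x - e * x"])
      fix t assume "x0 \<le> t" "t \<le> x"
      thus "\<exists>z. ((\<lambda>x. y1 x + k * Y x - e * x) has_real_derivative z) (at t) \<and> 0 \<le> z"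
        using ge[of t] by (intro exI[of _ "y2 t + k * y t - e"]) (auto intro!: derivative_eq_intros d Y)
    qed
    moreover have "k * (Y x - Y x0) \<le> k * I" using YI[OF that] k by simp
    ultimately show ?thesis by (simp add: algebra_simps)
  qed
  \<comment> \<open>From here on the linear lower bound for \<open>y1\<close> is at least 1.\<close>
  define x1 where "x1 = x0 + max 0 ((1 - y1 x0 + k * I) / e)"
  have y11: "y1 x \<ge> 1" if "x \<ge> x1" for x
  proof -
    have "x - x0 \<ge> (1 - y1 x0 + k * I) / e" "x \<ge> x0" using that by (auto simp: x1_def)
    hence "e * (x - x0) \<ge> 1 - y1 x0 + k * I" using \<open>e > 0\<close> by (simp add: field_simps)
    thus ?thesis using y1[OF \<open>x \<ge> x0\<close>] by simp
  qed
  have yx: "y x \<ge> x - x1" if "x \<ge> x1" for x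
  proof -
    have "y x1 - x1 \<le> y x - x"
      by (rule DERIV_nonneg_imp_nondecreasing[OF that, of "\<lambda>x. y x - x"])
        (use y11 in \<open>force intro!: derivative_eq_intros d\<close>)
    thus ?thesis using y(2)[of x1] by simp
  qed
  \<comment> \<open>Right of \<open>x1 + 1\<close> one has \<open>y \<ge> 1\<close>, so an interval
    of length \<open>1 + I\<close> already carries more than the total integral
    \<open>I\<close>.\<close>
  have "Y (x1 + 1) - (x1 + 1) \<le> Y (x1 + 2 + I) - (x1 + 2 + I)"
  proof (rule DERIV_nonneg_imp_nondecreasing[of "x1+1" "x1+2+I" "\<lambda>x. Y x - x"])
    fix t assume "x1 + 1 \<le> t"
    thus "\<exists>z. ((\<lambda>x. Y x - x) has_real_derivative z) (at t) \<and> 0 \<le> z"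
      using yx[of t] by (intro exI[of _ "y t - 1"]) (auto intro!: derivative_eq_intros Y)
  qed (use I0 in auto)
  thus False using YI[of "x1 + 1" "x1 + 2 + I"] I0 by simp
qed

text \<open>With \<open>q = p'\<close>, the quantities \<open>K = (q - k) u\<^sup>2\<close> and \<open>z = 2 k p - W'\<close> satisfy
  \<open>K' = z u\<^sup>2\<close> and \<open>z' \<le> 2 k K / u\<^sup>2\<close>. Hence if \<open>K < 0\<close> and \<open>z \<le> 0\<close> at one
  point, \<open>K\<close> stays below a negative constant to the right of it, and then \<open>u\<^sup>2\<close> cannot be
  integrable there. If \<open>z > 0\<close> the same happens to the left.\<close>

lemma riccati_lower_bound_right:
  fixes u p W W1 W2 :: "real \<Rightarrow> real"
  assumes u: "\<And>x. u x \<noteq> 0" "\<And>x. (u has_real_derivative - p x * u x) (at x)"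
      "integrable lborel (\<lambda>x. (u x)\<^sup>2)"
    and p: "\<And>x. (p has_real_derivative (p x)\<^sup>2 - W x + l) (at x)"
    and W: "\<And>x. (W has_real_derivative W1 x) (at x)" "\<And>x. (W1 has_real_derivative W2 x) (at x)"
      "\<And>x. W2 x \<ge> 2 * k\<^sup>2" and k: "k > 0"
    and x0: "2 * k * p x0 - W1 x0 \<le> 0"
  shows "(p x0)\<^sup>2 - W x0 + l \<ge> k"
proof (rule ccontr)
  assume neg: "\<not> ?thesis"
  define q where "q x = (p x)\<^sup>2 - W x + l" for x
  define K where "K x = (q x - k) * (u x)\<^sup>2" for x
  define z where "z x = 2 * k * p x - W1 x" for x
  have q: "(q has_real_derivative 2 * p x * q x - W1 x) (at x)" for x
    unfolding q_def by (auto intro!: derivative_eq_intros p W)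
  have u2: "((\<lambda>x. (u x)\<^sup>2) has_real_derivative - 2 * p x * (u x)\<^sup>2) (at x)" for x
    by (auto intro!: derivative_eq_intros u simp: power2_eq_square)
  have K: "(K has_real_derivative z x * (u x)\<^sup>2) (at x)" for x
    using DERIV_mult[OF DERIV_diff[OF q DERIV_const[of k]] u2]
    unfolding K_def z_def by (simp add: algebra_simps)
  have z: "(z has_real_derivative 2 * k * q x - W2 x) (at x)" for x
    unfolding z_def q_def by (auto intro!: derivative_eq_intros W p)
  have Ksign: "K x < 0 \<longleftrightarrow> q x < k" for x
    using u(1)[of x] by (auto simp: K_def mult_less_0_iff)
  have z': "2 * k * q x - W2 x \<le> 0" if "K x < 0" for x
  proof -
    have "2 * k * q x \<le> 2 * k * k" using that k Ksign by (intro mult_left_mono) auto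
    thus ?thesis using W(3)[of x] by (simp add: power2_eq_square)
  qed
  have K0: "K x0 < 0" using neg Ksign q_def by simp
  \<comment> \<open>Negativity of \<open>K\<close> is required only strictly before
    \<open>b\<close>, yet the bound holds at \<open>b\<close> itself: hence there can be no first
    point where \<open>K\<close> is nonnegative.\<close>
  have step: "K b \<le> K x0 \<and> z b \<le> 0" if "b \<ge> x0" and neg': "\<And>t. x0 \<le> t \<Longrightarrow> t < b \<Longrightarrow> K t < 0" for b
  proof -
    have cz: "continuous_on S z" for S
      using continuous_on_subset[OF continuous_on_UNIV_DERIV[OF z]] by blast
    have zt: "z t \<le> 0" if t: "x0 \<le> t" "t \<le> b" for t
    proof -
      have "z t \<le> z x0"
      proof (rule DERIV_nonpos_imp_decreasing_open[OF t(1) _ cz])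
        fix a assume "x0 < a" "a < t"
        hence "K a < 0" using neg' t by simp
        thus "\<exists>y. (z has_real_derivative y) (at a) \<and> y \<le> 0" using z z' by blast
      qed
      thus ?thesis using x0 by (simp add: z_def)
    qed
    have "K b \<le> K x0"
    proof (rule DERIV_nonpos_imp_nonincreasing[OF \<open>b \<ge> x0\<close>])
      fix a assume "x0 \<le> a" "a \<le> b"
      hence "z a * (u a)\<^sup>2 \<le> 0" using zt by (simp add: mult_le_0_iff)
      thus "\<exists>y. (K has_real_derivative y) (at a) \<and> y \<le> 0" using K by blast
    qed
    thus ?thesis using zt[of b] \<open>b \<ge> x0\<close> by simp
  qed
  have Kneg: "K b < 0" if "b \<ge> x0" for b
  proof (rule ccontr)
    assume "\<not> K b < 0"
    define A where "A = {x0..b} \<inter> {x. 0 \<le> K x}"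
    have "closed {x. 0 \<le> K x}"
      using continuous_on_UNIV_DERIV[OF K] by (intro closed_Collect_le continuous_intros) auto
    hence "compact A" unfolding A_def by (intro compact_Int_closed) auto
    moreover have "b \<in> A" using that \<open>\<not> K b < 0\<close> by (simp add: A_def)
    ultimately obtain c where c: "c \<in> A" "\<And>t. t \<in> A \<Longrightarrow> c \<le> t"
      using compact_attains_inf[of A] by blast
    have "K t < 0" if "x0 \<le> t" "t < c" for t
    proof (rule ccontr)
      assume "\<not> K t < 0"
      hence "t \<in> A" using that c(1) by (auto simp: A_def)
      thus False using c(2) that by fastforce
    qed
    hence "K c \<le> K x0" using step[of c] c(1) by (auto simp: A_def)
    thus False using K0 c(1) by (simp add: A_def)
  qed
  have Kle: "K b \<le> K x0" if "b \<ge> x0" for b using step[OF that] Kneg by auto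
  show False
  \<comment> \<open>For \<open>y = u^2\<close> the second derivative is
    \<open>4 p^2 u^2 - 2 q u^2\<close>. Dropping the first term, writing
    \<open>q u^2 = K + k u^2\<close> and using \<open>K \<le> K x0\<close> leaves
    \<open>- 2 K x0 - 2 k y\<close>.\<close>
  proof (rule no_positive_tail[OF u(3) _ u2])
    show "((\<lambda>x. - 2 * p x * (u x)\<^sup>2) has_real_derivative
        - 2 * q x * (u x)\<^sup>2 + - 2 * p x * (- 2 * p x * (u x)\<^sup>2)) (at x)" for x
      unfolding q_def by (rule derivative_eq_intros u2 p | simp)+
    show "- 2 * K x0 - 2 * k * (u x)\<^sup>2 \<le> - 2 * q x * (u x)\<^sup>2 + - 2 * p x * (- 2 * p x * (u x)\<^sup>2)"
      if "x \<ge> x0" for x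
    proof -
      have "0 \<le> (p x * u x)\<^sup>2" by simp
      thus ?thesis using Kle[OF that] unfolding K_def[of x] by (simp add: algebra_simps power2_eq_square)
    qed
    show "0 < - 2 * K x0" "2 * k > 0" using K0 k by auto
  qed auto
qed

text \<open>The reflection \<open>x -> - x\<close> changes the sign of \<open>p\<close> and
  \<open>W1\<close>, hence of \<open>2 k p - W1\<close>, and preserves the other hypotheses, so the
  remaining sign reduces to the one-sided lemma.\<close>

lemma riccati_lower_bound:
  fixes u p W W1 W2 :: "real \<Rightarrow> real"
  assumes u: "\<And>x. u x \<noteq> 0" "\<And>x. (u has_real_derivative - p x * u x) (at x)"
      "integrable lborel (\<lambda>x. (u x)\<^sup>2)"
    and p: "\<And>x. (p has_real_derivative (p x)\<^sup>2 - W x + l) (at x)"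
    and W: "\<And>x. (W has_real_derivative W1 x) (at x)" "\<And>x. (W1 has_real_derivative W2 x) (at x)"
      "\<And>x. W2 x \<ge> 2 * k\<^sup>2" and k: "k > 0"
  shows "(p x0)\<^sup>2 - W x0 + l \<ge> k"
proof (cases "2 * k * p x0 - W1 x0 \<le> 0")
  case True
  show ?thesis by (rule riccati_lower_bound_right[OF u p W k True])
next
  case False
  have refl: "((\<lambda>x. f (- x)) has_real_derivative - f' (- x)) (at x)"
    if "\<And>x. (f has_real_derivative f' x) (at x)" for f f' :: "real \<Rightarrow> real" and x
  proof -
    have "(uminus has_real_derivative -1) (at x)"
      using DERIV_minus[OF DERIV_ident[of "at x"]] by simp
    thus ?thesis
      using DERIV_chain2[where f=f and g=uminus and x=x and s=UNIV and Da="f' (-x)" and Db="-1"] that by simp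
  qed
  have "(- p (- (- x0)))\<^sup>2 - W (- (- x0)) + l \<ge> k"
  proof (rule riccati_lower_bound_right[where u="\<lambda>x. u (-x)" and p="\<lambda>x. - p (-x)" and W="\<lambda>x. W (-x)"
        and ?W1.0="\<lambda>x. - W1 (-x)" and ?W2.0="\<lambda>x. W2 (-x)"])
    show "integrable lborel (\<lambda>x. (u (- x))\<^sup>2)"
      using lborel_integrable_real_affine[OF u(3), of "-1" 0] by simp
    show "((\<lambda>x. - p (- x)) has_real_derivative (- p (- x))\<^sup>2 - W (- x) + l) (at x)" for x
      using DERIV_minus[OF refl[OF p]] by (simp add: algebra_simps)
    show "((\<lambda>x. u (- x)) has_real_derivative - (- p (- x)) * u (- x)) (at x)" for x
      using refl[OF u(2)] by simp
    show "((\<lambda>x. - W1 (- x)) has_real_derivative W2 (- x)) (at x)" for x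
      using DERIV_minus[OF refl[OF W(2)]] by simp
    show "((\<lambda>x. W (- x)) has_real_derivative - W1 (- x)) (at x)" for x
      using refl[OF W(1)] by simp
  qed (use False u W k in auto)
  thus ?thesis by simp
qed

section \<open>Smooth functions and cutoffs\<close>

text \<open>\<open>smooth\<close> applies the next \<open>deriv\<close> on the outside of an
  iterate, which does not fit the sum, product and chain rules. Peeling one derivative off the
  inside lets the closure properties go by induction on the order with the functions kept
  general.\<close>

primrec diff_upto :: "nat \<Rightarrow> (real \<Rightarrow> real) \<Rightarrow> bool" where
  "diff_upto 0 f \<longleftrightarrow> (\<forall>x. f differentiable at x)"
| "diff_upto (Suc n) f \<longleftrightarrow> (\<forall>x. f differentiable at x) \<and> diff_upto n (deriv f)"

lemma diff_upto_funpow: "diff_upto n f \<Longrightarrow> (deriv ^^ n) f differentiable at x"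
  by (induction n arbitrary: f) (auto simp del: funpow.simps simp: funpow_Suc_right)

lemma smooth_deriv: "smooth f \<Longrightarrow> smooth (deriv f)"
  unfolding smooth_def by (metis comp_apply funpow_Suc_right)

lemma smooth_differentiable: "smooth f \<Longrightarrow> f differentiable at x"
  unfolding smooth_def by (metis funpow_0)

lemma smooth_imp_diff_upto: "smooth f \<Longrightarrow> diff_upto n f"
  by (induction n arbitrary: f) (auto intro: smooth_deriv smooth_differentiable)

lemma smooth_iff_diff_upto: "smooth f \<longleftrightarrow> (\<forall>n. diff_upto n f)"
  by (meson smooth_imp_diff_upto diff_upto_funpow smooth_def)

lemma diff_upto_Suc_D: "diff_upto (Suc n) f \<Longrightarrow> diff_upto n f"
  by (induction n arbitrary: f) auto

lemma diff_upto_SucI: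
  assumes "\<And>x. (f has_real_derivative f' x) (at x)" "diff_upto n f'"
  shows "diff_upto (Suc n) f"
proof -
  have "deriv f = f'" using assms(1) DERIV_imp_deriv by blast
  thus ?thesis using assms real_differentiable_def by auto
qed

lemma smooth_DERIV: "smooth f \<Longrightarrow> (f has_real_derivative deriv f x) (at x)"
  using smooth_differentiable DERIV_deriv_iff_real_differentiable by blast

lemma smooth_if_deriv_smooth:
  assumes "\<And>x. (f has_real_derivative f' x) (at x)" "smooth f'"
  shows "smooth f"
  unfolding smooth_iff_diff_upto
  using diff_upto_SucI[OF assms(1)] assms(2) diff_upto_Suc_D smooth_imp_diff_upto by blast

lemma diff_upto_add: "diff_upto n f \<Longrightarrow> diff_upto n g \<Longrightarrow> diff_upto n (\<lambda>x. f x + g x)"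
proof (induction n arbitrary: f g)
  case (Suc n)
  have "((\<lambda>x. f x + g x) has_real_derivative deriv f x + deriv g x) (at x)" for x
    using Suc.prems by (intro DERIV_add) (auto simp: DERIV_deriv_iff_real_differentiable)
  thus ?case by (rule diff_upto_SucI) (use Suc in auto)
qed auto

lemma diff_upto_mult: "diff_upto n f \<Longrightarrow> diff_upto n g \<Longrightarrow> diff_upto n (\<lambda>x. f x * g x)"
proof (induction n arbitrary: f g)
  case (Suc n)
  have "((\<lambda>x. f x * g x) has_real_derivative deriv f x * g x + deriv g x * f x) (at x)" for x
    using Suc.prems by (intro DERIV_mult) (auto simp: DERIV_deriv_iff_real_differentiable)
  thus ?case
    by (rule diff_upto_SucI)
      (use Suc.prems in \<open>auto intro!: diff_upto_add Suc.IH intro: diff_upto_Suc_D[of n f] diff_upto_Suc_D[of n g]\<close>)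
qed auto

lemma smooth_const: "smooth (\<lambda>_. c)"
proof -
  have "(deriv ^^ n) (\<lambda>_. c) = (if n = 0 then (\<lambda>_. c) else (\<lambda>_. 0))" for n
    by (induction n) auto
  thus ?thesis by (simp add: smooth_def)
qed

lemma smooth_add: "smooth f \<Longrightarrow> smooth g \<Longrightarrow> smooth (\<lambda>x. f x + g x)"
  and smooth_mult: "smooth f \<Longrightarrow> smooth g \<Longrightarrow> smooth (\<lambda>x. f x * g x)"
  unfolding smooth_iff_diff_upto by (auto intro: diff_upto_add diff_upto_mult)

lemma diff_upto_affine: "diff_upto n f \<Longrightarrow> diff_upto n (\<lambda>x. f (a * x + b))"
proof (induction n arbitrary: f)
  case 0
  have "((\<lambda>x. f (a * x + b)) has_real_derivative deriv f (a * x + b) * a) (at x)" for x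
    by (rule DERIV_chain2[where f=f and g="\<lambda>x. a * x + b"])
      (use 0 in \<open>auto simp: DERIV_deriv_iff_real_differentiable intro!: derivative_eq_intros\<close>)
  thus ?case using real_differentiable_def by auto
next
  case (Suc n)
  have "((\<lambda>x. f (a * x + b)) has_real_derivative deriv f (a * x + b) * a) (at x)" for x
    by (rule DERIV_chain2[where f=f and g="\<lambda>x. a * x + b"])
      (use Suc.prems in \<open>auto simp: DERIV_deriv_iff_real_differentiable intro!: derivative_eq_intros\<close>)
  thus ?case
    by (rule diff_upto_SucI)
      (use Suc in \<open>auto intro!: diff_upto_mult smooth_imp_diff_upto[OF smooth_const]\<close>)
qed

lemma smooth_affine: "smooth f \<Longrightarrow> smooth (\<lambda>x. f (a * x + b))"
  unfolding smooth_iff_diff_upto by (auto intro: diff_upto_affine)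

lemma smooth_real_polynomial_function:
  assumes "real_polynomial_function p"
  shows "smooth p"
proof -
  have "diff_upto n p" for n
    using assms
  proof (induction n arbitrary: p)
    case 0
    thus ?case using has_real_derivative_polynomial_function real_differentiable_def
      by (metis diff_upto.simps(1))
  next
    case (Suc n)
    then obtain p' where "real_polynomial_function p'" "\<forall>x. (p has_real_derivative p' x) (at x)"
      using has_real_derivative_polynomial_function by metis
    thus ?case using Suc.IH diff_upto_SucI by blast
  qed
  thus ?thesis by (simp add: smooth_iff_diff_upto)
qed

text \<open>The powers of \<open>1 / x\<close> make the family closed under differentiation up to
  linear combinations; \<open>k = 0\<close> is the classical smooth function that is flat at
  0.\<close>

definition flat_exp :: "nat \<Rightarrow> real \<Rightarrow> real" where
  "flat_exp k x = (if x > 0 then (1 / x) ^ k * exp (- (1 / x)) else 0)"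

lemma flat_exp_tendsto_0: "(flat_exp k \<longlongrightarrow> 0) (at 0)"
proof -
  have "((\<lambda>x. (1 / x) ^ k / exp (1 / x)) \<longlongrightarrow> (0::real)) (at_right 0)"
    using filterlim_compose[OF tendsto_power_div_exp_0 filterlim_inverse_at_top_right]
    by (simp add: inverse_eq_divide)
  hence "(flat_exp k \<longlongrightarrow> 0) (at_right 0)"
    by (rule Lim_transform_eventually)
      (auto simp: eventually_at_right_field flat_exp_def exp_minus field_simps intro!: exI[of _ 1])
  moreover have "(flat_exp k \<longlongrightarrow> 0) (at_left 0)"
    by (rule Lim_transform_eventually[OF tendsto_const])
      (auto simp: eventually_at_left_field flat_exp_def intro!: exI[of _ "-1"])
  ultimately show ?thesis by (simp add: filterlim_split_at)
qed

lemma flat_exp_DERIV: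
  "(flat_exp k has_real_derivative flat_exp (k + 2) x - real k * flat_exp (k + 1) x) (at x)"
proof (cases x "0 :: real" rule: linorder_cases)
  case greater
  have "((\<lambda>x. (1 / x) ^ k * exp (- (1 / x))) has_real_derivative
      flat_exp (k + 2) x - real k * flat_exp (k + 1) x) (at x)"
    using greater by (cases k)
      (auto intro!: derivative_eq_intros simp: flat_exp_def power2_eq_square field_simps,
       metis Suc_pred neq0_conv power_Suc)
  thus ?thesis
    by (rule DERIV_cong_ev[THEN iffD1, rotated 3])
      (use greater in \<open>auto simp: flat_exp_def intro!: eventually_mono[OF eventually_nhds_in_open[of "{0<..}"]]\<close>)
next
  case less
  have "((\<lambda>x. 0) has_real_derivative flat_exp (k + 2) x - real k * flat_exp (k + 1) x) (at x)"
    using less by (auto simp: flat_exp_def)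
  thus ?thesis
    by (rule DERIV_cong_ev[THEN iffD1, rotated 3])
      (use less in \<open>auto simp: flat_exp_def intro!: eventually_mono[OF eventually_nhds_in_open[of "{..<0}"]]\<close>)
next
  case equal
  \<comment> \<open>At 0 the difference quotient of \<open>flat_exp k\<close> is
    \<open>flat_exp (Suc k)\<close> itself.\<close>
  have "((\<lambda>h. (flat_exp k (0 + h) - flat_exp k 0) / h) \<longlongrightarrow> 0) (at 0)"
    using flat_exp_tendsto_0[of "Suc k"]
    by (rule Lim_transform_eventually) (auto simp: flat_exp_def intro!: always_eventually)
  thus ?thesis using equal by (simp add: DERIV_def flat_exp_def)
qed

lemma smooth_flat_exp: "smooth (flat_exp k)"
proof -
  have "diff_upto n (flat_exp k)" for n
  proof (induction n arbitrary: k)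
    case 0
    thus ?case using flat_exp_DERIV real_differentiable_def by (metis diff_upto.simps(1))
  next
    case (Suc n)
    have "diff_upto n (\<lambda>x. flat_exp (k + 2) x + (- real k) * flat_exp (k + 1) x)"
      by (intro diff_upto_add diff_upto_mult Suc smooth_imp_diff_upto[OF smooth_const])
    thus ?case using flat_exp_DERIV by (intro diff_upto_SucI) auto
  qed
  thus ?thesis by (simp add: smooth_iff_diff_upto)
qed

lemma smooth_step:
  obtains B B' C where "smooth B" "\<And>x. (B has_real_derivative B' x) (at x)" "continuous_on UNIV B'"
    "\<And>x. x \<le> 0 \<Longrightarrow> B x = 0" "\<And>x. x \<ge> 1 \<Longrightarrow> B x = 1"
    "\<And>x. 0 \<le> B x" "\<And>x. B x \<le> 1" "\<And>x. \<bar>B' x\<bar> \<le> C"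
proof -
  \<comment> \<open>A smooth bump, positive exactly on the open unit interval; the step is its
    primitive divided by its total integral \<open>D\<close>.\<close>
  define b where "b x = flat_exp 0 x * flat_exp 0 (-1 * x + 1)" for x
  have b: "smooth b" unfolding b_def by (intro smooth_mult smooth_flat_exp smooth_affine)
  have cb: "continuous_on UNIV b" using smooth_DERIV[OF b] by (rule continuous_on_UNIV_DERIV)
  have b0: "b x \<ge> 0" for x by (simp add: b_def flat_exp_def)
  have bpos: "b x > 0" if "0 < x" "x < 1" for x using that by (simp add: b_def flat_exp_def)
  have bz: "b x = 0" if "x \<le> 0 \<or> x \<ge> 1" for x using that by (auto simp: b_def flat_exp_def)
  obtain G where G: "\<And>x. (G has_real_derivative b x) (at x)"
    using continuous_antiderivative[OF cb] by blast
  have mono: "G x \<le> G y" if "x \<le> y" for x y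
    by (rule DERIV_nonneg_imp_nondecreasing[OF that]) (use G b0 in blast)
  have "G 0 < G 1"
    by (rule DERIV_pos_imp_increasing_open[of 0 1 G])
      (use G bpos in \<open>auto intro!: continuous_on_subset[OF continuous_on_UNIV_DERIV[OF G]]\<close>)
  define D where "D = G 1 - G 0"
  have D: "D > 0" using \<open>G 0 < G 1\<close> by (simp add: D_def)
  define B where "B x = (G x - G 0) / D" for x
  have left: "G x = G 0" if "x \<le> 0" for x
  proof (rule antisym)
    show "G 0 \<le> G x"
      by (rule DERIV_nonpos_imp_nonincreasing[OF that]) (use G bz in fastforce)
  qed (use mono that in auto)
  have right: "G x = G 1" if "x \<ge> 1" for x
  proof (rule antisym)
    show "G x \<le> G 1"
      by (rule DERIV_nonpos_imp_nonincreasing[OF that]) (use G bz in fastforce)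
  qed (use mono that in auto)
  have bnd: "G 0 \<le> G x" "G x \<le> G 1" for x
    using mono[of 0 x] mono[of x 1] left[of x] right[of x] \<open>G 0 < G 1\<close> by linarith+
  obtain M where M: "\<And>x. x \<in> {0..1} \<Longrightarrow> b x \<le> M"
    using continuous_attains_sup[of "{0..1}" b] continuous_on_subset[OF cb] by (metis atLeastatMost_empty_iff compact_Icc subset_UNIV zero_less_one_class.zero_le_one)
  have M': "b x \<le> M" for x
    using M[of x] M[of 0] bz[of x] b0[of 0] by fastforce
  show ?thesis
  proof (rule that[of B "\<lambda>x. b x / D" "M / D"])
    show dB: "(B has_real_derivative b x / D) (at x)" for x
      unfolding B_def using D by (auto intro!: derivative_eq_intros G)
    have "smooth (\<lambda>x. b x * (1 / D))" by (intro smooth_mult b smooth_const)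
    thus "smooth B" by (intro smooth_if_deriv_smooth[OF dB]) simp
    show "continuous_on UNIV (\<lambda>x. b x / D)" using D cb by (intro continuous_intros) auto
    show "B x = 0" if "x \<le> 0" for x using left[OF that] by (simp add: B_def)
    show "B x = 1" if "x \<ge> 1" for x using right[OF that] D by (simp add: B_def D_def)
    show "0 \<le> B x" "B x \<le> 1" for x using bnd[of x] D by (auto simp: B_def D_def)
    show "\<bar>b x / D\<bar> \<le> M / D" for x using D b0[of x] M'[of x] by (simp add: divide_right_mono)
  qed
qed

text \<open>All cutoffs are built from shifted copies of one step, with transition zones of fixed
  width 1, so their derivatives are bounded independently of \<open>n\<close>, as dominated
  convergence will require.\<close>

lemma smooth_cutoffs:
  obtains cut cut' C where "\<And>n::nat. test_fun (cut n)" "\<And>n x. (cut n has_real_derivative cut' n x) (at x)"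
    "\<And>n. continuous_on UNIV (cut' n)"
    "\<And>n x. \<bar>x\<bar> \<le> real n \<Longrightarrow> cut n x = 1" "\<And>n x. \<bar>x\<bar> < real n \<Longrightarrow> cut' n x = 0"
    "\<And>n x. \<bar>x\<bar> \<ge> real n + 1 \<Longrightarrow> cut n x = 0"
    "\<And>n x. \<bar>x\<bar> > real n + 1 \<Longrightarrow> cut' n x = 0"
    "\<And>n x. 0 \<le> cut n x" "\<And>n x. cut n x \<le> 1" "\<And>n x. \<bar>cut' n x\<bar> \<le> C"
proof -
  obtain B B' C where B: "smooth B" "\<And>x. (B has_real_derivative B' x) (at x)" "continuous_on UNIV B'"
    "\<And>x. x \<le> 0 \<Longrightarrow> B x = 0" "\<And>x. x \<ge> 1 \<Longrightarrow> B x = 1"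
    "\<And>x. 0 \<le> B x" "\<And>x. B x \<le> 1" "\<And>x. \<bar>B' x\<bar> \<le> C"
    by (rule smooth_step) (rule that)
  \<comment> \<open>One factor rises just left of \<open>- n\<close>, the other falls just right of
    \<open>n\<close>. The form \<open>1 * x + ...\<close> matches the pattern of
    \<open>smooth_affine\<close>.\<close>
  define cut where "cut n x = B (1 * x + (real n + 1)) * B (-1 * x + (real n + 1))" for n x
  define cut' where "cut' n x = B' (x + (real n + 1)) * B (- x + (real n + 1)) - B (x + (real n + 1)) * B' (-x + (real n + 1))" for n x
  have d: "(cut n has_real_derivative cut' n x) (at x)" for n x
  proof -
    have "((\<lambda>x. B (1 * x + (real n + 1))) has_real_derivative B' (1 * x + (real n + 1)) * 1) (at x)"
      by (rule DERIV_chain2[where f=B, OF B(2)]) (auto intro!: derivative_eq_intros)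
    moreover have "((\<lambda>x. B (-1 * x + (real n + 1))) has_real_derivative B' (-1 * x + (real n + 1)) * (-1)) (at x)"
      by (rule DERIV_chain2[where f=B, OF B(2)]) (auto intro!: derivative_eq_intros)
    ultimately show ?thesis unfolding cut_def cut'_def
      by (auto intro!: derivative_eq_intros)
  qed
  have ge: "cut n x = 0" if "\<bar>x\<bar> \<ge> real n + 1" for n x
    using that B(4) by (cases "x > 0") (auto simp: cut_def)
  have le: "cut n x = 1" if "\<bar>x\<bar> \<le> real n" for n x
    using that B(5) by (auto simp: cut_def)
  have const: "cut' n x = 0" if "open S" "x \<in> S" "\<And>y. y \<in> S \<Longrightarrow> cut n y = c" for n x S c
  proof -
    have "(cut n has_real_derivative 0) (at x)"
      by (rule DERIV_cong_ev[THEN iffD2, OF refl _ refl, of _ "\<lambda>_. c"])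
        (use that in \<open>auto intro!: eventually_mono[OF eventually_nhds_in_open[of S]]\<close>)
    thus ?thesis using d DERIV_unique by blast
  qed
  show ?thesis
  proof (rule that[of cut cut' "2 * C"])
    show "test_fun (cut n)" for n
    proof -
      have "smooth (cut n)" unfolding cut_def by (intro smooth_mult smooth_affine B)
      thus ?thesis unfolding test_fun_def using ge[of n] by (auto intro!: exI[of _ "real n + 1"])
    qed
    show "continuous_on UNIV (cut' n)" for n unfolding cut'_def
      by (intro continuous_intros continuous_on_compose2[OF B(3)] continuous_on_compose2[OF continuous_on_UNIV_DERIV[OF B(2)]]) auto
    show "cut' n x = 0" if "\<bar>x\<bar> < real n" for n x
      by (rule const[of "{x. \<bar>x\<bar> < real n}" _ _ 1])
        (use that le in \<open>auto intro!: open_Collect_less continuous_intros\<close>)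
    show "cut' n x = 0" if "\<bar>x\<bar> > real n + 1" for n x
      by (rule const[of "{x. \<bar>x\<bar> > real n + 1}" _ _ 0])
        (use that ge in \<open>auto intro!: open_Collect_less continuous_intros\<close>)
    show "0 \<le> cut n x" for n x by (simp add: cut_def B)
    show "cut n x \<le> 1" for n x unfolding cut_def by (intro mult_le_one B)
    show "\<bar>cut' n x\<bar> \<le> 2 * C" for n x
    proof -
      have 1: "\<bar>B' y * B z\<bar> \<le> C" for y z
        using mult_mono[OF B(8)[of y] B(7)[of z]] B(6)[of z] B(8)[of y] by (simp add: abs_mult)
      show ?thesis using 1[of "x + (real n + 1)" "- x + (real n + 1)"] 1[of "- x + (real n + 1)" "x + (real n + 1)"]
        unfolding cut'_def by (simp add: mult.commute)
    qed
  qed (use d le ge in auto)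
qed

section \<open>The Gibbs measure and the max-min values\<close>

lemma test_fun_smooth: "test_fun \<phi> \<Longrightarrow> smooth \<phi>"
  by (simp add: test_fun_def)

lemma test_fun_C1c: "test_fun \<phi> \<Longrightarrow> C1c \<phi> (deriv \<phi>)"
  unfolding C1c_def test_fun_def
  by (auto intro: smooth_DERIV smooth_deriv continuous_on_UNIV_DERIV)

lemma test_fun_deriv_C1c:
  assumes "test_fun \<phi>"
  shows "C1c (deriv \<phi>) (deriv (deriv \<phi>))"
proof -
  have "C0c (deriv \<phi>)" using C1c_C0c_deriv test_fun_C1c assms by blast
  thus ?thesis using assms unfolding C1c_def test_fun_def C0c_def
    by (auto intro: smooth_DERIV smooth_deriv continuous_on_UNIV_DERIV)
qed

lemma test_fun_add_scaled:
  assumes "test_fun \<phi>" "test_fun \<psi>"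
  shows "test_fun (\<lambda>x. a * \<phi> x + b * \<psi> x)"
    and "deriv (\<lambda>x. a * \<phi> x + b * \<psi> x) x = a * deriv \<phi> x + b * deriv \<psi> x"
    and "Lop V (\<lambda>x. a * \<phi> x + b * \<psi> x) x = a * Lop V \<phi> x + b * Lop V \<psi> x"
proof -
  obtain R S where "\<forall>x. \<bar>x\<bar> > R \<longrightarrow> \<phi> x = 0" "\<forall>x. \<bar>x\<bar> > S \<longrightarrow> \<psi> x = 0"
    using assms unfolding test_fun_def by blast
  hence "\<forall>x. \<bar>x\<bar> > max R S \<longrightarrow> a * \<phi> x + b * \<psi> x = 0" by simp
  thus "test_fun (\<lambda>x. a * \<phi> x + b * \<psi> x)"
    using assms unfolding test_fun_def by (intro conjI exI[of _ "max R S"]) (auto intro!: smooth_add smooth_mult smooth_const)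
  have d: "deriv (\<lambda>x. a * f x + b * g x) = (\<lambda>x. a * deriv f x + b * deriv g x)"
    if "smooth f" "smooth g" for f g
  proof
    fix x
    have "((\<lambda>x. a * f x + b * g x) has_real_derivative a * deriv f x + b * deriv g x) (at x)"
      using smooth_DERIV[OF that(1)] smooth_DERIV[OF that(2)] by (auto intro!: derivative_eq_intros)
    thus "deriv (\<lambda>x. a * f x + b * g x) x = a * deriv f x + b * deriv g x"
      by (rule DERIV_imp_deriv)
  qed
  note s = assms[THEN test_fun_smooth]
  show "deriv (\<lambda>x. a * \<phi> x + b * \<psi> x) x = a * deriv \<phi> x + b * deriv \<psi> x"
    using d[OF s] by simp
  show "Lop V (\<lambda>x. a * \<phi> x + b * \<psi> x) x = a * Lop V \<phi> x + b * Lop V \<psi> x"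
    unfolding Lop_def d[OF s] d[OF s[THEN smooth_deriv]] by (simp add: algebra_simps)
qed

locale gibbs =
  fixes V :: "real \<Rightarrow> real"
  assumes smooth_V: "smooth V" and integrable_V: "integrable lborel (\<lambda>x. exp (- V x))"
begin

definition rho :: "real \<Rightarrow> real" where
  "rho x = exp (- V x) / Zc V"

lemma Zc_pos: "Zc V > 0"
proof -
  have "Zc V \<noteq> 0"
  proof
    assume "Zc V = 0"
    hence "AE x in lborel. exp (- V x) = 0"
      using integral_nonneg_eq_0_iff_AE[OF integrable_V] by (simp add: Zc_def)
    thus False using ae_filter_eq_bot_iff[of "lborel :: real measure"] by (simp add: eventually_False)
  qed
  moreover have "Zc V \<ge> 0" unfolding Zc_def by simp
  ultimately show ?thesis by simp
qed

lemma rho_pos: "rho x > 0"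
  using Zc_pos by (simp add: rho_def)

lemma rho_DERIV: "(rho has_real_derivative - deriv V x * rho x) (at x)"
  unfolding rho_def using Zc_pos
  by (auto intro!: derivative_eq_intros smooth_DERIV[OF smooth_V])

lemma continuous_rho: "continuous_on UNIV rho"
  using rho_DERIV by (rule continuous_on_UNIV_DERIV)

lemma continuous_deriv_V: "continuous_on UNIV (deriv V)"
  using smooth_DERIV[OF smooth_deriv[OF smooth_V]] by (rule continuous_on_UNIV_DERIV)

lemma rho_measurable[measurable]: "rho \<in> borel_measurable borel"
  using continuous_rho by (rule borel_measurable_continuous_onI)

lemma integrable_rho: "integrable lborel rho"
  using integrable_V unfolding rho_def by (intro integrable_divide_zero) auto

lemma integral_rho: "(LINT x|lborel. rho x) = 1"
  using Zc_pos by (simp add: rho_def Zc_def[symmetric])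

lemma mu_eq: "mu V = density lborel (\<lambda>x. ennreal (rho x))"
  by (simp add: mu_def rho_def)

lemma sets_mu[measurable_cong, simp]: "sets (mu V) = sets borel"
  by (simp add: mu_def)

lemma space_mu[simp]: "space (mu V) = UNIV"
  by (simp add: mu_def)

lemma integral_mu:
  fixes f :: "real \<Rightarrow> real"
  assumes "f \<in> borel_measurable borel"
  shows "(LINT x|mu V. f x) = (LINT x|lborel. rho x * f x)"
  unfolding mu_eq using assms rho_pos by (subst integral_density) (auto simp: less_imp_le)

lemma integrable_mu_iff:
  fixes f :: "real \<Rightarrow> real"
  assumes "f \<in> borel_measurable borel"
  shows "integrable (mu V) f \<longleftrightarrow> integrable lborel (\<lambda>x. rho x * f x)"
  unfolding mu_eq using assms rho_pos by (subst integrable_density) (auto simp: less_imp_le)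

lemma AE_mu_iff: "(AE x in mu V. P x) \<longleftrightarrow> (AE x in lborel. P x)"
  unfolding mu_eq using rho_pos by (subst AE_density) auto

lemma emeasure_mu_UNIV: "emeasure (mu V) UNIV = 1"
proof -
  have "emeasure (mu V) UNIV = (\<integral>\<^sup>+x. ennreal (rho x) \<partial>lborel)"
    unfolding mu_eq by (subst emeasure_density) auto
  also have "\<dots> = ennreal 1"
    using integrable_rho integral_rho rho_pos by (subst nn_integral_eq_integral) (auto simp: less_imp_le)
  finally show ?thesis by simp
qed

sublocale mu: finite_measure "mu V"
  by (rule finite_measureI) (simp add: emeasure_mu_UNIV)

lemma measure_mu_UNIV: "measure (mu V) UNIV = 1"
  by (simp add: measure_def emeasure_mu_UNIV)

lemma integral_mu_const: "(LINT x|mu V. (c::real)) = c"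
  by (simp add: measure_mu_UNIV)

lemma C0c_measurable: "C0c f \<Longrightarrow> f \<in> borel_measurable borel"
  by (simp add: C0c_def borel_measurable_continuous_onI)

lemma integrable_mu_C0c: "C0c f \<Longrightarrow> integrable (mu V) f"
  by (subst integrable_mu_iff) (auto intro!: C0c_measurable integrable_C0c C0c_mult_left continuous_rho)

lemma L2_C0c: "C0c f \<Longrightarrow> L2 V f"
  unfolding L2_def by (auto intro!: C0c_measurable integrable_mu_C0c C0c_power2)

lemma test_fun_C0c:
  assumes "test_fun \<phi>"
  shows "C0c \<phi>" "C0c (deriv \<phi>)" "C0c (Lop V \<phi>)"
proof -
  have 1: "C0c \<phi>" "C0c (deriv \<phi>)" "C0c (deriv (deriv \<phi>))"
    using C1c_C0c C1c_C0c_deriv test_fun_C1c[OF assms] test_fun_deriv_C1c[OF assms] by blast+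
  thus "C0c \<phi>" "C0c (deriv \<phi>)" by auto
  show "C0c (Lop V \<phi>)" unfolding Lop_def
    by (intro C0c_diff C0c_mult_left 1 continuous_deriv_V)
qed

lemma L2_test_fun:
  assumes "test_fun \<phi>"
  shows "L2 V \<phi>" "L2 V (deriv \<phi>)" "L2 V (\<lambda>x. - Lop V \<phi> x)"
  using test_fun_C0c[OF assms] L2_C0c C0c_mult_left[of "Lop V \<phi>" "\<lambda>_. -1"] by auto

section \<open>Cauchy-Schwarz and passage to the limit in L2(mu)\<close>

lemma L2_measurable[measurable_dest]: "L2 V f \<Longrightarrow> f \<in> borel_measurable borel"
  by (simp add: L2_def)

lemma L2_integrable_power2: "L2 V f \<Longrightarrow> integrable (mu V) (\<lambda>x. (f x)\<^sup>2)"
  by (simp add: L2_def)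

lemma L2_integrable_mult:
  assumes "L2 V f" "L2 V g"
  shows "integrable (mu V) (\<lambda>x. f x * g x)"
proof (rule Bochner_Integration.integrable_bound)
  show "integrable (mu V) (\<lambda>x. (f x)\<^sup>2 + (g x)\<^sup>2)" using assms by (simp add: L2_def)
  have "\<bar>a * b\<bar> \<le> a\<^sup>2 + b\<^sup>2" for a b :: real
    using sum_squares_bound[of a b] sum_squares_bound[of a "-b"] by (auto simp: abs_if)
  thus "AE x in mu V. norm (f x * g x) \<le> norm ((f x)\<^sup>2 + (g x)\<^sup>2)" by simp
  note [measurable] = assms[THEN L2_measurable]
  show "(\<lambda>x. f x * g x) \<in> borel_measurable (mu V)" by measurable
qed

lemma L2_lincomb:
  assumes "L2 V f" "L2 V g"
  shows "L2 V (\<lambda>x. a * f x + b * g x)"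
proof -
  note [measurable] = assms[THEN L2_measurable]
  have "integrable (mu V) (\<lambda>x. a\<^sup>2 * (f x)\<^sup>2 + 2 * a * b * (f x * g x) + b\<^sup>2 * (g x)\<^sup>2)"
    using assms L2_integrable_mult[OF assms] by (simp add: L2_def)
  moreover have "(\<lambda>x. (a * f x + b * g x)\<^sup>2) = (\<lambda>x. a\<^sup>2 * (f x)\<^sup>2 + 2 * a * b * (f x * g x) + b\<^sup>2 * (g x)\<^sup>2)"
    by (auto simp: power2_eq_square algebra_simps)
  ultimately show ?thesis unfolding L2_def by simp
qed

lemma L2_diff: "L2 V f \<Longrightarrow> L2 V g \<Longrightarrow> L2 V (\<lambda>x. f x - g x)"
  using L2_lincomb[of f g 1 "-1"] by simp

lemma L2_const: "L2 V (\<lambda>_. c)"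
  by (simp add: L2_def)

lemma L2_integrable: "L2 V f \<Longrightarrow> integrable (mu V) f"
  using L2_integrable_mult[OF _ L2_const[of 1]] by simp

lemma integral_lincomb_power2:
  assumes "L2 V f" "L2 V g"
  shows "(LINT x|mu V. (a * f x + b * g x)\<^sup>2) =
    a\<^sup>2 * (LINT x|mu V. (f x)\<^sup>2) + 2 * a * b * (LINT x|mu V. f x * g x) + b\<^sup>2 * (LINT x|mu V. (g x)\<^sup>2)"
proof -
  have "(LINT x|mu V. (a * f x + b * g x)\<^sup>2) =
    (LINT x|mu V. a\<^sup>2 * (f x)\<^sup>2 + 2 * a * b * (f x * g x) + b\<^sup>2 * (g x)\<^sup>2)"
    by (rule Bochner_Integration.integral_cong) (auto simp: power2_eq_square algebra_simps)
  thus ?thesis using assms L2_integrable_mult[OF assms] by (simp add: L2_def)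
qed

lemma L2_cauchy_schwarz:
  assumes "L2 V f" "L2 V g"
  shows "\<bar>LINT x|mu V. f x * g x\<bar> \<le> sqrt (LINT x|mu V. (f x)\<^sup>2) * sqrt (LINT x|mu V. (g x)\<^sup>2)"
proof -
  define A B C where "A = (LINT x|mu V. (f x)\<^sup>2)" "B = (LINT x|mu V. (g x)\<^sup>2)" "C = (LINT x|mu V. f x * g x)"
  note d = A_B_C_def
  have A: "A \<ge> 0" "B \<ge> 0" by (auto simp: d)
  have q: "0 \<le> a\<^sup>2 * A + 2 * a * b * C + b\<^sup>2 * B" for a b
  proof -
    have "0 \<le> (LINT x|mu V. (a * f x + b * g x)\<^sup>2)" by simp
    thus ?thesis unfolding integral_lincomb_power2[OF assms] d .
  qed
  have "C\<^sup>2 \<le> A * B"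
  proof (cases "B = 0")
    case True
    have "C = 0"
    proof (rule ccontr)
      assume "C \<noteq> 0"
      \<comment> \<open>This coefficient makes the form equal to
        \<open>A - (A + 1) = -1\<close>.\<close>
      thus False using q[of 1 "- (A + 1) / (2 * C)"] True by (simp add: field_simps)
    qed
    thus ?thesis using A by simp
  next
    case False
    hence "B > 0" using A by simp
    have "0 \<le> B\<^sup>2 * A + 2 * B * (- C) * C + (- C)\<^sup>2 * B" using q[of B "- C"] .
    also have "\<dots> = B * (A * B - C\<^sup>2)" by (simp add: power2_eq_square algebra_simps)
    finally show ?thesis using \<open>B > 0\<close> by (simp add: zero_le_mult_iff)
  qed
  hence "\<bar>C\<bar> \<le> sqrt (A * B)" using real_sqrt_le_mono by fastforce
  thus ?thesis by (simp add: d real_sqrt_mult)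
qed

text \<open>This carries relations between test functions over to the closure: functions and images
  converge in L2, so bilinear expressions converge. The difference of products splits into three
  terms, each controlled by Cauchy-Schwarz.\<close>

lemma tendsto_integral_mult_L2:
  assumes L: "\<And>n. L2 V (\<phi> n)" "\<And>n. L2 V (\<gamma> n)" "L2 V f" "L2 V g"
    and c: "(\<lambda>n. LINT x|mu V. (\<phi> n x - f x)\<^sup>2) \<longlonglongrightarrow> 0" "(\<lambda>n. LINT x|mu V. (\<gamma> n x - g x)\<^sup>2) \<longlonglongrightarrow> 0"
  shows "(\<lambda>n. LINT x|mu V. \<phi> n x * \<gamma> n x) \<longlonglongrightarrow> (LINT x|mu V. f x * g x)"
proof -
  define a b where "a n = sqrt (LINT x|mu V. (\<phi> n x - f x)\<^sup>2)" "b n = sqrt (LINT x|mu V. (\<gamma> n x - g x)\<^sup>2)" for n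
  define A B where "A = sqrt (LINT x|mu V. (f x)\<^sup>2)" "B = sqrt (LINT x|mu V. (g x)\<^sup>2)"
  have ab: "a \<longlonglongrightarrow> 0" "b \<longlonglongrightarrow> 0"
    using tendsto_real_sqrt[OF c(1)] tendsto_real_sqrt[OF c(2)] by (simp_all add: a_b_def[abs_def])
  have bound: "\<bar>(LINT x|mu V. \<phi> n x * \<gamma> n x) - (LINT x|mu V. f x * g x)\<bar> \<le> a n * b n + a n * B + A * b n" for n
  proof -
    have d: "L2 V (\<lambda>x. \<phi> n x - f x)" "L2 V (\<lambda>x. \<gamma> n x - g x)" using L L2_diff by auto
    have "(LINT x|mu V. \<phi> n x * \<gamma> n x) - (LINT x|mu V. f x * g x) =
      (LINT x|mu V. \<phi> n x * \<gamma> n x - f x * g x)"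
      by (simp add: L2_integrable_mult L)
    also have "\<dots> = (LINT x|mu V. (\<phi> n x - f x) * (\<gamma> n x - g x) + (\<phi> n x - f x) * g x + f x * (\<gamma> n x - g x))"
      by (rule Bochner_Integration.integral_cong) (auto simp: algebra_simps)
    also have "\<dots> = (LINT x|mu V. (\<phi> n x - f x) * (\<gamma> n x - g x)) + (LINT x|mu V. (\<phi> n x - f x) * g x)
        + (LINT x|mu V. f x * (\<gamma> n x - g x))"
      using L2_integrable_mult[OF d] L2_integrable_mult[OF d(1) L(4)] L2_integrable_mult[OF L(3) d(2)] by simp
    finally show ?thesis
      using L2_cauchy_schwarz[OF d] L2_cauchy_schwarz[OF d(1) L(4)] L2_cauchy_schwarz[OF L(3) d(2)]
      unfolding a_b_def A_B_def by linarith
  qed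
  have "(\<lambda>n. a n * b n + a n * B + A * b n) \<longlonglongrightarrow> 0 * 0 + 0 * B + A * 0"
    by (intro tendsto_intros ab)
  hence z: "(\<lambda>n. a n * b n + a n * B + A * b n) \<longlonglongrightarrow> 0" by simp
  have "(\<lambda>n. (LINT x|mu V. \<phi> n x * \<gamma> n x) - (LINT x|mu V. f x * g x)) \<longlonglongrightarrow> 0"
    by (rule Lim_null_comparison[OF _ z]) (use bound in auto)
  thus ?thesis by (simp add: LIM_zero_iff)
qed

text \<open>Since \<open>rho L \<phi>\<close> is the derivative of \<open>rho \<phi>'\<close>, the
  compact support of \<open>\<phi>\<close> alone removes the boundary terms. So \<open>f\<close> may
  be constant, which yields the mean-zero property of eigenfunctions, while
  \<open>f = \<phi>\<close> gives the Dirichlet form.\<close>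

lemma integral_mult_Lop:
  assumes \<phi>: "test_fun \<phi>" and f: "\<And>x. (f has_real_derivative f' x) (at x)" "continuous_on UNIV f'"
  shows "(LINT x|mu V. f x * - Lop V \<phi> x) = (LINT x|mu V. f' x * deriv \<phi> x)"
proof -
  have cf: "continuous_on UNIV f" using f(1) by (rule continuous_on_UNIV_DERIV)
  have "C1c (\<lambda>x. rho x * deriv \<phi> x) (\<lambda>x. - deriv V x * rho x * deriv \<phi> x + rho x * deriv (deriv \<phi>) x)"
    by (rule C1c_mult[OF test_fun_deriv_C1c[OF \<phi>] rho_DERIV])
      (intro continuous_intros continuous_deriv_V continuous_rho)
  from C1c_mult[OF this f]
  have "C1c (\<lambda>x. f x * (rho x * deriv \<phi> x)) (\<lambda>x. f' x * (rho x * deriv \<phi> x) + f x * (- deriv V x * rho x * deriv \<phi> x + rho x * deriv (deriv \<phi>) x))" .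
  from integral_deriv_C1c[OF this]
  have "0 = (LINT x|lborel. rho x * (f' x * deriv \<phi> x) + rho x * (f x * Lop V \<phi> x))"
    by (simp add: Lop_def algebra_simps)
  also have "\<dots> = (LINT x|lborel. rho x * (f' x * deriv \<phi> x)) + (LINT x|lborel. rho x * (f x * Lop V \<phi> x))"
    by (intro Bochner_Integration.integral_add integrable_C0c C0c_mult_left continuous_rho f cf test_fun_C0c[OF \<phi>])
  also have "\<dots> = (LINT x|mu V. f' x * deriv \<phi> x) + (LINT x|mu V. f x * Lop V \<phi> x)"
    by (subst (1 2) integral_mu)
      (auto intro!: C0c_measurable C0c_mult_left f cf test_fun_C0c[OF \<phi>])
  finally show ?thesis by simp
qed

lemma integral_test_fun_Lop:
  assumes "test_fun \<phi>"
  shows "(LINT x|mu V. \<phi> x * - Lop V \<phi> x) = (LINT x|mu V. (deriv \<phi> x)\<^sup>2)"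
  using integral_mult_Lop[OF assms, of \<phi> "deriv \<phi>"] test_fun_C1c[OF assms]
  by (simp add: C1c_def power2_eq_square)

lemma graph_test_fun: "test_fun \<phi> \<Longrightarrow> graph V \<phi> (\<lambda>x. - Lop V \<phi> x)"
  unfolding graph_def using L2_test_fun by (auto intro!: exI[of _ "\<lambda>_. \<phi>"])

lemma tendsto_L2_correction:
  assumes L: "\<And>n. L2 V (\<phi> n)" "L2 V f" "L2 V h" and t: "t \<longlonglongrightarrow> 0"
    and c: "(\<lambda>n. LINT x|mu V. (\<phi> n x - f x)\<^sup>2) \<longlonglongrightarrow> 0"
  shows "(\<lambda>n. LINT x|mu V. (\<phi> n x - t n * h x - f x)\<^sup>2) \<longlonglongrightarrow> 0"
proof -
  have d: "L2 V (\<lambda>x. \<phi> n x - f x)" for n using L L2_diff by auto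
  have eq: "(LINT x|mu V. (\<phi> n x - t n * h x - f x)\<^sup>2) =
    (LINT x|mu V. (\<phi> n x - f x)\<^sup>2) - 2 * t n * (LINT x|mu V. (\<phi> n x - f x) * h x) + (t n)\<^sup>2 * (LINT x|mu V. (h x)\<^sup>2)" for n
    using integral_lincomb_power2[OF d[of n] L(3), of 1 "- t n"] by (simp add: algebra_simps)
  have "(\<lambda>n. LINT x|mu V. (\<phi> n x - f x) * h x) \<longlonglongrightarrow> (LINT x|mu V. 0 * h x)"
    by (rule tendsto_integral_mult_L2) (use d L L2_const c in auto)
  hence "(\<lambda>n. (LINT x|mu V. (\<phi> n x - f x)\<^sup>2) - 2 * t n * (LINT x|mu V. (\<phi> n x - f x) * h x) + (t n)\<^sup>2 * (LINT x|mu V. (h x)\<^sup>2))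
    \<longlonglongrightarrow> 0 - 2 * 0 * (LINT x|mu V. 0 * h x) + 0\<^sup>2 * (LINT x|mu V. (h x)\<^sup>2)"
    by (intro tendsto_intros t c)
  thus ?thesis unfolding eq by simp
qed

text \<open>The approximating test functions of the closure need not satisfy the constraints; they are
  corrected one constraint at a time by a vanishing multiple of one fixed member of the sequence.\<close>

lemma lam_ge:
  assumes b: "\<And>i. i < k \<Longrightarrow> L2 V (b i)"
    and gap: "\<And>\<phi>. test_fun \<phi> \<Longrightarrow> (\<And>i. i < k \<Longrightarrow> (LINT x|mu V. \<phi> x * b i x) = 0) \<Longrightarrow>
      c * (LINT x|mu V. (\<phi> x)\<^sup>2) \<le> (LINT x|mu V. (deriv \<phi> x)\<^sup>2)"
  shows "lam V k \<ge> ereal c"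
proof -
  have main: "c * (LINT x|mu V. (f x)\<^sup>2) \<le> (LINT x|mu V. f x * g x)"
    if fg: "graph V f g" and orth: "\<And>i. i < k \<Longrightarrow> (LINT x|mu V. f x * b i x) = 0" for f g
  proof -
    have Lf: "L2 V f" and Lg: "L2 V g" using fg by (auto simp: graph_def)
    define conv where "conv \<phi> \<longleftrightarrow> (\<forall>n. test_fun (\<phi> n)) \<and>
        (\<lambda>n. LINT x|mu V. (\<phi> n x - f x)\<^sup>2) \<longlonglongrightarrow> 0 \<and>
        (\<lambda>n. LINT x|mu V. (- Lop V (\<phi> n) x - g x)\<^sup>2) \<longlonglongrightarrow> 0" for \<phi> :: "nat \<Rightarrow> real \<Rightarrow> real"
    have "\<exists>\<phi>. conv \<phi> \<and> (\<forall>n. \<forall>j<i. (LINT x|mu V. \<phi> n x * b j x) = 0)" if "i \<le> k" for i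
      using that
    proof (induction i)
      case 0
      thus ?case using fg unfolding graph_def conv_def by auto
    next
      case (Suc i)
      then obtain \<phi> where \<phi>: "conv \<phi>" "\<And>n j. j < i \<Longrightarrow> (LINT x|mu V. \<phi> n x * b j x) = 0"
        by auto
      have T: "test_fun (\<phi> n)" for n using \<phi>(1) by (simp add: conv_def)
      show ?case
      proof (cases "\<forall>n. (LINT x|mu V. \<phi> n x * b i x) = 0")
        case True
        thus ?thesis using \<phi> less_Suc_eq by auto
      next
        case False
        then obtain m where m: "(LINT x|mu V. \<phi> m x * b i x) \<noteq> 0" by blast
        \<comment> \<open>\<open>t n\<close> cancels constraint \<open>i\<close> and tends to 0
          because \<open>f\<close> satisfies that constraint. The earlier ones survive the
          correction, since \<open>\<phi> m\<close> satisfies them too.\<close>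
        define t where "t n = (LINT x|mu V. \<phi> n x * b i x) / (LINT x|mu V. \<phi> m x * b i x)" for n
        define \<psi> where "\<psi> n x = 1 * \<phi> n x + (- t n) * \<phi> m x" for n x
        have bi: "L2 V (b i)" using b Suc.prems by auto
        have "(\<lambda>n. LINT x|mu V. \<phi> n x * b i x) \<longlonglongrightarrow> (LINT x|mu V. f x * b i x)"
          by (rule tendsto_integral_mult_L2) (use \<phi>(1) L2_test_fun[OF T] Lf bi in \<open>auto simp: conv_def\<close>)
        hence "t \<longlonglongrightarrow> 0 / (LINT x|mu V. \<phi> m x * b i x)"
          unfolding t_def using orth[of i] Suc.prems m by (intro tendsto_intros) auto
        hence t: "t \<longlonglongrightarrow> 0" by simp
        have T\<psi>: "test_fun (\<psi> n)" for n unfolding \<psi>_def by (rule test_fun_add_scaled[OF T T])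
        have L\<psi>: "Lop V (\<psi> n) x = Lop V (\<phi> n) x - t n * Lop V (\<phi> m) x" for n x
          unfolding \<psi>_def by (subst test_fun_add_scaled[OF T T]) simp
        have "conv \<psi>" unfolding conv_def
        proof (intro conjI allI T\<psi>)
          show "(\<lambda>n. LINT x|mu V. (\<psi> n x - f x)\<^sup>2) \<longlonglongrightarrow> 0"
            unfolding \<psi>_def using tendsto_L2_correction[OF L2_test_fun(1)[OF T] Lf L2_test_fun(1)[OF T[of m]] t] \<phi>(1)
            by (simp add: conv_def)
          have "(\<lambda>n. LINT x|mu V. (- Lop V (\<phi> n) x - t n * - Lop V (\<phi> m) x - g x)\<^sup>2) \<longlonglongrightarrow> 0"
            by (rule tendsto_L2_correction[OF L2_test_fun(3)[OF T] Lg L2_test_fun(3)[OF T[of m]] t])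
              (use \<phi>(1) in \<open>simp add: conv_def\<close>)
          thus "(\<lambda>n. LINT x|mu V. (- Lop V (\<psi> n) x - g x)\<^sup>2) \<longlonglongrightarrow> 0"
            unfolding L\<psi> by simp
        qed
        moreover have "(LINT x|mu V. \<psi> n x * b j x) = 0" if "j < Suc i" for n j
        proof -
          have bj: "L2 V (b j)" using b Suc.prems that by auto
          have i: "integrable (mu V) (\<lambda>x. \<phi> n x * b j x)" for n
            by (rule L2_integrable_mult[OF L2_test_fun(1)[OF T] bj])
          have "(LINT x|mu V. \<psi> n x * b j x) = (LINT x|mu V. \<phi> n x * b j x - t n * (\<phi> m x * b j x))"
            unfolding \<psi>_def by (simp add: algebra_simps)
          also have "\<dots> = (LINT x|mu V. \<phi> n x * b j x) - t n * (LINT x|mu V. \<phi> m x * b j x)"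
            using i by simp
          also have "\<dots> = 0" using m \<phi>(2) that by (cases "j = i") (auto simp: t_def)
          finally show ?thesis .
        qed
        ultimately show ?thesis by blast
      qed
    qed
    then obtain \<phi> where \<phi>: "conv \<phi>" "\<And>n j. j < k \<Longrightarrow> (LINT x|mu V. \<phi> n x * b j x) = 0" by blast
    have T: "test_fun (\<phi> n)" for n using \<phi>(1) by (simp add: conv_def)
    have "c * (LINT x|mu V. \<phi> n x * \<phi> n x) \<le> (LINT x|mu V. \<phi> n x * - Lop V (\<phi> n) x)" for n
      using gap[OF T \<phi>(2)] integral_test_fun_Lop[OF T] by (simp add: power2_eq_square)
    moreover have "(\<lambda>n. LINT x|mu V. \<phi> n x * \<phi> n x) \<longlonglongrightarrow> (LINT x|mu V. f x * f x)"
      by (rule tendsto_integral_mult_L2) (use \<phi>(1) L2_test_fun[OF T] Lf in \<open>auto simp: conv_def\<close>)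
    moreover have "(\<lambda>n. LINT x|mu V. \<phi> n x * - Lop V (\<phi> n) x) \<longlonglongrightarrow> (LINT x|mu V. f x * g x)"
      by (rule tendsto_integral_mult_L2) (use \<phi>(1) L2_test_fun[OF T] Lf Lg in \<open>auto simp: conv_def\<close>)
    ultimately show ?thesis
      unfolding power2_eq_square by (intro LIMSEQ_le[OF tendsto_mult_left]) auto
  qed
  show ?thesis unfolding lam_def
  proof (rule SUP_upper2[where i=b])
    show "ereal c \<le> (INF fg \<in> {(f, g). graph V f g \<and> (LINT x|mu V. (f x)\<^sup>2) > 0 \<and>
        (\<forall>i<k. (LINT x|mu V. f x * b i x) = 0)}.
        ereal ((LINT x|mu V. fst fg x * snd fg x) / (LINT x|mu V. (fst fg x)\<^sup>2)))"
    proof (rule INF_greatest, clarsimp)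
      fix f g assume "graph V f g" "(LINT x|mu V. (f x)\<^sup>2) > 0" "\<forall>i<k. (LINT x|mu V. f x * b i x) = 0"
      thus "c \<le> (LINT x|mu V. f x * g x) / (LINT x|mu V. (f x)\<^sup>2)"
        using main[of f g] by (simp add: pos_le_divide_eq)
    qed
  qed (use b in auto)
qed

end

section \<open>The supersymmetric partner operator\<close>

context gibbs
begin

text \<open>The function \<open>W\<close>. It equals \<open>a' + a^2\<close> for
  \<open>a = V' / 2\<close>, which is why it appears when the square of \<open>v' - V' v / 2\<close>
  is integrated.\<close>

definition pot :: "real \<Rightarrow> real" where
  "pot x = deriv (deriv V) x / 2 + (deriv V x)\<^sup>2 / 4"

lemma deriv_V_DERIV: "(deriv V has_real_derivative deriv (deriv V) x) (at x)"
  by (intro smooth_DERIV smooth_deriv smooth_V)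

lemma half_deriv_V_DERIV: "((\<lambda>x. deriv V x / 2) has_real_derivative deriv (deriv V) x / 2) (at x)"
  by (auto intro!: derivative_eq_intros deriv_V_DERIV)

lemma continuous_deriv2_V: "continuous_on UNIV (deriv (deriv V))"
  using smooth_DERIV[OF smooth_deriv[OF smooth_deriv[OF smooth_V]]] by (rule continuous_on_UNIV_DERIV)

lemma continuous_half_deriv2_V: "continuous_on UNIV (\<lambda>x. deriv (deriv V) x / 2)"
  by (intro continuous_intros continuous_deriv2_V) auto

lemma continuous_pot: "continuous_on UNIV pot"
  unfolding pot_def by (intro continuous_intros continuous_deriv2_V continuous_deriv_V) auto

lemma sqrt_rho_DERIV: "((\<lambda>x. sqrt (rho x)) has_real_derivative - (deriv V x / 2) * sqrt (rho x)) (at x)"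
proof -
  have "((\<lambda>x. sqrt (rho x)) has_real_derivative inverse (sqrt (rho x)) / 2 * (- deriv V x * rho x)) (at x)"
    by (rule DERIV_chain2[OF DERIV_real_sqrt[OF rho_pos] rho_DERIV])
  moreover have "inverse (sqrt (rho x)) / 2 * (- deriv V x * rho x) = - (deriv V x / 2) * sqrt (rho x)"
    using rho_pos[of x] real_sqrt_mult_self[of "rho x"] by (simp add: field_simps)
  ultimately show ?thesis by metis
qed

lemma sqrt_rho_power2: "(sqrt (rho x))\<^sup>2 = rho x"
  using rho_pos[of x] by simp

lemma integral_mu_power2:
  assumes "C0c f"
  shows "(LINT x|mu V. (f x)\<^sup>2) = (LINT x|lborel. (f x * sqrt (rho x))\<^sup>2)"
  using C0c_measurable[OF C0c_power2[OF assms]]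
  by (subst integral_mu) (auto simp: power_mult_distrib sqrt_rho_power2 rho_pos less_imp_le mult.commute)

text \<open>The duality for \<open>s = sqrt rho\<close>, \<open>r = V' / 2\<close> and
  \<open>h = \<phi>\<close>. Squares weighted by \<open>rho\<close> are L2(mu) norms, so a lower
  bound for the partner form at \<open>v\<close> becomes a Poincare-type bound for
  \<open>\<phi>\<close>.\<close>

lemma test_fun_partner:
  assumes \<phi>: "test_fun \<phi>" and mean: "(LINT x|mu V. \<phi> x) = 0"
  obtains v v' where "C1c v v'" "\<And>x. v' x - deriv V x / 2 * v x = \<phi> x * sqrt (rho x)"
    "C1c (\<lambda>x. sqrt (rho x) * v x) (\<lambda>x. \<phi> x * rho x)"
    "\<And>c. c > 0 \<Longrightarrow> c * (LINT x|lborel. (v x)\<^sup>2) \<le> (LINT x|lborel. (v' x - deriv V x / 2 * v x)\<^sup>2) \<Longrightarrow>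
       c * (LINT x|mu V. (\<phi> x)\<^sup>2) \<le> (LINT x|mu V. (deriv \<phi> x)\<^sup>2)"
proof -
  have nz: "sqrt (rho x) \<noteq> 0" for x using rho_pos[of x] by simp
  have c: "continuous_on UNIV (\<lambda>x. deriv V x / 2)"
    by (rule continuous_on_UNIV_DERIV[OF half_deriv_V_DERIV])
  have "(LINT x|lborel. \<phi> x * (sqrt (rho x))\<^sup>2) = 0"
    using mean C0c_measurable[OF test_fun_C0c(1)[OF \<phi>]]
    by (simp add: integral_mu sqrt_rho_power2 mult.commute rho_pos less_imp_le)
  then obtain v v' where v: "C1c v v'" "\<And>x. v' x - deriv V x / 2 * v x = \<phi> x * sqrt (rho x)"
    "C1c (\<lambda>x. sqrt (rho x) * v x) (\<lambda>x. \<phi> x * (sqrt (rho x))\<^sup>2)"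
    "\<And>c. c > 0 \<Longrightarrow> c * (LINT x|lborel. (v x)\<^sup>2) \<le> (LINT x|lborel. (\<phi> x * sqrt (rho x))\<^sup>2) \<Longrightarrow>
       c * (LINT x|lborel. (\<phi> x * sqrt (rho x))\<^sup>2) \<le> (LINT x|lborel. (deriv \<phi> x * sqrt (rho x))\<^sup>2)"
    by (rule partner_function[OF test_fun_C1c[OF \<phi>] sqrt_rho_DERIV nz c]) (rule that)
  show ?thesis
    using v by (intro that[of v v'])
      (auto simp: integral_mu_power2 test_fun_C0c[OF \<phi>] sqrt_rho_power2 rho_pos less_imp_le)
qed

text \<open>Comparison with \<open>b = 0\<close>; the discarded term is the integral of
  \<open>v'^2\<close>.\<close>

lemma integral_square_ge_pot:
  assumes v: "C1c v v'"
  shows "(LINT x|lborel. (v' x - deriv V x / 2 * v x)\<^sup>2) \<ge> (LINT x|lborel. pot x * (v x)\<^sup>2)"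
proof -
  have "(LINT x|lborel. (v' x - deriv V x / 2 * v x)\<^sup>2) = (LINT x|lborel. (v' x - 0 * v x)\<^sup>2) +
      (LINT x|lborel. (deriv (deriv V) x / 2 + (deriv V x / 2)\<^sup>2 - 0 - 0\<^sup>2) * (v x)\<^sup>2)"
    by (rule integral_square_riccati[OF v half_deriv_V_DERIV continuous_half_deriv2_V]) auto
  moreover have "(LINT x|lborel. (v' x - 0 * v x)\<^sup>2) \<ge> 0" by simp
  ultimately show ?thesis by (simp add: pot_def power_divide)
qed

text \<open>The zero-energy solution \<open>exp (V / 2)\<close> of the partner operator has logarithmic derivative
  \<open>V' / 2\<close>; bending it by \<open>F / 2\<close> times the density, with \<open>F\<close> a primitive of the
  density, leaves a strictly positive remainder.\<close>

lemma integral_square_ge_rho: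
  assumes v: "C1c v v'"
  shows "(LINT x|lborel. (v' x - deriv V x / 2 * v x)\<^sup>2) \<ge> (LINT x|lborel. (rho x)\<^sup>2 / 4 * (v x)\<^sup>2)"
proof -
  obtain G where G: "\<And>x. (G has_real_derivative rho x) (at x)"
    using continuous_antiderivative[OF continuous_rho] by blast
  define F where "F x = G x - G 0" for x
  have F: "(F has_real_derivative rho x) (at x)" for x
    unfolding F_def by (auto intro!: derivative_eq_intros G)
  have G1: "0 \<le> G b - G a \<and> G b - G a \<le> 1" if "a \<le> b" for a b
  proof -
    have "G b - G a = (LINT x|lborel. indicator {a..b} x * rho x)"
      using integral_Icc_deriv[OF that G continuous_rho] by simp
    moreover have "(LINT x|lborel. indicator {a..b} x * rho x) \<le> (LINT x|lborel. rho x)"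
      using integrable_rho integrable_real_mult_indicator[of "{a..b}" lborel rho] rho_pos
      by (intro integral_mono) (auto split: split_indicator simp: mult.commute less_imp_le)
    moreover have "0 \<le> (LINT x|lborel. indicator {a..b} x * rho x)"
      using rho_pos by (intro Bochner_Integration.integral_nonneg) (auto simp: less_imp_le)
    ultimately show ?thesis using integral_rho by simp
  qed
  have "\<bar>F x\<bar> \<le> 1" for x
    using G1[of 0 x] G1[of x 0] by (cases "x \<ge> 0") (auto simp: F_def)
  hence F1: "(F x)\<^sup>2 \<le> 1" for x using abs_square_le_1 by blast
  have cF: "continuous_on UNIV F" using F by (rule continuous_on_UNIV_DERIV)
  \<comment> \<open>Because \<open>rho' = - V' rho\<close>, the terms with \<open>V' rho F\<close>
    cancel in \<open>b' + b^2\<close>. It falls short of \<open>pot\<close> by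
    \<open>rho^2 / 2 - rho^2 F^2 / 4\<close>, which is at least \<open>rho^2 / 4\<close> as
    \<open>F^2 \<le> 1\<close>.\<close>
  define b where "b x = deriv V x / 2 - rho x * F x / 2" for x
  define b' where "b' x = deriv (deriv V) x / 2 - (- deriv V x * rho x * F x + rho x * rho x) / 2" for x
  have b: "(b has_real_derivative b' x) (at x)" for x unfolding b_def b'_def
    by (auto intro!: derivative_eq_intros half_deriv_V_DERIV deriv_V_DERIV rho_DERIV F simp: field_simps)
  have cb': "continuous_on UNIV b'" unfolding b'_def
    by (intro continuous_intros continuous_deriv2_V continuous_deriv_V continuous_rho cF) auto
  have v0: "C0c v" using v C1c_C0c by blast
  have "(LINT x|lborel. (v' x - deriv V x / 2 * v x)\<^sup>2) = (LINT x|lborel. (v' x - b x * v x)\<^sup>2) +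
      (LINT x|lborel. (deriv (deriv V) x / 2 + (deriv V x / 2)\<^sup>2 - b' x - (b x)\<^sup>2) * (v x)\<^sup>2)"
    by (rule integral_square_riccati[OF v half_deriv_V_DERIV continuous_half_deriv2_V b cb'])
  moreover have "(LINT x|lborel. (v' x - b x * v x)\<^sup>2) \<ge> 0" by simp
  moreover have "(LINT x|lborel. (rho x)\<^sup>2 / 4 * (v x)\<^sup>2) \<le>
      (LINT x|lborel. (deriv (deriv V) x / 2 + (deriv V x / 2)\<^sup>2 - b' x - (b x)\<^sup>2) * (v x)\<^sup>2)"
  proof (rule integral_mono)
    show "integrable lborel (\<lambda>x. (rho x)\<^sup>2 / 4 * (v x)\<^sup>2)"
      by (intro integrable_C0c C0c_mult_left C0c_power2 v0 continuous_intros continuous_rho) auto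
    show "integrable lborel (\<lambda>x. (deriv (deriv V) x / 2 + (deriv V x / 2)\<^sup>2 - b' x - (b x)\<^sup>2) * (v x)\<^sup>2)"
      by (intro integrable_C0c C0c_mult_left C0c_power2 v0 continuous_intros continuous_deriv2_V
          continuous_deriv_V cb' continuous_on_UNIV_DERIV[OF b]) auto
    fix x
    have "(rho x)\<^sup>2 / 4 * (F x)\<^sup>2 \<le> (rho x)\<^sup>2 / 4 * 1" using F1[of x] by (intro mult_left_mono) auto
    hence "(rho x)\<^sup>2 / 4 \<le> deriv (deriv V) x / 2 + (deriv V x / 2)\<^sup>2 - b' x - (b x)\<^sup>2"
      unfolding b_def b'_def by (simp add: power2_eq_square field_simps)
    thus "(rho x)\<^sup>2 / 4 * (v x)\<^sup>2 \<le> (deriv (deriv V) x / 2 + (deriv V x / 2)\<^sup>2 - b' x - (b x)\<^sup>2) * (v x)\<^sup>2"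
      by (rule mult_right_mono) simp
  qed
  ultimately show ?thesis by linarith
qed

text \<open>\<open>pot\<close> controls the form outside a compact interval but may be negative
  inside; the bound by \<open>rho^2 / 4\<close> may fade at infinity but is uniformly positive
  inside. A combination of the two dominates 1 everywhere.\<close>

lemma lam_1_pos:
  assumes R: "\<And>x. \<bar>x\<bar> > R \<Longrightarrow> pot x \<ge> 1"
  shows "lam V 1 > 0"
proof -
  define R' where "R' = max R 0"
  have ne: "{-R'..R'} \<noteq> {}" by (simp add: R'_def)
  obtain y where y: "\<And>x. x \<in> {-R'..R'} \<Longrightarrow> rho y \<le> rho x"
    using continuous_attains_inf[OF compact_Icc ne continuous_on_subset[OF continuous_rho subset_UNIV]] by blast
  obtain z where z: "\<And>x. x \<in> {-R'..R'} \<Longrightarrow> pot z \<le> pot x"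
    using continuous_attains_inf[OF compact_Icc ne continuous_on_subset[OF continuous_pot subset_UNIV]] by blast
  define m where "m = (rho y)\<^sup>2 / 4"
  \<comment> \<open>Chosen so that \<open>t * m = \<bar>pot z\<bar> + 1\<close>: inside the interval
    the density term outweighs the minimum of \<open>pot\<close> and leaves 1.\<close>
  define t where "t = (\<bar>pot z\<bar> + 1) / m"
  have m: "m > 0" using rho_pos[of y] by (simp add: m_def)
  have t: "t \<ge> 0" using m by (simp add: t_def)
  have pt: "1 \<le> pot x + t * ((rho x)\<^sup>2 / 4)" for x
  proof (cases "x \<in> {-R'..R'}")
    case True
    have "m \<le> (rho x)\<^sup>2 / 4"
      unfolding m_def using y[OF True] rho_pos[of y] by (intro divide_right_mono power_mono) auto
    hence "t * m \<le> t * ((rho x)\<^sup>2 / 4)" using t by (rule mult_left_mono)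
    moreover have "t * m = \<bar>pot z\<bar> + 1" using m by (simp add: t_def)
    ultimately show ?thesis using z[OF True] by linarith
  next
    case False
    hence "pot x \<ge> 1" by (intro R) (auto simp: R'_def)
    thus ?thesis using t by (simp add: add_increasing2)
  qed
  \<comment> \<open>The form is used with total weight \<open>1 + t\<close>: once for
    \<open>pot\<close> and \<open>t\<close> times for the density.\<close>
  define d where "d = 1 / (1 + t)"
  have d: "d > 0" using t by (simp add: d_def)
  have gap: "d * (LINT x|lborel. (v x)\<^sup>2) \<le> (LINT x|lborel. (v' x - deriv V x / 2 * v x)\<^sup>2)" if v: "C1c v v'" for v v'
  proof -
    have v0: "C0c v" using v C1c_C0c by blast
    have i: "integrable lborel (\<lambda>x. pot x * (v x)\<^sup>2)" "integrable lborel (\<lambda>x. (rho x)\<^sup>2 / 4 * (v x)\<^sup>2)"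
      "integrable lborel (\<lambda>x. (v x)\<^sup>2)"
      by (intro integrable_C0c C0c_mult_left C0c_power2 v0 continuous_intros continuous_rho continuous_pot; simp)+
    have "(LINT x|lborel. (v x)\<^sup>2) \<le> (LINT x|lborel. pot x * (v x)\<^sup>2 + t * ((rho x)\<^sup>2 / 4 * (v x)\<^sup>2))"
    proof (rule integral_mono)
      show "integrable lborel (\<lambda>x. pot x * (v x)\<^sup>2 + t * ((rho x)\<^sup>2 / 4 * (v x)\<^sup>2))"
        using i by (intro Bochner_Integration.integrable_add integrable_mult_right) auto
      show "(v x)\<^sup>2 \<le> pot x * (v x)\<^sup>2 + t * ((rho x)\<^sup>2 / 4 * (v x)\<^sup>2)" for x
        using mult_right_mono[OF pt[of x], of "(v x)\<^sup>2"] by (simp add: algebra_simps)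
    qed (rule i)
    also have "\<dots> = (LINT x|lborel. pot x * (v x)\<^sup>2) + t * (LINT x|lborel. (rho x)\<^sup>2 / 4 * (v x)\<^sup>2)"
      unfolding Bochner_Integration.integral_add[OF i(1) integrable_mult_right[OF i(2)]] by simp
    also have "\<dots> \<le> (LINT x|lborel. (v' x - deriv V x / 2 * v x)\<^sup>2) + t * (LINT x|lborel. (v' x - deriv V x / 2 * v x)\<^sup>2)"
      by (intro add_mono mult_left_mono integral_square_ge_pot integral_square_ge_rho v t)
    also have "\<dots> = (1 + t) * (LINT x|lborel. (v' x - deriv V x / 2 * v x)\<^sup>2)" by (simp add: algebra_simps)
    finally show ?thesis using t by (simp add: d_def field_simps)
  qed
  \<comment> \<open>The constant function serves as constraint: orthogonality to it is the mean
    condition under which the partner function has compact support.\<close>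
  have "lam V 1 \<ge> ereal d"
  proof (rule lam_ge[where b="\<lambda>_ _. 1"])
    fix \<phi> assume \<phi>: "test_fun \<phi>" and o: "\<And>i::nat. i < 1 \<Longrightarrow> (LINT x|mu V. \<phi> x * 1) = 0"
    have "(LINT x|mu V. \<phi> x) = 0" using o[of 0] by simp
    then obtain v v' where v: "C1c v v'"
      "\<And>c. c > 0 \<Longrightarrow> c * (LINT x|lborel. (v x)\<^sup>2) \<le> (LINT x|lborel. (v' x - deriv V x / 2 * v x)\<^sup>2) \<Longrightarrow>
       c * (LINT x|mu V. (\<phi> x)\<^sup>2) \<le> (LINT x|mu V. (deriv \<phi> x)\<^sup>2)"
      by (rule test_fun_partner[OF \<phi>]) (rule that)
    show "d * (LINT x|mu V. (\<phi> x)\<^sup>2) \<le> (LINT x|mu V. (deriv \<phi> x)\<^sup>2)"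
      by (rule v(2)[OF d gap[OF v(1)]])
  qed (rule L2_const)
  moreover have "0 < ereal d" using d by simp
  ultimately show ?thesis by (rule less_le_trans[rotated])
qed

end

text \<open>\<open>f - k x^2\<close> is convex, hence lies above its tangent at 0, and far out the
  quadratic term beats the tangent.\<close>

lemma strongly_convex_ge_1:
  fixes f :: "real \<Rightarrow> real"
  assumes f: "\<And>x. (f has_real_derivative f1 x) (at x)" "\<And>x. (f1 has_real_derivative f2 x) (at x)"
    and k: "k > 0" and f2: "\<And>x. f2 x \<ge> 2 * k"
  obtains R where "\<And>x. \<bar>x\<bar> > R \<Longrightarrow> f x \<ge> 1"
proof -
  have "convex_on UNIV (\<lambda>x. f x - k * x\<^sup>2)"
  proof (rule f''_ge0_imp_convex)
    show "((\<lambda>x. f x - k * x\<^sup>2) has_real_derivative f1 x - 2 * k * x) (at x)" for x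
      by (auto intro!: derivative_eq_intros f)
    show "((\<lambda>x. f1 x - 2 * k * x) has_real_derivative f2 x - 2 * k) (at x)" for x
      by (auto intro!: derivative_eq_intros f)
  qed (use f2 in auto)
  moreover have "((\<lambda>x. f x - k * x\<^sup>2) has_real_derivative f1 0) (at 0)"
    by (auto intro!: derivative_eq_intros f)
  ultimately have t: "f x - k * x\<^sup>2 - f 0 \<ge> f1 0 * x" for x
    using convex_on_imp_above_tangent[of UNIV "\<lambda>x. f x - k * x\<^sup>2" 0 x "f1 0"] by simp
  define R where "R = max 1 ((\<bar>f 0\<bar> + 1 + \<bar>f1 0\<bar>) / k)"
  have "f x \<ge> 1" if x: "\<bar>x\<bar> > R" for x
  proof -
    have "\<bar>x\<bar> \<ge> 1" "\<bar>x\<bar> \<ge> (\<bar>f 0\<bar> + 1 + \<bar>f1 0\<bar>) / k" using x by (auto simp: R_def)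
    hence "k * \<bar>x\<bar> \<ge> \<bar>f 0\<bar> + 1 + \<bar>f1 0\<bar>" using k by (simp add: field_simps)
    hence "k * \<bar>x\<bar> * \<bar>x\<bar> \<ge> (\<bar>f 0\<bar> + 1 + \<bar>f1 0\<bar>) * \<bar>x\<bar>" by (rule mult_right_mono) simp
    moreover have "k * \<bar>x\<bar> * \<bar>x\<bar> = k * x\<^sup>2" by (simp add: power2_eq_square)
    moreover have "(\<bar>f 0\<bar> + 1) * \<bar>x\<bar> \<ge> (\<bar>f 0\<bar> + 1) * 1" using \<open>\<bar>x\<bar> \<ge> 1\<close> by (intro mult_left_mono) auto
    moreover have "f1 0 * x \<ge> - \<bar>f1 0\<bar> * \<bar>x\<bar>" using abs_ge_minus_self[of "f1 0 * x"] by (simp add: abs_mult)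
    ultimately show ?thesis using t[of x] abs_ge_minus_self[of "f 0"] by (simp add: algebra_simps power2_eq_square)
  qed
  thus ?thesis by (rule that)
qed

section \<open>Poincare inequality from the first max-min value\<close>

text \<open>Uniform approximation of \<open>\<psi>\<close> itself would say nothing about
  derivatives. Weierstrass is applied to \<open>\<psi>'\<close>, and the primitive agreeing with
  \<open>\<psi>\<close> at 0 is then off by at most \<open>e * R\<close>.\<close>

lemma polynomial_C1_approx:
  fixes \<psi> \<psi>' :: "real \<Rightarrow> real"
  assumes \<psi>: "\<And>x. (\<psi> has_real_derivative \<psi>' x) (at x)" "continuous_on UNIV \<psi>'" and e: "e > 0" and R: "R > 0"
  obtains P p where "smooth P" "smooth p" "\<And>x. (P has_real_derivative p x) (at x)"
    "\<And>x. \<bar>x\<bar> \<le> R \<Longrightarrow> \<bar>p x - \<psi>' x\<bar> \<le> e" "\<And>x. \<bar>x\<bar> \<le> R \<Longrightarrow> \<bar>P x - \<psi> x\<bar> \<le> e * R"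
proof -
  obtain p where p: "real_polynomial_function p" "\<And>x. x \<in> {-R..R} \<Longrightarrow> \<bar>\<psi>' x - p x\<bar> < e"
    using Stone_Weierstrass_real_polynomial_function[OF compact_Icc continuous_on_subset[OF \<psi>(2) subset_UNIV] e] by blast
  have sp: "smooth p" using p(1) by (rule smooth_real_polynomial_function)
  have cp: "continuous_on UNIV p" using smooth_DERIV[OF sp] by (rule continuous_on_UNIV_DERIV)
  obtain G where G: "\<And>x. (G has_real_derivative p x) (at x)"
    using continuous_antiderivative[OF cp] by blast
  define P where "P x = G x - G 0 + \<psi> 0" for x
  have P: "(P has_real_derivative p x) (at x)" for x
    unfolding P_def by (auto intro!: derivative_eq_intros G)
  have pe: "\<bar>p x - \<psi>' x\<bar> \<le> e" if "\<bar>x\<bar> \<le> R" for x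
  proof -
    have "\<bar>\<psi>' x - p x\<bar> < e" using that by (intro p(2)) auto
    thus ?thesis by linarith
  qed
  have "\<bar>P x - \<psi> x\<bar> \<le> e * R" if x: "\<bar>x\<bar> \<le> R" for x
  proof -
    have "norm ((P x - \<psi> x) - (P 0 - \<psi> 0)) \<le> e * norm (x - 0)"
    proof (rule field_differentiable_bound[of "{-R..R}" "\<lambda>x. P x - \<psi> x" "\<lambda>x. p x - \<psi>' x"])
      show "((\<lambda>x. P x - \<psi> x) has_real_derivative p z - \<psi>' z) (at z within {-R..R})" for z
        by (auto intro!: derivative_eq_intros has_field_derivative_at_within[OF P] has_field_derivative_at_within[OF \<psi>(1)])
      show "norm (p z - \<psi>' z) \<le> e" if "z \<in> {-R..R}" for z using pe[of z] that by auto
    qed (use x R in auto)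
    also have "\<dots> \<le> e * R" using x e by simp
    finally show ?thesis by (simp add: P_def)
  qed
  thus ?thesis using that[OF smooth_if_deriv_smooth[OF P sp] sp P pe] by blast
qed

text \<open>Pointwise limits together with envelopes independent of \<open>n\<close> are the input
  for dominated convergence; the envelopes are square integrable as soon as \<open>\<psi>\<close>
  and \<open>\<psi>'\<close> are.\<close>

lemma test_fun_C1_approx:
  fixes \<psi> \<psi>' :: "real \<Rightarrow> real"
  assumes \<psi>: "\<And>x. (\<psi> has_real_derivative \<psi>' x) (at x)" "continuous_on UNIV \<psi>'"
  obtains T C where "\<And>n::nat. test_fun (T n)" "\<And>x. (\<lambda>n. T n x) \<longlonglongrightarrow> \<psi> x"
    "\<And>x. (\<lambda>n. deriv (T n) x) \<longlonglongrightarrow> \<psi>' x" "\<And>n x. \<bar>T n x\<bar> \<le> 1 + \<bar>\<psi> x\<bar>"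
    "\<And>n x. \<bar>deriv (T n) x\<bar> \<le> C * (1 + \<bar>\<psi> x\<bar>) + (1 + \<bar>\<psi>' x\<bar>)"
proof -
  obtain cut cut' C where cut: "\<And>n::nat. test_fun (cut n)" "\<And>n x. (cut n has_real_derivative cut' n x) (at x)"
    "\<And>n. continuous_on UNIV (cut' n)"
    "\<And>n x. \<bar>x\<bar> \<le> real n \<Longrightarrow> cut n x = 1" "\<And>n x. \<bar>x\<bar> < real n \<Longrightarrow> cut' n x = 0"
    "\<And>n x. \<bar>x\<bar> \<ge> real n + 1 \<Longrightarrow> cut n x = 0"
    "\<And>n x. \<bar>x\<bar> > real n + 1 \<Longrightarrow> cut' n x = 0"
    "\<And>n x. 0 \<le> cut n x" "\<And>n x. cut n x \<le> 1" "\<And>n x. \<bar>cut' n x\<bar> \<le> C"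
    by (rule smooth_cutoffs) (rule that)
  have C: "C \<ge> 0" using cut(10)[of 0 0] by linarith
  \<comment> \<open>\<open>cut n\<close> lives on radius \<open>n + 1\<close>, and the error in
    value is the error in the derivative times this radius; the square keeps both at most
    \<open>1 / (n + 1)\<close>.\<close>
  define e where "e n = 1 / (real n + 1)\<^sup>2" for n
  have e: "e n > 0" "e n * (real n + 1) = 1 / (real n + 1)" "e n \<le> 1 / (real n + 1)" "1 / (real n + 1) \<le> 1" for n
  proof -
    have "0 < 1 / k\<^sup>2 \<and> 1 / k\<^sup>2 * k = 1 / k \<and> 1 / k\<^sup>2 \<le> 1 / k \<and> 1 / k \<le> 1" if "k \<ge> 1" for k :: real
      using that by (auto simp: power2_eq_square field_simps)
    from this[of "real n + 1"]
    show "e n > 0" "e n * (real n + 1) = 1 / (real n + 1)" "e n \<le> 1 / (real n + 1)" "1 / (real n + 1) \<le> 1"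
      by (auto simp: e_def)
  qed
  have "\<exists>P p. smooth P \<and> smooth p \<and> (\<forall>x. (P has_real_derivative p x) (at x)) \<and>
      (\<forall>x. \<bar>x\<bar> \<le> real n + 1 \<longrightarrow> \<bar>p x - \<psi>' x\<bar> \<le> 1 / (real n + 1)) \<and>
      (\<forall>x. \<bar>x\<bar> \<le> real n + 1 \<longrightarrow> \<bar>P x - \<psi> x\<bar> \<le> 1 / (real n + 1))" for n
  proof -
    obtain P p where "smooth P" "smooth p" "\<And>x. (P has_real_derivative p x) (at x)"
      "\<And>x. \<bar>x\<bar> \<le> real n + 1 \<Longrightarrow> \<bar>p x - \<psi>' x\<bar> \<le> e n" "\<And>x. \<bar>x\<bar> \<le> real n + 1 \<Longrightarrow> \<bar>P x - \<psi> x\<bar> \<le> e n * (real n + 1)"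
      by (rule polynomial_C1_approx[OF \<psi> e(1)[of n], of "real n + 1"]) (auto intro: that)
    thus ?thesis using e(2,3)[of n] by (intro exI[of _ P] exI[of _ p]) (auto intro: order_trans)
  qed
  then obtain P p where Pp: "\<And>n. smooth (P n)" "\<And>n. smooth (p n)" "\<And>n x. (P n has_real_derivative p n x) (at x)"
      "\<And>n x. \<bar>x\<bar> \<le> real n + 1 \<Longrightarrow> \<bar>p n x - \<psi>' x\<bar> \<le> 1 / (real n + 1)"
      "\<And>n x. \<bar>x\<bar> \<le> real n + 1 \<Longrightarrow> \<bar>P n x - \<psi> x\<bar> \<le> 1 / (real n + 1)"
    by metis
  define T where "T n x = cut n x * P n x" for n x
  have dT: "deriv (T n) x = cut' n x * P n x + cut n x * p n x" for n x
    unfolding T_def by (rule DERIV_imp_deriv) (auto intro!: derivative_eq_intros cut Pp)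
  have ev: "eventually (\<lambda>n. \<bar>x\<bar> < real n) sequentially" for x :: real
    using eventually_gt_at_top[of "nat \<lceil>\<bar>x\<bar>\<rceil>"] by eventually_elim linarith
  have lim0: "(\<lambda>n. 1 / (real n + 1)) \<longlonglongrightarrow> 0"
    using LIMSEQ_inverse_real_of_nat by (simp add: inverse_eq_divide add.commute)
  show ?thesis
  proof (rule that[of T C])
    show "test_fun (T n)" for n
    proof -
      have "smooth (T n)" unfolding T_def using cut(1) Pp(1) by (intro smooth_mult) (auto simp: test_fun_def)
      thus ?thesis using cut(6)[of n] unfolding test_fun_def T_def by (auto intro!: exI[of _ "real n + 1"])
    qed
    show "(\<lambda>n. T n x) \<longlonglongrightarrow> \<psi> x" for x
    proof (rule LIM_zero_cancel, rule Lim_null_comparison[OF _ lim0])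
      show "\<forall>\<^sub>F n in sequentially. norm (T n x - \<psi> x) \<le> 1 / (real n + 1)"
        using ev[of x] by eventually_elim (use Pp(5) cut(4) in \<open>auto simp: T_def\<close>)
    qed
    show "(\<lambda>n. deriv (T n) x) \<longlonglongrightarrow> \<psi>' x" for x
    proof (rule LIM_zero_cancel, rule Lim_null_comparison[OF _ lim0])
      show "\<forall>\<^sub>F n in sequentially. norm (deriv (T n) x - \<psi>' x) \<le> 1 / (real n + 1)"
        using ev[of x] by eventually_elim (use Pp(4) cut(4,5) in \<open>auto simp: dT\<close>)
    qed
    show "\<bar>T n x\<bar> \<le> 1 + \<bar>\<psi> x\<bar>" for n x
    proof (cases "\<bar>x\<bar> \<le> real n + 1")
      case True
      have "\<bar>T n x\<bar> \<le> 1 * \<bar>P n x\<bar>"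
        unfolding T_def abs_mult using cut(8,9)[of n x] by (intro mult_right_mono) auto
      thus ?thesis using Pp(5)[OF True] e(4)[of n] by linarith
    qed (use cut(6) in \<open>auto simp: T_def\<close>)
    show "\<bar>deriv (T n) x\<bar> \<le> C * (1 + \<bar>\<psi> x\<bar>) + (1 + \<bar>\<psi>' x\<bar>)" for n x
    proof (cases "\<bar>x\<bar> \<le> real n + 1")
      case True
      have "\<bar>cut' n x * P n x\<bar> \<le> C * (1 + \<bar>\<psi> x\<bar>)"
        unfolding abs_mult using cut(10)[of n x] C Pp(5)[OF True] e(4)[of n] by (intro mult_mono) linarith+
      moreover have "\<bar>cut n x * p n x\<bar> \<le> 1 * (1 + \<bar>\<psi>' x\<bar>)"
        unfolding abs_mult using cut(8,9)[of n x] Pp(4)[OF True] e(4)[of n] by (intro mult_mono) linarith+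
      ultimately show ?thesis unfolding dT by (intro order_trans[OF abs_triangle_ineq] add_mono) auto
    qed (use cut(6,7) C in \<open>auto simp: dT\<close>)
  qed
qed

context gibbs
begin

lemma tendsto_integral_mult_dominated:
  assumes "\<And>n. a n \<in> borel_measurable borel" "\<And>n. b n \<in> borel_measurable borel"
    and lim: "\<And>x. (\<lambda>n. a n x) \<longlonglongrightarrow> a' x" "\<And>x. (\<lambda>n. b n x) \<longlonglongrightarrow> b' x"
    and bnd: "\<And>n x. \<bar>a n x\<bar> \<le> A x" "\<And>n x. \<bar>b n x\<bar> \<le> B x" and AB: "L2 V A" "L2 V B"
  shows "(\<lambda>n. LINT x|mu V. a n x * b n x) \<longlonglongrightarrow> (LINT x|mu V. a' x * b' x)"
proof (rule integral_dominated_convergence[where w="\<lambda>x. A x * B x"])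
  note [measurable] = assms(1,2)
  have "a' \<in> borel_measurable borel" by (rule borel_measurable_LIMSEQ_real[OF lim(1)]) (use assms in auto)
  moreover have "b' \<in> borel_measurable borel" by (rule borel_measurable_LIMSEQ_real[OF lim(2)]) (use assms in auto)
  ultimately show "(\<lambda>x. a' x * b' x) \<in> borel_measurable (mu V)" by measurable
  show "(\<lambda>x. a n x * b n x) \<in> borel_measurable (mu V)" for n by measurable
  show "integrable (mu V) (\<lambda>x. A x * B x)" by (rule L2_integrable_mult[OF AB])
  show "AE x in mu V. (\<lambda>n. a n x * b n x) \<longlonglongrightarrow> a' x * b' x"
    by (intro AE_I2 tendsto_intros lim)
  have "\<bar>a n x * b n x\<bar> \<le> A x * B x" for n x
    unfolding abs_mult by (intro mult_mono bnd order_trans[OF abs_ge_zero bnd(1)[of n x]]) auto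
  thus "AE x in mu V. norm (a n x * b n x) \<le> A x * B x" for n by simp
qed

lemma L2_abs: "L2 V f \<Longrightarrow> L2 V (\<lambda>x. \<bar>f x\<bar>)"
  unfolding L2_def by auto

text \<open>If the inequality failed, \<open>l' \<integral> f\<^sup>2 - \<integral> f'\<^sup>2\<close> would, for some \<open>l' < l\<close>, be positive
  definite on the span of a cutoff (approximating 1) and an approximation of the centred \<open>\<psi>\<close>;
  but every single constraint admits a nonzero element of that two-dimensional space.\<close>

lemma poincare_C1:
  assumes l: "lam V 1 = ereal l" and \<psi>: "\<And>x. (\<psi> has_real_derivative \<psi>' x) (at x)" "continuous_on UNIV \<psi>'"
    and L: "L2 V \<psi>" "L2 V \<psi>'"
  shows "l * ((LINT x|mu V. (\<psi> x)\<^sup>2) - (LINT x|mu V. \<psi> x)\<^sup>2) \<le> (LINT x|mu V. (\<psi>' x)\<^sup>2)"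
proof (rule ccontr)
  assume neg: "\<not> ?thesis"
  define c where "c = (LINT x|mu V. \<psi> x)"
  define f where "f x = \<psi> x - c" for x
  have f: "(f has_real_derivative \<psi>' x) (at x)" for x
    unfolding f_def by (auto intro!: derivative_eq_intros \<psi>)
  have Lf: "L2 V f" unfolding f_def by (intro L2_diff L L2_const)
  have mf: "(LINT x|mu V. f x) = 0"
    unfolding f_def using L2_integrable[OF L(1)] by (simp add: integral_mu_const c_def measure_mu_UNIV)
  define N D where "N = (LINT x|mu V. (f x)\<^sup>2)" "D = (LINT x|mu V. (\<psi>' x)\<^sup>2)"
  have "N = (LINT x|mu V. (\<psi> x)\<^sup>2) - c\<^sup>2"
    using integral_lincomb_power2[OF L(1) L2_const[of c], of 1 "-1"]
    by (simp add: N_D_def f_def c_def[symmetric] measure_mu_UNIV power2_eq_square)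
  hence lN: "D < l * N" using neg by (simp add: N_D_def c_def)
  have N0: "N \<ge> 0" "D \<ge> 0" by (auto simp: N_D_def)
  hence N: "N > 0" using lN by (cases "N = 0") auto
  have l0: "l > 0"
  proof (rule ccontr)
    assume "\<not> l > 0"
    hence "l * N \<le> 0" using N by (simp add: mult_le_0_iff)
    thus False using lN N0 by simp
  qed
  have "D / N < l" using lN N by (simp add: field_simps)
  \<comment> \<open>\<open>l' < l\<close> lets the supremum supply a constraint that forces all
    quotients above \<open>l'\<close>; \<open>D / N < l'\<close> keeps the centred function a
    violator.\<close>
  then obtain l' where l': "l' < l" "D / N < l'" using dense by blast
  moreover have "0 \<le> D / N" using N0 N by simp
  ultimately have l'0: "0 < l'" by simp
  have DN: "D < l' * N" using l'(2) N by (simp add: field_simps)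
  have "ereal l' < lam V 1" using l l'(1) by simp
  then obtain gs where gs: "L2 V (gs (0::nat))" and
    inf: "ereal l' < (INF fg \<in> {(f, g). graph V f g \<and> (LINT x|mu V. (f x)\<^sup>2) > 0 \<and>
                       (\<forall>i<1. (LINT x|mu V. f x * gs i x) = 0)}.
        ereal ((LINT x|mu V. fst fg x * snd fg x) / (LINT x|mu V. (fst fg x)\<^sup>2)))"
    unfolding lam_def less_SUP_iff by auto
  have low: "l' * (LINT x|mu V. (\<phi> x)\<^sup>2) \<le> (LINT x|mu V. (deriv \<phi> x)\<^sup>2)"
    if \<phi>: "test_fun \<phi>" "(LINT x|mu V. \<phi> x * gs 0 x) = 0" for \<phi>
  proof (cases "(LINT x|mu V. (\<phi> x)\<^sup>2) > 0")
    case True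
    have "ereal l' \<le> ereal ((LINT x|mu V. fst (\<phi>, \<lambda>x. - Lop V \<phi> x) x * snd (\<phi>, \<lambda>x. - Lop V \<phi> x) x) / (LINT x|mu V. (fst (\<phi>, \<lambda>x. - Lop V \<phi> x) x)\<^sup>2))"
      by (rule order_trans[OF less_imp_le[OF inf]], rule INF_lower) (use \<phi> True graph_test_fun[OF \<phi>(1)] in auto)
    hence "l' \<le> (LINT x|mu V. (deriv \<phi> x)\<^sup>2) / (LINT x|mu V. (\<phi> x)\<^sup>2)"
      unfolding fst_conv snd_conv integral_test_fun_Lop[OF \<phi>(1)] by simp
    thus ?thesis using True by (simp add: field_simps)
  next
    case False
    hence "(LINT x|mu V. (\<phi> x)\<^sup>2) = 0" by (simp add: antisym not_less)
    thus ?thesis by simp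
  qed
  obtain S Cs where S: "\<And>n::nat. test_fun (S n)" "\<And>x. (\<lambda>n. S n x) \<longlonglongrightarrow> 1"
    "\<And>x. (\<lambda>n. deriv (S n) x) \<longlonglongrightarrow> 0" "\<And>n x. \<bar>S n x\<bar> \<le> 1 + \<bar>1\<bar>"
    "\<And>n x. \<bar>deriv (S n) x\<bar> \<le> Cs * (1 + \<bar>1\<bar>) + (1 + \<bar>0\<bar>)"
    by (rule test_fun_C1_approx[of "\<lambda>_. 1" "\<lambda>_. 0"]) (auto intro: that)
  obtain T Ct where T: "\<And>n::nat. test_fun (T n)" "\<And>x. (\<lambda>n. T n x) \<longlonglongrightarrow> f x"
    "\<And>x. (\<lambda>n. deriv (T n) x) \<longlonglongrightarrow> \<psi>' x" "\<And>n x. \<bar>T n x\<bar> \<le> 1 + \<bar>f x\<bar>"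
    "\<And>n x. \<bar>deriv (T n) x\<bar> \<le> Ct * (1 + \<bar>f x\<bar>) + (1 + \<bar>\<psi>' x\<bar>)"
    by (rule test_fun_C1_approx[OF f \<psi>(2)]) (rule that)
  have Ld: "L2 V (\<lambda>x. 1 + \<bar>f x\<bar>)" "L2 V (\<lambda>x. Ct * (1 + \<bar>f x\<bar>) + (1 + \<bar>\<psi>' x\<bar>))"
  proof -
    have 1: "L2 V (\<lambda>x. 1 + \<bar>h x\<bar>)" if "L2 V h" for h
      using L2_lincomb[OF L2_const[of 1] L2_abs[OF that], of 1 1] by simp
    show "L2 V (\<lambda>x. 1 + \<bar>f x\<bar>)" by (rule 1[OF Lf])
    show "L2 V (\<lambda>x. Ct * (1 + \<bar>f x\<bar>) + (1 + \<bar>\<psi>' x\<bar>))"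
      using L2_lincomb[OF 1[OF Lf] 1[OF L(2)], of Ct 1] by simp
  qed
  have mS: "S n \<in> borel_measurable borel" "deriv (S n) \<in> borel_measurable borel" for n
    using L2_test_fun(1,2)[OF S(1)[of n]] by (auto simp: L2_def)
  have mT: "T n \<in> borel_measurable borel" "deriv (T n) \<in> borel_measurable borel" for n
    using L2_test_fun(1,2)[OF T(1)[of n]] by (auto simp: L2_def)
  \<comment> \<open>\<open>a\<close>, \<open>b\<close>, \<open>d\<close> are the matrix entries of
    the form \<open>l' \<integral> f\<^sup>2 - \<integral> f'\<^sup>2\<close> on the span of
    \<open>S n\<close> and \<open>T n\<close>. The off-diagonal limit is 0 because \<open>f\<close>
    is centred, and the limits \<open>l'\<close> and \<open>l' * N - D\<close> on the diagonal are
    positive.\<close>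
  define a where "a n = l' * (LINT x|mu V. S n x * S n x) - (LINT x|mu V. deriv (S n) x * deriv (S n) x)" for n
  define b where "b n = l' * (LINT x|mu V. T n x * T n x) - (LINT x|mu V. deriv (T n) x * deriv (T n) x)" for n
  define d where "d n = l' * (LINT x|mu V. S n x * T n x) - (LINT x|mu V. deriv (S n) x * deriv (T n) x)" for n
  have "a \<longlonglongrightarrow> l' * (LINT x|mu V. 1 * 1) - (LINT x|mu V. 0 * 0)" unfolding a_def
    by (intro tendsto_intros tendsto_integral_mult_dominated[OF _ _ _ _ S(4) S(4)]
        tendsto_integral_mult_dominated[OF _ _ _ _ S(5) S(5)] S mS L2_const)
  hence a: "a \<longlonglongrightarrow> l'" by (simp add: measure_mu_UNIV)
  have "b \<longlonglongrightarrow> l' * (LINT x|mu V. f x * f x) - (LINT x|mu V. \<psi>' x * \<psi>' x)" unfolding b_def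
    by (intro tendsto_intros tendsto_integral_mult_dominated[OF _ _ _ _ T(4) T(4)]
        tendsto_integral_mult_dominated[OF _ _ _ _ T(5) T(5)] T mT Ld)
  hence b: "b \<longlonglongrightarrow> l' * N - D" by (simp add: N_D_def power2_eq_square)
  have "d \<longlonglongrightarrow> l' * (LINT x|mu V. 1 * f x) - (LINT x|mu V. 0 * \<psi>' x)" unfolding d_def
    by (intro tendsto_intros tendsto_integral_mult_dominated[OF _ _ _ _ S(4) T(4)]
        tendsto_integral_mult_dominated[OF _ _ _ _ S(5) T(5)] S T mS mT Ld L2_const)
  hence d: "d \<longlonglongrightarrow> 0" by (simp add: mf)
  have "(\<lambda>n. a n * b n - (d n)\<^sup>2) \<longlonglongrightarrow> l' * (l' * N - D) - 0\<^sup>2"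
    by (intro tendsto_intros a b d)
  moreover have "l' * (l' * N - D) - 0\<^sup>2 > 0" using l'0 DN by simp
  ultimately have "\<forall>\<^sub>F n in sequentially. a n * b n - (d n)\<^sup>2 > 0" by (rule order_tendstoD)
  moreover have "\<forall>\<^sub>F n in sequentially. a n > 0" using order_tendstoD(1)[OF a l'0] .
  ultimately have "\<forall>\<^sub>F n in sequentially. a n * b n - (d n)\<^sup>2 > 0 \<and> a n > 0" by (rule eventually_conj)
  then obtain n where n: "a n * b n - (d n)\<^sup>2 > 0" "a n > 0"
    using eventually_happens'[OF sequentially_bot] by blast
  define \<alpha> \<beta> where "\<alpha> = (LINT x|mu V. S n x * gs 0 x)" "\<beta> = (LINT x|mu V. T n x * gs 0 x)"
  \<comment> \<open>A nontrivial combination of \<open>S n\<close> and \<open>T n\<close> orthogonal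
    to \<open>gs 0\<close>.\<close>
  obtain r t where rt: "r \<noteq> 0 \<or> t \<noteq> 0" "r * \<alpha> + t * \<beta> = 0"
  proof (cases "\<beta> = 0")
    case True
    show ?thesis by (rule that[of 0 1]) (auto simp: True)
  next
    case False
    show ?thesis by (rule that[of \<beta> "- \<alpha>"]) (auto simp: False)
  qed
  define \<phi> where "\<phi> x = r * S n x + t * T n x" for x
  have \<phi>: "test_fun \<phi>" unfolding \<phi>_def by (rule test_fun_add_scaled[OF S(1) T(1)])
  have d\<phi>: "deriv \<phi> x = r * deriv (S n) x + t * deriv (T n) x" for x
    unfolding \<phi>_def by (rule test_fun_add_scaled[OF S(1) T(1)])
  note LS = L2_test_fun[OF S(1)[of n]] and LT = L2_test_fun[OF T(1)[of n]]
  have "(LINT x|mu V. \<phi> x * gs 0 x) = (LINT x|mu V. r * (S n x * gs 0 x) + t * (T n x * gs 0 x))"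
    by (simp add: \<phi>_def algebra_simps)
  also have "\<dots> = r * \<alpha> + t * \<beta>"
    using L2_integrable_mult[OF LS(1) gs] L2_integrable_mult[OF LT(1) gs] by (simp add: \<alpha>_\<beta>_def)
  finally have "l' * (LINT x|mu V. (\<phi> x)\<^sup>2) \<le> (LINT x|mu V. (deriv \<phi> x)\<^sup>2)"
    using rt by (intro low[OF \<phi>]) simp
  hence "r\<^sup>2 * a n + 2 * r * t * d n + t\<^sup>2 * b n \<le> 0"
    unfolding d\<phi> unfolding \<phi>_def integral_lincomb_power2[OF LS(1) LT(1)] integral_lincomb_power2[OF LS(2) LT(2)]
      a_def b_def d_def by (simp add: power2_eq_square algebra_simps)
  hence "a n * (r\<^sup>2 * a n + 2 * r * t * d n + t\<^sup>2 * b n) \<le> 0" using n by (simp add: mult_le_0_iff)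
  moreover have "a n * (r\<^sup>2 * a n + 2 * r * t * d n + t\<^sup>2 * b n) = (r * a n + t * d n)\<^sup>2 + t\<^sup>2 * (a n * b n - (d n)\<^sup>2)"
    by (simp add: power2_eq_square algebra_simps)
  ultimately have le: "(r * a n + t * d n)\<^sup>2 + t\<^sup>2 * (a n * b n - (d n)\<^sup>2) \<le> 0" by simp
  have "t = 0"
  proof (rule ccontr)
    assume "t \<noteq> 0"
    hence "t\<^sup>2 * (a n * b n - (d n)\<^sup>2) > 0" using n by simp
    thus False using le zero_le_power2[of "r * a n + t * d n"] by linarith
  qed
  thus False using le n rt by simp
qed

end

section \<open>Regularity of eigenfunctions\<close>

text \<open>For the derivatives of the approximating sequence only pointwise convergence will be
  established; Fatou still gives square integrability of the limit and a one-sided energy estimate,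
  and one side is enough.\<close>

lemma fatou_integrable:
  fixes h :: "nat \<Rightarrow> 'a \<Rightarrow> real"
  assumes h: "\<And>n. integrable M (h n)" "\<And>n x. h n x \<ge> 0" "\<And>x. (\<lambda>n. h n x) \<longlonglongrightarrow> H x"
    and L: "(\<lambda>n. LINT x|M. h n x) \<longlonglongrightarrow> L"
  shows "integrable M H" "(LINT x|M. H x) \<le> L"
proof -
  have m[measurable]: "h n \<in> borel_measurable M" for n using h(1) by auto
  have mH[measurable]: "H \<in> borel_measurable M"
    by (rule borel_measurable_LIMSEQ_real[OF h(3) m])
  have H0: "H x \<ge> 0" for x by (rule LIMSEQ_le_const[OF h(3)]) (use h(2) in auto)
  have L0: "L \<ge> 0" by (rule LIMSEQ_le_const[OF L]) (use h(2) in auto)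
  have "(\<integral>\<^sup>+x. ennreal (H x) \<partial>M) = (\<integral>\<^sup>+x. liminf (\<lambda>n. ennreal (h n x)) \<partial>M)"
  proof (rule nn_integral_cong)
    fix x
    have "(\<lambda>n. ennreal (h n x)) \<longlonglongrightarrow> ennreal (H x)" using h(3) by (rule tendsto_ennrealI)
    thus "ennreal (H x) = liminf (\<lambda>n. ennreal (h n x))"
      using lim_imp_Liminf[OF sequentially_bot] by metis
  qed
  also have "\<dots> \<le> liminf (\<lambda>n. \<integral>\<^sup>+x. ennreal (h n x) \<partial>M)"
    by (rule nn_integral_liminf) measurable
  also have "\<dots> = liminf (\<lambda>n. ennreal (LINT x|M. h n x))"
    using h(1,2) by (simp add: nn_integral_eq_integral)
  also have "\<dots> = ennreal L"
    using lim_imp_Liminf[OF sequentially_bot tendsto_ennrealI[OF L]] .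
  finally have le: "(\<integral>\<^sup>+x. ennreal (H x) \<partial>M) \<le> ennreal L" .
  show i: "integrable M H"
    by (rule integrableI_nonneg) (use H0 le in \<open>auto intro: le_less_trans\<close>)
  show "(LINT x|M. H x) \<le> L"
    using le L0 H0 nn_integral_eq_integral[OF i] by (simp add: ennreal_le_iff)
qed

context gibbs
begin

lemma rho_deriv_DERIV:
  assumes "test_fun \<phi>"
  shows "((\<lambda>x. rho x * deriv \<phi> x) has_real_derivative rho x * Lop V \<phi> x) (at x)"
proof -
  have "((\<lambda>x. rho x * deriv \<phi> x) has_real_derivative - deriv V x * rho x * deriv \<phi> x + deriv (deriv \<phi>) x * rho x) (at x)"
    by (intro DERIV_mult rho_DERIV smooth_DERIV smooth_deriv test_fun_smooth assms)
  thus ?thesis by (simp add: Lop_def algebra_simps)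
qed

lemma continuous_Lop: "test_fun \<phi> \<Longrightarrow> continuous_on UNIV (Lop V \<phi>)"
  using test_fun_C0c(3) C0c_def by blast

text \<open>\<open>rho L \<phi>\<close> is the derivative of the flux \<open>rho \<phi>'\<close>,
  which vanishes far to the left.\<close>

lemma integral_atMost_Lop:
  assumes \<phi>: "test_fun \<phi>"
  shows "(LINT y|mu V. indicator {..x} y * Lop V \<phi> y) = rho x * deriv \<phi> x"
proof -
  obtain R S where R: "\<And>x. \<bar>x\<bar> > R \<Longrightarrow> deriv \<phi> x = 0" "\<And>x. \<bar>x\<bar> > S \<Longrightarrow> Lop V \<phi> x = 0"
    using test_fun_C0c(2,3)[OF \<phi>] unfolding C0c_def by blast
  define a where "a = - (\<bar>R\<bar> + \<bar>S\<bar> + \<bar>x\<bar> + 1)"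
  have a: "a \<le> x" "\<bar>a\<bar> > R" "a < - \<bar>S\<bar>" by (auto simp: a_def)
  have m: "Lop V \<phi> \<in> borel_measurable borel" using test_fun_C0c(3)[OF \<phi>] by (rule C0c_measurable)
  have "(LINT y|mu V. indicator {..x} y * Lop V \<phi> y) = (LINT y|lborel. indicator {a..x} y * (rho y * Lop V \<phi> y))"
    using R(2) a m by (subst integral_mu) (auto intro!: Bochner_Integration.integral_cong split: split_indicator)
  also have "\<dots> = rho x * deriv \<phi> x - rho a * deriv \<phi> a"
    by (rule integral_Icc_deriv[OF a(1) rho_deriv_DERIV[OF \<phi>]])
      (intro continuous_intros continuous_rho continuous_Lop \<phi>)
  finally show ?thesis using R(1)[OF a(2)] by simp
qed

text \<open>The boundary term contains the flux \<open>rho \<phi>'\<close> at \<open>x\<close>,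
  whose limit is zero at a critical point of the eigenfunction. There a half-line energy inequality
  survives the passage to the limit.\<close>

lemma integral_atLeast_deriv_square:
  assumes \<phi>: "test_fun \<phi>"
  shows "(LINT y|mu V. indicator {x..} y * (deriv \<phi> y)\<^sup>2) =
    (LINT y|mu V. indicator {x..} y * \<phi> y * - Lop V \<phi> y) - \<phi> x * (rho x * deriv \<phi> x)"
proof -
  obtain R S where R: "\<And>x. \<bar>x\<bar> > R \<Longrightarrow> deriv \<phi> x = 0" "\<And>x. \<bar>x\<bar> > S \<Longrightarrow> Lop V \<phi> x = 0"
    using test_fun_C0c[OF \<phi>] unfolding C0c_def by blast
  define b where "b = \<bar>R\<bar> + \<bar>S\<bar> + \<bar>x\<bar> + 1"
  have b: "x \<le> b" "\<bar>b\<bar> > R" "b > \<bar>S\<bar>" "b > \<bar>R\<bar>" by (auto simp: b_def)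
  have m[measurable]: "Lop V \<phi> \<in> borel_measurable borel" "deriv \<phi> \<in> borel_measurable borel" "\<phi> \<in> borel_measurable borel"
    using test_fun_C0c[OF \<phi>] C0c_measurable by blast+
  have c: "continuous_on UNIV \<phi>" "continuous_on UNIV (deriv \<phi>)"
    using test_fun_C0c[OF \<phi>] C0c_def by blast+
  have d: "((\<lambda>y. \<phi> y * (rho y * deriv \<phi> y)) has_real_derivative
      deriv \<phi> y * (rho y * deriv \<phi> y) + rho y * Lop V \<phi> y * \<phi> y) (at y)" for y
    by (intro DERIV_mult rho_deriv_DERIV \<phi> smooth_DERIV test_fun_smooth)
  have i: "integrable (mu V) (\<lambda>y. indicator {x..} y * (deriv \<phi> y)\<^sup>2)"
      "integrable (mu V) (\<lambda>y. indicator {x..} y * \<phi> y * Lop V \<phi> y)"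
  proof -
    have "integrable (mu V) (\<lambda>y. (deriv \<phi> y)\<^sup>2 * indicator {x..} y)"
      by (intro integrable_real_mult_indicator L2_integrable_power2 L2_test_fun \<phi>) auto
    thus "integrable (mu V) (\<lambda>y. indicator {x..} y * (deriv \<phi> y)\<^sup>2)" by (simp add: mult_ac)
    have "integrable (mu V) (\<lambda>y. (\<phi> y * Lop V \<phi> y) * indicator {x..} y)"
      by (intro integrable_real_mult_indicator L2_integrable_mult L2_C0c test_fun_C0c \<phi>) auto
    thus "integrable (mu V) (\<lambda>y. indicator {x..} y * \<phi> y * Lop V \<phi> y)" by (simp add: mult_ac)
  qed
  have "(LINT y|mu V. indicator {x..} y * (deriv \<phi> y)\<^sup>2) + (LINT y|mu V. indicator {x..} y * \<phi> y * Lop V \<phi> y)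
    = (LINT y|mu V. indicator {x..} y * (deriv \<phi> y)\<^sup>2 + indicator {x..} y * \<phi> y * Lop V \<phi> y)"
    using i by simp
  also have "\<dots> = (LINT y|lborel. indicator {x..b} y * (deriv \<phi> y * (rho y * deriv \<phi> y) + rho y * Lop V \<phi> y * \<phi> y))"
    using R b by (subst integral_mu)
      (auto intro!: Bochner_Integration.integral_cong simp: power2_eq_square algebra_simps split: split_indicator)
  also have "\<dots> = \<phi> b * (rho b * deriv \<phi> b) - \<phi> x * (rho x * deriv \<phi> x)"
    by (rule integral_Icc_deriv[OF b(1) d]) (intro continuous_intros continuous_rho continuous_Lop \<phi> c)
  finally show ?thesis using R(1)[OF b(2)] by simp
qed

lemma L2_indicator_mult:
  assumes "L2 V f" "S \<in> sets borel"
  shows "L2 V (\<lambda>x. indicator S x * f x)"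
proof -
  have "integrable (mu V) (\<lambda>x. (f x)\<^sup>2 * indicator S x)"
    using assms by (intro integrable_real_mult_indicator L2_integrable_power2) auto
  moreover have "(\<lambda>x. (indicator S x * f x)\<^sup>2) = (\<lambda>x. (f x)\<^sup>2 * indicator S x)"
    by (auto simp: fun_eq_iff split: split_indicator)
  moreover have "(\<lambda>x. indicator S x * f x) \<in> borel_measurable borel"
    using L2_measurable[OF assms(1)] assms(2) by measurable
  ultimately show ?thesis unfolding L2_def by simp
qed

lemma integral_indicator_power2_le:
  assumes "L2 V f" "S \<in> sets borel"
  shows "(LINT x|mu V. (indicator S x * f x)\<^sup>2) \<le> (LINT x|mu V. (f x)\<^sup>2)"
  by (intro integral_mono L2_integrable_power2 L2_indicator_mult assms) (auto split: split_indicator)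

lemma integral_atMost_primitive:
  assumes F: "continuous_on UNIV F" "L2 V F"
  shows "((\<lambda>x. LINT y|mu V. indicator {..x} y * F y) has_real_derivative rho x * F x) (at x)"
proof -
  define I where "I x = (LINT y|mu V. indicator {..x} y * F y)" for x
  have c: "continuous_on UNIV (\<lambda>x. rho x * F x)" by (intro continuous_intros continuous_rho F)
  obtain K where K: "\<And>x. (K has_real_derivative rho x * F x) (at x)"
    using continuous_antiderivative[OF c] by blast
  have step: "I b - I a = K b - K a" if "a \<le> b" for a b
  proof -
    have i: "integrable (mu V) (\<lambda>y. indicator {..x} y * F y)" for x
      by (intro L2_integrable L2_indicator_mult F) auto
    have [measurable]: "F \<in> borel_measurable borel" using F(2) by (rule L2_measurable)
    have "I b - I a = (LINT y|mu V. indicator {..b} y * F y - indicator {..a} y * F y)"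
      unfolding I_def using i by simp
    also have "\<dots> = (LINT y|lborel. rho y * (indicator {..b} y * F y - indicator {..a} y * F y))"
      by (rule integral_mu) measurable
    also have "\<dots> = (LINT y|lborel. indicator {a..b} y * (rho y * F y))"
    proof (rule integral_cong_AE)
      \<comment> \<open>The difference of the two indicators is that of a half-open interval; only
        the null set consisting of \<open>a\<close> is in doubt.\<close>
      show "AE y in lborel. rho y * (indicator {..b} y * F y - indicator {..a} y * F y) = indicator {a..b} y * (rho y * F y)"
        using AE_lborel_singleton[of a] by eventually_elim (use that in \<open>auto split: split_indicator\<close>)
    qed measurable
    also have "\<dots> = K b - K a" by (rule integral_Icc_deriv[OF that K c])
    finally show ?thesis .
  qed
  have "I x = K x + (I 0 - K 0)" for x
    using step[of 0 x] step[of x 0] by (cases "x \<ge> 0") auto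
  hence "I = (\<lambda>x. K x + (I 0 - K 0))" by blast
  moreover have "((\<lambda>x. K x + (I 0 - K 0)) has_real_derivative rho x * F x) (at x)"
    by (auto intro!: derivative_eq_intros K)
  ultimately show ?thesis unfolding I_def by metis
qed

text \<open>L2 convergence of \<open>- L \<phi>\<close> forces the fluxes \<open>rho \<phi>'\<close>
  to converge uniformly. Dividing by \<open>rho\<close> and integrating gives a C1 representative,
  and the integral formula for the flux then upgrades it to a classical solution. The last two
  conclusions record what the study of critical points of \<open>F\<close> requires.\<close>

lemma eigenfunction_regular:
  assumes "eigfun V l f" "(LINT x|mu V. (f x)\<^sup>2) > 0"
  obtains F F' where "\<And>x. (F has_real_derivative F' x) (at x)"
    "\<And>x. (F' has_real_derivative deriv V x * F' x - l * F x) (at x)"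
    "L2 V F" "L2 V F'" "l * (LINT x|mu V. F x) = 0" "(LINT x|mu V. (F x)\<^sup>2) > 0"
    "\<And>x. rho x * F' x = - l * (LINT y|mu V. indicator {..x} y * F y)"
    "\<And>x. F' x = 0 \<Longrightarrow> (LINT y|mu V. indicator {x..} y * (F' y)\<^sup>2) \<le> l * (LINT y|mu V. indicator {x..} y * (F y)\<^sup>2)"
proof -
  obtain g \<phi> where Lf: "L2 V f" and Lg: "L2 V g" and T: "\<And>n::nat. test_fun (\<phi> n)"
    and c1: "(\<lambda>n. LINT x|mu V. (\<phi> n x - f x)\<^sup>2) \<longlonglongrightarrow> 0"
    and c2: "(\<lambda>n. LINT x|mu V. (- Lop V (\<phi> n) x - g x)\<^sup>2) \<longlonglongrightarrow> 0"
    and gf: "AE x in mu V. g x = l * f x"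
    using assms unfolding eigfun_def graph_def by blast
  note T2 = L2_test_fun[OF T]
  have Llf: "L2 V (\<lambda>x. l * f x)" using L2_lincomb[OF Lf L2_const[of 0], of l 0] by simp
  note [measurable] = L2_measurable[OF Lf] L2_measurable[OF Lg] L2_measurable[OF T2(1)] C0c_measurable[OF test_fun_C0c(3)[OF T]]
  have "(LINT x|mu V. (- Lop V (\<phi> n) x - g x)\<^sup>2) = (LINT x|mu V. (- Lop V (\<phi> n) x - l * f x)\<^sup>2)" for n
    by (intro integral_cong_AE eventually_mono[OF gf]) auto
  with c2 have c3: "(\<lambda>n. LINT x|mu V. (- Lop V (\<phi> n) x - l * f x)\<^sup>2) \<longlonglongrightarrow> 0" by simp
  define A where "A n x = rho x * deriv (\<phi> n) x" for n x
  define G where "G x = - l * (LINT y|mu V. indicator {..x} y * f y)" for x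
  define e where "e n = sqrt (LINT x|mu V. (- Lop V (\<phi> n) x - l * f x)\<^sup>2)" for n
  have e0: "e \<longlonglongrightarrow> 0" using tendsto_real_sqrt[OF c3] by (simp add: e_def[abs_def])
  \<comment> \<open>Cauchy-Schwarz against the indicator of a half-line, whose norm is at most 1, so
    the bound does not depend on \<open>x\<close>.\<close>
  have AG: "\<bar>A n x - G x\<bar> \<le> e n" for n x
  proof -
    have d: "L2 V (\<lambda>x. - Lop V (\<phi> n) x - l * f x)" by (rule L2_diff[OF T2(3) Llf])
    have L1: "L2 V (\<lambda>y. indicator {..x} y * 1)" by (rule L2_indicator_mult[OF L2_const]) auto
    have i: "integrable (mu V) (\<lambda>y. indicator {..x} y * Lop V (\<phi> n) y)" "integrable (mu V) (\<lambda>y. indicator {..x} y * f y)"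
      by (intro L2_integrable L2_indicator_mult Lf L2_C0c test_fun_C0c T; simp)+
    have "- (A n x - G x) = (LINT y|mu V. (indicator {..x} y * 1) * (- Lop V (\<phi> n) y - l * f y))"
    proof -
      have "(LINT y|mu V. (indicator {..x} y * 1) * (- Lop V (\<phi> n) y - l * f y)) =
        (LINT y|mu V. - (indicator {..x} y * Lop V (\<phi> n) y) - l * (indicator {..x} y * f y))"
        by (rule Bochner_Integration.integral_cong) (auto simp: algebra_simps)
      also have "\<dots> = - (A n x) - l * (LINT y|mu V. indicator {..x} y * f y)"
        using i integral_atMost_Lop[OF T, of x n] by (simp add: A_def)
      finally show ?thesis by (simp add: G_def)
    qed
    hence "\<bar>A n x - G x\<bar> = \<bar>LINT y|mu V. (indicator {..x} y * 1) * (- Lop V (\<phi> n) y - l * f y)\<bar>"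
      by (metis abs_minus_cancel)
    also have "\<dots> \<le> sqrt (LINT y|mu V. (indicator {..x} y * 1)\<^sup>2) * e n"
      unfolding e_def by (rule L2_cauchy_schwarz[OF L1 d])
    also have "\<dots> \<le> 1 * e n"
    proof (rule mult_right_mono)
      have "(LINT y|mu V. (indicator {..x} y * 1)\<^sup>2) \<le> (LINT y|mu V. (1::real)\<^sup>2)"
        by (rule integral_indicator_power2_le[OF L2_const]) auto
      thus "sqrt (LINT y|mu V. (indicator {..x} y * 1)\<^sup>2) \<le> 1" by (simp add: measure_mu_UNIV)
    qed (simp add: e_def)
    finally show ?thesis by simp
  qed
  have AGlim: "(\<lambda>n. A n x) \<longlonglongrightarrow> G x" for x
    by (rule LIM_zero_cancel, rule Lim_null_comparison[OF _ e0]) (use AG in auto)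
  have cG: "continuous_on UNIV G"
  proof (rule uniform_limit_theorem[of UNIV A])
    show "\<forall>\<^sub>F n in sequentially. continuous_on UNIV (A n)"
      unfolding A_def by (intro always_eventually allI continuous_intros continuous_rho C0c_continuous test_fun_C0c T)
    show "uniform_limit UNIV A G sequentially"
    proof (rule uniform_limitI)
      fix \<epsilon> :: real assume "\<epsilon> > 0"
      from order_tendstoD(2)[OF e0 this]
      show "\<forall>\<^sub>F n in sequentially. \<forall>x\<in>UNIV. dist (A n x) (G x) < \<epsilon>"
        by eventually_elim (use AG in \<open>auto simp: dist_real_def intro: le_less_trans\<close>)
    qed
  qed simp
  define F' where "F' x = G x / rho x" for x
  have cF': "continuous_on UNIV F'" unfolding F'_def
    using rho_pos by (intro continuous_intros cG continuous_rho) (auto simp: less_imp_neq[THEN not_sym])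
  obtain H where H: "\<And>x. (H has_real_derivative F' x) (at x)"
    using continuous_antiderivative[OF cF'] by blast
  have dlim: "(\<lambda>n. deriv (\<phi> n) x) \<longlonglongrightarrow> F' x" for x
  proof -
    have "(\<lambda>n. A n x / rho x) \<longlonglongrightarrow> F' x" unfolding F'_def
      using rho_pos[of x] by (intro tendsto_intros AGlim) auto
    moreover have "A n x / rho x = deriv (\<phi> n) x" for n using rho_pos[of x] by (simp add: A_def)
    ultimately show ?thesis by simp
  qed
  \<comment> \<open>The derivatives control only increments. Division by \<open>rho\<close> is
    harmless on a segment, where \<open>rho\<close> has a positive minimum.\<close>
  have inc: "(\<lambda>n. \<phi> n x - \<phi> n y) \<longlonglongrightarrow> H x - H y" for x y
  proof -
    define S where "S = closed_segment x y"
    have cS: "compact S" "S \<noteq> {}" unfolding S_def by auto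
    obtain z where z: "\<And>t. t \<in> S \<Longrightarrow> rho z \<le> rho t"
      using continuous_attains_inf[OF cS continuous_on_subset[OF continuous_rho subset_UNIV]] by blast
    have bound: "norm ((\<phi> n x - \<phi> n y) - (H x - H y)) \<le> e n * (\<bar>x - y\<bar> / rho z)" for n
    proof -
      have "norm ((\<phi> n x - H x) - (\<phi> n y - H y)) \<le> (e n / rho z) * norm (x - y)"
      proof (rule field_differentiable_bound[of S "\<lambda>t. \<phi> n t - H t" "\<lambda>t. deriv (\<phi> n) t - F' t"])
        show "((\<lambda>t. \<phi> n t - H t) has_real_derivative deriv (\<phi> n) t - F' t) (at t within S)" for t
          by (intro DERIV_diff has_field_derivative_at_within[OF H] has_field_derivative_at_within[OF smooth_DERIV]
              test_fun_smooth T)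
        show "norm (deriv (\<phi> n) t - F' t) \<le> e n / rho z" if "t \<in> S" for t
        proof -
          have "deriv (\<phi> n) t - F' t = (A n t - G t) / rho t"
            using rho_pos[of t] by (simp add: A_def F'_def field_simps)
          hence "norm (deriv (\<phi> n) t - F' t) = \<bar>A n t - G t\<bar> / rho t" using rho_pos[of t] by simp
          also have "\<dots> \<le> e n / rho z"
            using AG[of n t] z[OF that] rho_pos[of z] by (intro frac_le) auto
          finally show ?thesis .
        qed
      qed (auto simp: S_def)
      thus ?thesis by (simp add: algebra_simps)
    qed
    have "(\<lambda>n. e n * (\<bar>x - y\<bar> / rho z)) \<longlonglongrightarrow> 0" 
      using tendsto_mult_right[OF e0, of "\<bar>x - y\<bar> / rho z"] by (simp only: mult_zero_left)
    show ?thesis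
      by (rule LIM_zero_cancel, rule Lim_null_comparison[OF _ \<open>(\<lambda>n. e n * (\<bar>x - y\<bar> / rho z)) \<longlonglongrightarrow> 0\<close>])
        (use bound in auto)
  qed
  have id: "integrable (mu V) (\<lambda>x. (\<phi> n x - f x)\<^sup>2)" for n
    by (intro L2_integrable_power2 L2_diff T2 Lf)
  have "\<exists>r::nat\<Rightarrow>nat. strict_mono r \<and> (AE x in mu V. (\<lambda>n. (\<phi> (r n) x - f x)\<^sup>2) \<longlonglongrightarrow> 0)"
    by (rule tendsto_L1_AE_subseq[OF id]) (use c1 in simp)
  then obtain r :: "nat \<Rightarrow> nat" where r: "strict_mono r" and ae0: "AE x in mu V. (\<lambda>n. (\<phi> (r n) x - f x)\<^sup>2) \<longlonglongrightarrow> 0"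
    by blast
  from ae0 have ae: "AE x in mu V. (\<lambda>n. \<phi> (r n) x) \<longlonglongrightarrow> f x"
  proof eventually_elim
    case (elim x)
    hence "(\<lambda>n. sqrt ((\<phi> (r n) x - f x)\<^sup>2)) \<longlonglongrightarrow> sqrt 0" by (rule tendsto_real_sqrt)
    hence "(\<lambda>n. \<phi> (r n) x - f x) \<longlonglongrightarrow> 0" by (simp add: tendsto_rabs_zero_iff)
    thus ?case by (rule LIM_zero_cancel)
  qed
  \<comment> \<open>The space is not null, so almost everywhere convergence of the subsequence
    yields one point \<open>y\<close>; its value fixes the additive constant left open by the
    increments.\<close>
  have "ae_filter (mu V) \<noteq> bot" by (simp add: ae_filter_eq_bot_iff emeasure_mu_UNIV)
  then obtain y where y: "(\<lambda>n. \<phi> (r n) y) \<longlonglongrightarrow> f y"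
    using eventually_happens'[OF _ ae] by blast
  define F where "F x = H x - H y + f y" for x
  have F: "(F has_real_derivative F' x) (at x)" for x
    unfolding F_def by (auto intro!: derivative_eq_intros H)
  have cF: "continuous_on UNIV F" using F by (rule continuous_on_UNIV_DERIV)
  have Flim: "(\<lambda>n. \<phi> (r n) x) \<longlonglongrightarrow> F x" for x
  proof -
    have "(\<lambda>n. (\<phi> (r n) x - \<phi> (r n) y) + \<phi> (r n) y) \<longlonglongrightarrow> (H x - H y) + f y"
      using LIMSEQ_subseq_LIMSEQ[OF inc r, of x y] by (intro tendsto_add y) (simp add: o_def)
    thus ?thesis by (simp add: F_def)
  qed
  have fF: "AE x in mu V. f x = F x"
    using ae by eventually_elim (use Flim LIMSEQ_unique in blast)
  note [measurable] = borel_measurable_continuous_onI[OF cF]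
  have sq: "(LINT x|mu V. (f x)\<^sup>2) = (LINT x|mu V. (F x)\<^sup>2)"
    by (intro integral_cong_AE eventually_mono[OF fF]) auto
  have LF: "L2 V F"
  proof -
    have "integrable (mu V) (\<lambda>x. (f x)\<^sup>2) \<longleftrightarrow> integrable (mu V) (\<lambda>x. (F x)\<^sup>2)"
      by (intro integrable_cong_AE eventually_mono[OF fF]) auto
    thus ?thesis using Lf unfolding L2_def by simp
  qed
  have GF: "G x = - l * (LINT y|mu V. indicator {..x} y * F y)" for x
  proof -
    have "(LINT y|mu V. indicator {..x} y * f y) = (LINT y|mu V. indicator {..x} y * F y)"
      by (intro integral_cong_AE eventually_mono[OF fF]) auto
    thus ?thesis by (simp add: G_def)
  qed
  \<comment> \<open>Replacing \<open>f\<close> by the continuous \<open>F\<close> in the integral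
    makes the flux differentiable; its derivative is the eigenvalue equation.\<close>
  have dG: "(G has_real_derivative - l * (rho x * F x)) (at x)" for x
  proof -
    have "G = (\<lambda>x. - l * (LINT y|mu V. indicator {..x} y * F y))" using GF by blast
    thus ?thesis using DERIV_cmult[OF integral_atMost_primitive[OF cF LF], of "- l"] by simp
  qed
  have dF': "(F' has_real_derivative deriv V x * F' x - l * F x) (at x)" for x
  proof -
    have "(F' has_real_derivative (- l * (rho x * F x) * rho x - G x * (- deriv V x * rho x)) / (rho x * rho x)) (at x)"
      unfolding F'_def using rho_pos[of x] by (intro DERIV_divide dG rho_DERIV) simp
    moreover have "(- l * (rho x * F x) * rho x - G x * (- deriv V x * rho x)) / (rho x * rho x) = deriv V x * F' x - l * F x"
      using rho_pos[of x] by (simp add: F'_def field_simps)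
    ultimately show ?thesis by simp
  qed
  have mean: "l * (LINT x|mu V. F x) = 0"
  proof -
    have "(\<lambda>n. LINT x|mu V. 1 * - Lop V (\<phi> n) x) \<longlonglongrightarrow> (LINT x|mu V. 1 * (l * f x))"
      by (rule tendsto_integral_mult_L2) (use T2 Llf L2_const c3 in auto)
    moreover have "(LINT x|mu V. 1 * - Lop V (\<phi> n) x) = (LINT x|mu V. 0 * deriv (\<phi> n) x)" for n
      by (rule integral_mult_Lop[OF T]) auto
    ultimately have "(\<lambda>n::nat. 0) \<longlonglongrightarrow> l * (LINT x|mu V. f x)" by simp
    hence "l * (LINT x|mu V. f x) = 0" by (simp add: LIMSEQ_const_iff)
    moreover have "(LINT x|mu V. f x) = (LINT x|mu V. F x)"
      by (intro integral_cong_AE eventually_mono[OF fF]) auto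
    ultimately show ?thesis by simp
  qed
  have LF': "L2 V F'"
  proof -
    have "(\<lambda>n. LINT x|mu V. \<phi> n x * - Lop V (\<phi> n) x) \<longlonglongrightarrow> (LINT x|mu V. f x * (l * f x))"
      by (rule tendsto_integral_mult_L2) (use T2 Lf Llf c1 c3 in auto)
    hence lim: "(\<lambda>n. LINT x|mu V. (deriv (\<phi> n) x)\<^sup>2) \<longlonglongrightarrow> (LINT x|mu V. f x * (l * f x))"
      unfolding integral_test_fun_Lop[OF T] .
    have "integrable (mu V) (\<lambda>x. (F' x)\<^sup>2)"
      by (rule fatou_integrable(1)[OF L2_integrable_power2[OF T2(2)] _ _ lim]) (auto intro!: tendsto_intros dlim)
    thus ?thesis using borel_measurable_continuous_onI[OF cF'] by (simp add: L2_def)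
  qed
  have half: "(LINT y|mu V. indicator {x..} y * (F' y)\<^sup>2) \<le> l * (LINT y|mu V. indicator {x..} y * (F y)\<^sup>2)"
    if x: "F' x = 0" for x
  proof -
    have "G x = 0" using x rho_pos[of x] by (simp add: F'_def)
    have s: "(\<lambda>n. LINT y|mu V. (indicator {x..} y * \<phi> n y - indicator {x..} y * f y)\<^sup>2) \<longlonglongrightarrow> 0"
    proof (rule Lim_null_comparison[OF _ c1], rule always_eventually, rule allI)
      fix n
      have "(LINT y|mu V. (indicator {x..} y * (\<phi> n y - f y))\<^sup>2) \<le> (LINT y|mu V. (\<phi> n y - f y)\<^sup>2)"
        by (rule integral_indicator_power2_le[OF L2_diff[OF T2(1) Lf]]) simp
      thus "norm (LINT y|mu V. (indicator {x..} y * \<phi> n y - indicator {x..} y * f y)\<^sup>2) \<le> (LINT y|mu V. (\<phi> n y - f y)\<^sup>2)"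
        by (simp add: right_diff_distrib)
    qed
    have "(\<lambda>n. LINT y|mu V. (indicator {x..} y * \<phi> n y) * - Lop V (\<phi> n) y) \<longlonglongrightarrow> (LINT y|mu V. (indicator {x..} y * f y) * (l * f y))"
      by (rule tendsto_integral_mult_L2) (use T2 Lf Llf s c3 L2_indicator_mult in auto)
    from LIMSEQ_subseq_LIMSEQ[OF this r]
    have "(\<lambda>n. (LINT y|mu V. indicator {x..} y * \<phi> (r n) y * - Lop V (\<phi> (r n)) y) - \<phi> (r n) x * A (r n) x) \<longlonglongrightarrow>
        (LINT y|mu V. (indicator {x..} y * f y) * (l * f y)) - F x * G x"
      using LIMSEQ_subseq_LIMSEQ[OF AGlim r, of x] by (intro tendsto_diff tendsto_mult Flim) (auto simp: o_def)
    hence lim: "(\<lambda>n. LINT y|mu V. indicator {x..} y * (deriv (\<phi> (r n)) y)\<^sup>2) \<longlonglongrightarrow> (LINT y|mu V. (indicator {x..} y * f y) * (l * f y))"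
      unfolding integral_atLeast_deriv_square[OF T] A_def using \<open>G x = 0\<close> by simp
    have "(LINT y|mu V. indicator {x..} y * (F' y)\<^sup>2) \<le> (LINT y|mu V. (indicator {x..} y * f y) * (l * f y))"
    proof (rule fatou_integrable(2)[OF _ _ _ lim])
      show "integrable (mu V) (\<lambda>y. indicator {x..} y * (deriv (\<phi> (r n)) y)\<^sup>2)" for n
        using integrable_real_mult_indicator[OF _ L2_integrable_power2[OF T2(2)[of "r n"]], of "{x..}"] by (simp add: mult.commute)
      show "(\<lambda>n. indicator {x..} y * (deriv (\<phi> (r n)) y)\<^sup>2) \<longlonglongrightarrow> indicator {x..} y * (F' y)\<^sup>2" for y
        using LIMSEQ_subseq_LIMSEQ[OF dlim r, of y] by (intro tendsto_intros) (simp add: o_def)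
    qed auto
    also have "\<dots> = (LINT y|mu V. l * (indicator {x..} y * (F y)\<^sup>2))"
      by (intro integral_cong_AE eventually_mono[OF fF]) (auto simp: power2_eq_square)
    finally show ?thesis by simp
  qed
  show ?thesis
  proof (rule that[OF F dF' LF LF' mean _ _ half])
    show "(LINT x|mu V. (F x)\<^sup>2) > 0" using assms(2) sq by simp
    show "rho x * F' x = - l * (LINT y|mu V. indicator {..x} y * F y)" for x
      using rho_pos[of x] GF[of x] by (simp add: F'_def)
  qed
qed

end

section \<open>The ground state of the partner operator\<close>

text \<open>Gronwall's argument for the energy \<open>E = F^2 + F'^2\<close>: its derivative is at
  most \<open>K * E\<close> in absolute value between the two points, with \<open>K\<close> coming
  from \<open>2 * \<bar>F F'\<bar> \<le> E\<close> and the maximum of the coefficient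
  \<open>a\<close>.\<close>

lemma linear_ode_unique_zero:
  fixes F F' a :: "real \<Rightarrow> real"
  assumes F: "\<And>x. (F has_real_derivative F' x) (at x)"
    and F': "\<And>x. (F' has_real_derivative a x * F' x - l * F x) (at x)"
    and a: "continuous_on UNIV a" and zero: "F x0 = 0" "F' x0 = 0"
  shows "F x = 0"
proof -
  define I where "I = {min x x0..max x x0}"
  have cI: "compact I" "I \<noteq> {}" by (auto simp: I_def)
  obtain m where m: "\<And>t. t \<in> I \<Longrightarrow> \<bar>a t\<bar> \<le> \<bar>a m\<bar>"
    using continuous_attains_sup[OF cI, of "\<lambda>t. \<bar>a t\<bar>"] continuous_on_subset[OF a subset_UNIV]
    by (metis continuous_on_rabs)
  define K where "K = \<bar>1 - l\<bar> + 2 * \<bar>a m\<bar>"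
  define E where "E t = (F t)\<^sup>2 + (F' t)\<^sup>2" for t
  define E' where "E' t = (1 - l) * (2 * (F t * F' t)) + 2 * a t * (F' t)\<^sup>2" for t
  have E: "(E has_real_derivative E' t) (at t)" for t
    unfolding E_def E'_def
    by (auto intro!: derivative_eq_intros F F' simp: power2_eq_square algebra_simps)
  have E0: "E t \<ge> 0" for t by (simp add: E_def)
  have E'b: "\<bar>E' t\<bar> \<le> K * E t" if "t \<in> I" for t
  proof -
    have "2 * \<bar>F t * F' t\<bar> \<le> E t"
      using sum_squares_bound[of "\<bar>F t\<bar>" "\<bar>F' t\<bar>"] by (simp add: E_def abs_mult)
    hence "\<bar>1 - l\<bar> * (2 * \<bar>F t * F' t\<bar>) \<le> \<bar>1 - l\<bar> * E t" by (rule mult_left_mono) simp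
    moreover have "(2 * \<bar>a t\<bar>) * (F' t)\<^sup>2 \<le> (2 * \<bar>a m\<bar>) * E t"
      using m[OF that] by (intro mult_mono) (auto simp: E_def)
    moreover have "\<bar>E' t\<bar> \<le> \<bar>1 - l\<bar> * (2 * \<bar>F t * F' t\<bar>) + (2 * \<bar>a t\<bar>) * (F' t)\<^sup>2"
      unfolding E'_def by (rule order_trans[OF abs_triangle_ineq]) (simp add: abs_mult)
    ultimately show ?thesis by (simp add: K_def distrib_right)
  qed
  have "E x \<le> 0"
  proof (cases "x \<ge> x0")
    case True
    have "exp (- K * x) * E x \<le> exp (- K * x0) * E x0"
    proof (rule DERIV_nonpos_imp_nonincreasing[OF True, of "\<lambda>t. exp (- K * t) * E t"])
      fix t assume t: "x0 \<le> t" "t \<le> x"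
      have "((\<lambda>t. exp (- K * t) * E t) has_real_derivative exp (- K * t) * (E' t - K * E t)) (at t)"
        by (auto intro!: derivative_eq_intros E simp: algebra_simps)
      moreover have "E' t \<le> K * E t" using E'b[of t] t by (simp add: I_def)
      ultimately show "\<exists>y. ((\<lambda>t. exp (- K * t) * E t) has_real_derivative y) (at t) \<and> y \<le> 0"
        by (auto intro!: exI[of _ "exp (- K * t) * (E' t - K * E t)"] simp: mult_le_0_iff)
    qed
    thus ?thesis using zero by (simp add: E_def[of x0] mult_le_0_iff)
  next
    case False
    have "exp (K * x) * E x \<le> exp (K * x0) * E x0"
    proof (rule DERIV_nonneg_imp_nondecreasing[of x x0 "\<lambda>t. exp (K * t) * E t"])
      fix t assume t: "x \<le> t" "t \<le> x0"
      have "((\<lambda>t. exp (K * t) * E t) has_real_derivative exp (K * t) * (E' t + K * E t)) (at t)"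
        by (auto intro!: derivative_eq_intros E simp: algebra_simps)
      moreover have "0 \<le> E' t + K * E t" using E'b[of t] t by (simp add: I_def)
      ultimately show "\<exists>y. ((\<lambda>t. exp (K * t) * E t) has_real_derivative y) (at t) \<and> 0 \<le> y"
        by (auto intro!: exI[of _ "exp (K * t) * (E' t + K * E t)"])
    qed (use False in auto)
    thus ?thesis using zero by (simp add: E_def[of x0] mult_le_0_iff)
  qed
  hence "E x = 0" using E0[of x] by simp
  thus ?thesis by (simp add: E_def sum_power2_eq_zero_iff)
qed

context gibbs
begin

lemma measure_mu_pos:
  assumes "a < b" "{a<..<b} \<subseteq> S" "S \<in> sets borel"
  shows "measure (mu V) S > 0"
proof (rule ccontr)
  assume "\<not> measure (mu V) S > 0"
  hence "emeasure (mu V) S = 0"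
    using mu.emeasure_eq_measure measure_nonneg[of "mu V" S] by (simp add: antisym not_less)
  hence "AE x in mu V. x \<notin> S" using assms(3) by (auto intro!: AE_I[where N=S])
  hence "AE x in lborel. x \<notin> S" by (simp add: AE_mu_iff)
  hence "AE x in lborel. x \<notin> {a<..<b}" by (rule eventually_mono) (use assms(2) in auto)
  hence "emeasure lborel {a<..<b} = 0"
    by (subst (asm) AE_iff_measurable[of "{a<..<b}"]) auto
  thus False using assms(1) by simp
qed

text \<open>At a zero \<open>x\<^sub>0\<close> of the derivative, freezing the eigenfunction to the left of \<open>x\<^sub>0\<close> gives a
  competitor that violates the Poincare inequality, unless the eigenfunction vanishes at
  \<open>x\<^sub>0\<close> too.\<close>

lemma eigenfunction_deriv_nonzero:
  assumes lam: "lam V 1 = ereal l" and l: "l > 0"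
    and F: "\<And>x. (F has_real_derivative F' x) (at x)"
      "\<And>x. (F' has_real_derivative deriv V x * F' x - l * F x) (at x)"
    and L: "L2 V F" "L2 V F'" and mean: "(LINT x|mu V. F x) = 0" and norm: "(LINT x|mu V. (F x)\<^sup>2) > 0"
    and cdf: "\<And>x. rho x * F' x = - l * (LINT y|mu V. indicator {..x} y * F y)"
    and half: "\<And>x. F' x = 0 \<Longrightarrow> (LINT y|mu V. indicator {x..} y * (F' y)\<^sup>2) \<le> l * (LINT y|mu V. indicator {x..} y * (F y)\<^sup>2)"
  shows "F' x \<noteq> 0"
proof
  assume zero: "F' x = 0"
  have cF: "continuous_on UNIV F" using F(1) by (rule continuous_on_UNIV_DERIV)
  have cF': "continuous_on UNIV F'" using F(2) by (rule continuous_on_UNIV_DERIV)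
  \<comment> \<open>Taking the derivative at \<open>max y x\<close> keeps it continuous, so the
    competitor is C1; as \<open>F' x = 0\<close>, it vanishes left of \<open>x\<close>.\<close>
  define \<psi>' where "\<psi>' y = F' (max y x)" for y
  have c\<psi>': "continuous_on UNIV \<psi>'" unfolding \<psi>'_def
    by (intro continuous_on_compose2[OF cF'] continuous_intros) auto
  obtain K where K: "\<And>y. (K has_real_derivative \<psi>' y) (at y)"
    using continuous_antiderivative[OF c\<psi>'] by blast
  define \<psi> where "\<psi> y = K y - K x + F x" for y
  have \<psi>: "(\<psi> has_real_derivative \<psi>' y) (at y)" for y
    unfolding \<psi>_def by (auto intro!: derivative_eq_intros K)
  define c where "c = F x"
  have \<psi>_right: "\<psi> y = F y" if "y \<ge> x" for y
  proof -
    have "\<psi> y - \<psi> x = (LINT t|lborel. indicator {x..y} t * \<psi>' t)"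
      using integral_Icc_deriv[OF that \<psi> c\<psi>'] by simp
    also have "\<dots> = (LINT t|lborel. indicator {x..y} t * F' t)"
      by (rule Bochner_Integration.integral_cong) (auto simp: \<psi>'_def max_def split: split_indicator)
    also have "\<dots> = F y - F x" by (rule integral_Icc_deriv[OF that F(1) cF'])
    finally show ?thesis by (simp add: \<psi>_def)
  qed
  have \<psi>_left: "\<psi> y = c" if "y \<le> x" for y
  proof -
    have "\<psi> x - \<psi> y = (LINT t|lborel. indicator {y..x} t * \<psi>' t)"
      using integral_Icc_deriv[OF that \<psi> c\<psi>'] by simp
    also have "\<dots> = (LINT t|lborel. indicator {y..x} t * 0)"
      by (rule Bochner_Integration.integral_cong) (use zero in \<open>auto simp: \<psi>'_def max_def split: split_indicator\<close>)
    finally show ?thesis by (simp add: \<psi>_def c_def)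
  qed
  have \<psi>_eq: "\<psi> = (\<lambda>y. 1 * (indicator {x..} y * F y) + c * (indicator {..<x} y * 1))"
    using \<psi>_left \<psi>_right by (force simp: fun_eq_iff split: split_indicator)
  have \<psi>'_eq: "\<psi>' = (\<lambda>y. indicator {x..} y * F' y)"
    using zero by (auto simp: fun_eq_iff \<psi>'_def max_def split: split_indicator)
  have LR: "L2 V (\<lambda>y. indicator {x..} y * F y)" "L2 V (\<lambda>y. indicator {..<x} y * 1)" "L2 V (\<lambda>y. indicator {..x} y * F y)"
    by (intro L2_indicator_mult L L2_const; simp)+
  have L\<psi>: "L2 V \<psi>" unfolding \<psi>_eq by (rule L2_lincomb[OF LR(1,2)])
  have L\<psi>': "L2 V \<psi>'" unfolding \<psi>'_eq by (intro L2_indicator_mult L) simp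
  define m where "m = measure (mu V) {..<x}"
  define N where "N = (LINT y|mu V. indicator {x..} y * (F y)\<^sup>2)"
  \<comment> \<open>At a critical point the flux formula makes the integral of \<open>F\<close> over
    the left half-line vanish; the zero mean does the rest.\<close>
  have int_right: "(LINT y|mu V. indicator {x..} y * F y) = 0"
  proof -
    note [measurable] = L2_measurable[OF L(1)]
    have "(LINT y|mu V. indicator {..x} y * F y) = 0" using cdf[of x] zero l by simp
    moreover have "(LINT y|mu V. F y) = (LINT y|mu V. indicator {x..} y * F y + indicator {..x} y * F y)"
    proof (rule integral_cong_AE)
      have "AE y in mu V. y \<noteq> x" using AE_lborel_singleton[of x] by (simp add: AE_mu_iff)
      thus "AE y in mu V. F y = indicator {x..} y * F y + indicator {..x} y * F y"
        by eventually_elim (auto split: split_indicator)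
    qed auto
    ultimately show ?thesis using mean L2_integrable[OF LR(1)] L2_integrable[OF LR(3)] by simp
  qed
  have int1: "(LINT y|mu V. \<psi> y) = c * m"
    unfolding \<psi>_eq using int_right L2_integrable[OF LR(1)] L2_integrable[OF LR(2)]
    by (simp add: m_def)
  have int2: "(LINT y|mu V. (\<psi> y)\<^sup>2) = N + c\<^sup>2 * m"
  proof -
    have "(LINT y|mu V. (\<psi> y)\<^sup>2) = (LINT y|mu V. (indicator {x..} y * F y)\<^sup>2 + c\<^sup>2 * (indicator {..<x} y * 1)\<^sup>2)"
      by (rule Bochner_Integration.integral_cong) (auto simp: \<psi>_eq split: split_indicator)
    also have "\<dots> = (LINT y|mu V. (indicator {x..} y * F y)\<^sup>2) + c\<^sup>2 * (LINT y|mu V. (indicator {..<x} y * 1)\<^sup>2)"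
      using L2_integrable_power2[OF LR(1)] L2_integrable_power2[OF LR(2)]
      by (subst Bochner_Integration.integral_add) auto
    also have "(LINT y|mu V. (indicator {x..} y * F y)\<^sup>2) = N"
      unfolding N_def by (rule Bochner_Integration.integral_cong) (auto split: split_indicator)
    also have "(LINT y|mu V. (indicator {..<x} y * (1::real))\<^sup>2) = (LINT y|mu V. indicator {..<x} y)"
      by (rule Bochner_Integration.integral_cong) (auto split: split_indicator)
    finally show ?thesis by (simp add: m_def)
  qed
  have int3: "(LINT y|mu V. (\<psi>' y)\<^sup>2) \<le> l * N"
  proof -
    have "(LINT y|mu V. (\<psi>' y)\<^sup>2) = (LINT y|mu V. indicator {x..} y * (F' y)\<^sup>2)"
      unfolding \<psi>'_eq by (rule Bochner_Integration.integral_cong) (auto split: split_indicator)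
    thus ?thesis using half[OF zero] by (simp add: N_def)
  qed
  have "l * (N + c\<^sup>2 * m - (c * m)\<^sup>2) \<le> l * N"
    using poincare_C1[OF lam \<psi> c\<psi>' L\<psi> L\<psi>'] int1 int2 int3 by simp
  hence "N + c\<^sup>2 * m - (c * m)\<^sup>2 \<le> N" using l by (simp only: mult_le_cancel_left_pos)
  hence le: "c\<^sup>2 * (m * (1 - m)) \<le> 0" by (simp add: power2_eq_square algebra_simps)
  have m0: "m > 0" unfolding m_def by (rule measure_mu_pos[of "x - 1" x]) auto
  have m1: "m < 1"
  proof -
    have "measure (mu V) {x..} > 0" by (rule measure_mu_pos[of x "x + 1"]) auto
    moreover have "measure (mu V) UNIV = m + measure (mu V) {x..}"
      unfolding m_def by (subst mu.finite_measure_Union[symmetric]) (auto intro!: arg_cong[where f="measure (mu V)"])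
    ultimately show ?thesis by (simp add: measure_mu_UNIV)
  qed
  have "c = 0"
  proof (rule ccontr)
    assume "c \<noteq> 0"
    hence "c\<^sup>2 * (m * (1 - m)) > 0" using m0 m1 by simp
    thus False using le by simp
  qed
  hence "F y = 0" for y
    using linear_ode_unique_zero[OF F continuous_deriv_V, of x y] zero by (simp add: c_def)
  thus False using norm by simp
qed

text \<open>Replacing \<open>d/dx - V' / 2\<close> by \<open>d/dx + p\<close> splits off exactly
  \<open>l\<close>, by the equation for \<open>p'\<close>. Orthogonality to \<open>u\<close> permits
  a second passage to the partner, and there comparing \<open>p\<close> with \<open>- p\<close>
  leaves the Riccati excess \<open>2 p' \<ge> 2 k\<close>.\<close>

lemma gap_above_ground_state:
  fixes u p :: "real \<Rightarrow> real"
  assumes v: "C1c v v'" and u: "\<And>x. u x \<noteq> 0" "\<And>x. (u has_real_derivative - p x * u x) (at x)"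
    and p: "\<And>x. (p has_real_derivative (p x)\<^sup>2 - pot x + l) (at x)"
    and k: "k > 0" "\<And>x. (p x)\<^sup>2 - pot x + l \<ge> k"
    and orth: "(LINT x|lborel. u x * v x) = 0"
  shows "(l + 2 * k) * (LINT x|lborel. (v x)\<^sup>2) \<le> (LINT x|lborel. (v' x - deriv V x / 2 * v x)\<^sup>2)"
proof -
  have cp: "continuous_on UNIV p" using p by (rule continuous_on_UNIV_DERIV)
  have cu: "continuous_on UNIV u" using u(2) by (rule continuous_on_UNIV_DERIV)
  have cp': "continuous_on UNIV (\<lambda>x. (p x)\<^sup>2 - pot x + l)" by (intro continuous_intros cp continuous_pot)
  have pm: "((\<lambda>x. - p x) has_real_derivative - ((p x)\<^sup>2 - pot x + l)) (at x)" for x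
    by (rule DERIV_minus[OF p])
  have cpm: "continuous_on UNIV (\<lambda>x. - ((p x)\<^sup>2 - pot x + l))" using cp' by (rule continuous_on_minus)
  \<comment> \<open>Division by the ground state: \<open>d/dx + p\<close> annihilates
    \<open>u\<close>, so \<open>v' + p v = h' u\<close>, the form that the duality expects.\<close>
  define h where "h x = inverse (u x) * v x" for x
  define h' where "h' x = p x * inverse (u x) * v x + inverse (u x) * v' x" for x
  have h: "C1c h h'" unfolding h_def h'_def
    by (rule C1c_mult[OF v])
      (use u cp cu in \<open>auto intro!: derivative_eq_intros continuous_intros simp: power2_eq_square\<close>)
  have hu: "h x * u x = v x" for x using u(1) by (simp add: h_def)
  have h'u: "h' x * u x = v' x + p x * v x" for x using u(1) by (simp add: h'_def field_simps)
  have "(LINT x|lborel. h x * (u x)\<^sup>2) = 0"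
    using orth by (simp add: hu power2_eq_square mult.assoc[symmetric] mult.commute)
  then obtain w w' where w: "C1c w w'" "\<And>x. w' x - p x * w x = h x * u x"
    "\<And>c. c > 0 \<Longrightarrow> c * (LINT x|lborel. (w x)\<^sup>2) \<le> (LINT x|lborel. (h x * u x)\<^sup>2) \<Longrightarrow>
       c * (LINT x|lborel. (h x * u x)\<^sup>2) \<le> (LINT x|lborel. (h' x * u x)\<^sup>2)"
    by (rule partner_function[OF h u(2) u(1) cp]) (rule that)
  have w0: "C0c w" using w(1) C1c_C0c by blast
  have "2 * k * (LINT x|lborel. (w x)\<^sup>2) \<le> (LINT x|lborel. (w' x - p x * w x)\<^sup>2)"
  proof -
    have "(LINT x|lborel. (w' x - p x * w x)\<^sup>2) = (LINT x|lborel. (w' x - (- p x) * w x)\<^sup>2) +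
      (LINT x|lborel. (((p x)\<^sup>2 - pot x + l) + (p x)\<^sup>2 - (- ((p x)\<^sup>2 - pot x + l)) - (- p x)\<^sup>2) * (w x)\<^sup>2)"
      by (rule integral_square_riccati[OF w(1) p cp' pm cpm])
    moreover have "(LINT x|lborel. (w' x - (- p x) * w x)\<^sup>2) \<ge> 0" by simp
    moreover have "(LINT x|lborel. 2 * k * (w x)\<^sup>2) \<le>
      (LINT x|lborel. (((p x)\<^sup>2 - pot x + l) + (p x)\<^sup>2 - (- ((p x)\<^sup>2 - pot x + l)) - (- p x)\<^sup>2) * (w x)\<^sup>2)"
    proof (rule integral_mono)
      show "integrable lborel (\<lambda>x. 2 * k * (w x)\<^sup>2)"
        by (intro integrable_C0c C0c_mult_left C0c_power2 w0 continuous_intros)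
      show "integrable lborel (\<lambda>x. (((p x)\<^sup>2 - pot x + l) + (p x)\<^sup>2 - (- ((p x)\<^sup>2 - pot x + l)) - (- p x)\<^sup>2) * (w x)\<^sup>2)"
        by (intro integrable_C0c C0c_mult_left C0c_power2 w0 continuous_intros cp continuous_pot)
      show "2 * k * (w x)\<^sup>2 \<le> (((p x)\<^sup>2 - pot x + l) + (p x)\<^sup>2 - (- ((p x)\<^sup>2 - pot x + l)) - (- p x)\<^sup>2) * (w x)\<^sup>2" for x
        using k(2)[of x] by (intro mult_right_mono) auto
    qed
    ultimately have "(LINT x|lborel. 2 * k * (w x)\<^sup>2) \<le> (LINT x|lborel. (w' x - p x * w x)\<^sup>2)"
      by linarith
    thus ?thesis by simp
  qed
  hence gap: "2 * k * (LINT x|lborel. (v x)\<^sup>2) \<le> (LINT x|lborel. (v' x + p x * v x)\<^sup>2)"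
    using w(3)[of "2 * k"] k(1) unfolding w(2) hu h'u by simp
  have eq: "(LINT x|lborel. (v' x - deriv V x / 2 * v x)\<^sup>2) = (LINT x|lborel. (v' x - (- p x) * v x)\<^sup>2) +
      (LINT x|lborel. (deriv (deriv V) x / 2 + (deriv V x / 2)\<^sup>2 - (- ((p x)\<^sup>2 - pot x + l)) - (- p x)\<^sup>2) * (v x)\<^sup>2)"
    by (rule integral_square_riccati[OF v half_deriv_V_DERIV continuous_half_deriv2_V pm cpm])
  have l: "deriv (deriv V) x / 2 + (deriv V x / 2)\<^sup>2 - (- ((p x)\<^sup>2 - pot x + l)) - (- p x)\<^sup>2 = l" for x
    by (simp add: pot_def power_divide)
  show ?thesis using gap eq[unfolded l] by (simp add: distrib_right)
qed

lemma smooth_pot: "smooth pot"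
proof -
  have "smooth (\<lambda>x. deriv (deriv V) x * (1 / 2) + deriv V x * deriv V x * (1 / 4))"
    by (intro smooth_add smooth_mult smooth_const smooth_deriv smooth_V)
  moreover have "(\<lambda>x. deriv (deriv V) x * (1 / 2) + deriv V x * deriv V x * (1 / 4)) = pot"
    by (auto simp: pot_def fun_eq_iff power2_eq_square)
  ultimately show ?thesis by simp
qed

lemma lam_2_ge:
  assumes lam: "lam V 1 = ereal l" and f: "eigfun V l f" "(LINT x|mu V. (f x)\<^sup>2) > 0"
    and k: "k > 0" and convex: "\<And>x. deriv (deriv pot) x \<ge> 2 * k\<^sup>2"
  shows "lam V 2 \<ge> ereal (l + 2 * k)"
proof -
  note pot1 = smooth_DERIV[OF smooth_pot] and pot2 = smooth_DERIV[OF smooth_deriv[OF smooth_pot]]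
  have "k\<^sup>2 > 0" using k by simp
  then obtain R where "\<And>x. \<bar>x\<bar> > R \<Longrightarrow> pot x \<ge> 1"
    using strongly_convex_ge_1[OF pot1 pot2 _ convex] by blast
  \<comment> \<open>Positivity lets \<open>l\<close> be cancelled from the flux and mean identities;
    for \<open>l = 0\<close> the eigenfunction could be constant.\<close>
  hence l: "l > 0" using lam_1_pos[of R] lam by simp
  obtain F F' where F: "\<And>x. (F has_real_derivative F' x) (at x)"
    "\<And>x. (F' has_real_derivative deriv V x * F' x - l * F x) (at x)"
    "L2 V F" "L2 V F'" "l * (LINT x|mu V. F x) = 0" "(LINT x|mu V. (F x)\<^sup>2) > 0"
    "\<And>x. rho x * F' x = - l * (LINT y|mu V. indicator {..x} y * F y)"
    "\<And>x. F' x = 0 \<Longrightarrow> (LINT y|mu V. indicator {x..} y * (F' y)\<^sup>2) \<le> l * (LINT y|mu V. indicator {x..} y * (F y)\<^sup>2)"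
    by (rule eigenfunction_regular[OF f]) (rule that)
  have mean: "(LINT x|mu V. F x) = 0" using F(5) l by simp
  have nz: "F' x \<noteq> 0" for x
    by (rule eigenfunction_deriv_nonzero[OF lam l F(1-4) mean F(6-8)])
  have cF': "continuous_on UNIV F'" using F(2) by (rule continuous_on_UNIV_DERIV)
  define u where "u x = sqrt (rho x) * F' x" for x
  \<comment> \<open>This is \<open>- u' / u\<close>, with the second derivative of \<open>F\<close>
    eliminated by the eigenvalue equation.\<close>
  define p where "p x = l * F x / F' x - deriv V x / 2" for x
  have u0: "u x \<noteq> 0" for x using nz[of x] rho_pos[of x] by (simp add: u_def)
  have u1: "(u has_real_derivative - p x * u x) (at x)" for x
  proof -
    have "(u has_real_derivative - (deriv V x / 2) * sqrt (rho x) * F' x + (deriv V x * F' x - l * F x) * sqrt (rho x)) (at x)"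
      unfolding u_def by (rule DERIV_mult[OF sqrt_rho_DERIV F(2)])
    moreover have "- (deriv V x / 2) * sqrt (rho x) * F' x + (deriv V x * F' x - l * F x) * sqrt (rho x) = - p x * u x"
      unfolding u_def p_def using nz[of x] by (simp add: field_simps)
    ultimately show ?thesis by metis
  qed
  have p1: "(p has_real_derivative (p x)\<^sup>2 - pot x + l) (at x)" for x
  proof -
    have "(p has_real_derivative ((l * F' x) * F' x - (l * F x) * (deriv V x * F' x - l * F x)) / (F' x * F' x)
        - deriv (deriv V) x / 2) (at x)"
      unfolding p_def by (intro DERIV_diff DERIV_divide DERIV_cmult F half_deriv_V_DERIV nz)
    moreover have "((l * F' x) * F' x - (l * F x) * (deriv V x * F' x - l * F x)) / (F' x * F' x)
        - deriv (deriv V) x / 2 = (p x)\<^sup>2 - pot x + l"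
      unfolding p_def pot_def using nz[of x] by (simp add: field_simps power2_eq_square)
    ultimately show ?thesis by metis
  qed
  have u2: "integrable lborel (\<lambda>x. (u x)\<^sup>2)"
  proof -
    have "integrable lborel (\<lambda>x. rho x * (F' x)\<^sup>2)"
      using L2_integrable_power2[OF F(4)] L2_measurable[OF F(4)] by (subst (asm) integrable_mu_iff) auto
    thus ?thesis by (simp add: u_def power_mult_distrib less_imp_le rho_pos)
  qed
  have pk: "(p x)\<^sup>2 - pot x + l \<ge> k" for x
    by (rule riccati_lower_bound[OF u0 u1 u2 p1 pot1 pot2 convex k])
  \<comment> \<open>Of the two constraints, 1 provides the compactly supported partner function
    \<open>v\<close>, and \<open>F\<close> makes \<open>v\<close> orthogonal to
    \<open>u\<close>.\<close>
  show ?thesis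
  proof (rule lam_ge[where b="\<lambda>i. if i = 0 then (\<lambda>_. 1) else F"])
    show "L2 V (if i = 0 then (\<lambda>_. 1) else F)" for i :: nat using F(3) L2_const by auto
    fix \<phi> assume \<phi>: "test_fun \<phi>"
      and o: "\<And>i::nat. i < 2 \<Longrightarrow> (LINT x|mu V. \<phi> x * (if i = 0 then (\<lambda>_. 1) else F) x) = 0"
    have o0: "(LINT x|mu V. \<phi> x) = 0" using o[of 0] by simp
    have o1: "(LINT x|mu V. \<phi> x * F x) = 0" using o[of 1] by simp
    obtain v v' where v: "C1c v v'" "C1c (\<lambda>x. sqrt (rho x) * v x) (\<lambda>x. \<phi> x * rho x)"
      "\<And>c. c > 0 \<Longrightarrow> c * (LINT x|lborel. (v x)\<^sup>2) \<le> (LINT x|lborel. (v' x - deriv V x / 2 * v x)\<^sup>2) \<Longrightarrow>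
       c * (LINT x|mu V. (\<phi> x)\<^sup>2) \<le> (LINT x|mu V. (deriv \<phi> x)\<^sup>2)"
      by (rule test_fun_partner[OF \<phi> o0]) (rule that)
    \<comment> \<open>Integration by parts transfers the orthogonality: the derivative of
      \<open>F * sqrt rho * v\<close> is \<open>u * v + F * \<phi> * rho\<close>.\<close>
    have "(LINT x|lborel. u x * v x) = 0"
    proof -
      have "0 = (LINT x|lborel. F' x * (sqrt (rho x) * v x) + F x * (\<phi> x * rho x))"
        using integral_deriv_C1c[OF C1c_mult[OF v(2) F(1) cF']] by simp
      also have "\<dots> = (LINT x|lborel. F' x * (sqrt (rho x) * v x)) + (LINT x|lborel. F x * (\<phi> x * rho x))"
        by (intro Bochner_Integration.integral_add integrable_C0c C0c_mult_left C1c_C0c[OF v(2)]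
            C1c_C0c_deriv[OF v(2)] cF' continuous_on_UNIV_DERIV[OF F(1)])
      also have "(LINT x|lborel. F x * (\<phi> x * rho x)) = (LINT x|mu V. \<phi> x * F x)"
        using L2_measurable[OF F(3)] L2_measurable[OF L2_test_fun(1)[OF \<phi>]]
        by (subst integral_mu) (auto simp: mult_ac)
      finally show ?thesis using o1 by (simp add: u_def mult_ac)
    qed
    from gap_above_ground_state[OF v(1) u0 u1 p1 k pk this] l k
    show "(l + 2 * k) * (LINT x|mu V. (\<phi> x)\<^sup>2) \<le> (LINT x|mu V. (deriv \<phi> x)\<^sup>2)"
      by (intro v(3)) auto
  qed
qed

end

theorem mainTheorem12:
  fixes V :: "real \<Rightarrow> real" and \<kappa> :: real
  assumes "smooth V"
    and "integrable lborel (\<lambda>x. exp (- V x))"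
    and "\<exists>l. lam V 1 = ereal l \<and> l \<in> sigma_disc V"
    and "\<kappa> > 0"
    and "\<forall>x. deriv (deriv (\<lambda>y. deriv (deriv V) y / 2 + (deriv V y)\<^sup>2 / 4)) x \<ge> 2 * \<kappa>\<^sup>2"
  shows "lam V 2 \<ge> lam V 1 + ereal (2 * \<kappa>)"
proof -
  interpret gibbs V by unfold_locales (use assms in auto)
  obtain l f where l: "lam V 1 = ereal l" and f: "eigfun V l f" "(LINT x|mu V. (f x)\<^sup>2) > 0"
    using assms(3) unfolding sigma_disc_def by blast
  have "pot = (\<lambda>y. deriv (deriv V) y / 2 + (deriv V y)\<^sup>2 / 4)" by (simp add: pot_def fun_eq_iff)
  hence "deriv (deriv pot) x \<ge> 2 * \<kappa>\<^sup>2" for x using assms(5) by simp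
  from lam_2_ge[OF l f assms(4) this] show ?thesis using l by simp
qed

end
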